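(* Let $\mathcal{I} = \langle [m],[n],\{v_i\}_{i=1}^n\rangle$ be a fair division instance in which the valuation function $v_i$ of each agent $i\in[n]$ is nonnegative, normalized, monotone, and subadditive. Given value oracle access to the functions $v_i$, the algorithm Alg (described in full in the context) computes an $8n$-approximation to the Nash optimal allocation in polynomial time. That is, in polynomial time it computes an allocation $\mathcal{B}$ with $\mathrm{NSW}(\mathcal{B})\ge \frac{1}{8n}\,\mathrm{NSW}(\mathcal{N}^* )$, where $\mathcal{N}^*$ is an allocation that maximizes $\mathrm{NSW}$.
   Context: A fair division instance $\langle [m],[n],\{v_i\}_{i=1}^n\rangle$ consists of a set $[m]=\{1,\ldots,m\}$ of indivisible goods, a set $[n]=\{1,\ldots,n\}$ of agents, and for each agent $i$ a valuation function $v_i:2^{[m]}\to\mathbb{R}_+$; write $v_i(g)=v_i(\{g\})$. A valuation $v$ is normalized if $v(\emptyset)=0$, monotone if $v(A)\le v(B)$ whenever $A\subseteq B$, and subadditive if $v(A\cup B)\le v(A)+v(B)$ for all $A,B\subseteq[m]$. An allocation is an $n$-partition $\mathcal{A}=(A_1,\ldots,A_n)$ of $[m]$, agent $i$ receiving $A_i$; its Nash social welfare is $\mathrm{NSW}(\mathcal{A})=\left(\prod_{i=1}^n v_i(A_i)\right)^{1/n}$. A value oracle, queried with an agent $i$ and a set $S\subseteq[m]$, returns $v_i(S)$. Algorithm Alg. (Initialization) Set $t=0$, $\mathrm{SAT}_0=\emptyset$, $\mathrm{UNSAT}_0=[n]$. For each agent $i$, sort the goods so that $v_i(g_1)\ge\cdots\ge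 v_i(g_m)$; if $v_i([m]\setminus\{g_1,\ldots,g_{2n}\})=0$ set $\gamma_i^0=0$, else set $\gamma_i^0=v_i([m])$. (Outer loop) While $\mathrm{UNSAT}_t\ne\emptyset$, do the following. (1) In the complete bipartite graph between $[n]$ and $[m]$ with weight $\log(v_i(g)+\gamma_i^t)$ on edge $(i,g)$, compute a maximum-weight matching $\pi^t$ among those matching every agent, $\pi^t(i)$ being the good matched to $i$. (2) Set $G=[m]\setminus\{\pi^t(i)\}_{i\in[n]}$ and $A=[n]$. (3) While there exist $a'\in A$ and $g'\in G$ with $v_{a'}(g')\ge\frac{1}{2n}v_{a'}(G)$, set $B^t_{a'}=\{g'\}$ and remove $g'$ from $G$ and $a'$ from $A$. (4) Set $(B_i^t)_{i\in A}$ to be the output of the subroutine MovingKnife on $(G,A,\{v_i\}_{i\in A})$. (5) Let $\mathrm{SAT}_{t+1}=\{i\in[n]: v_i(B_i^t)\ge\gamma_i^t\}$ and set $\gamma_i^{t+1}=\gamma_i^t$ for $i\in\mathrm{SAT}_{t+1}$; let $\mathrm{UNSAT}_{t+1}=\{i\in[n]: v_i(B_i^t)<\gamma_i^t\}$ and set $\gamma_i^{t+1}=(1-\frac1m)\gamma_i^t$ for $i\in\mathrm{UNSAT}_{t+1}$. Increase $t$ by one. (Output) Return the allocation $\left(B_1^{t-1}\cup\{\pi^{t-1}(1)\},\ldots,B_n^{t-1}\cup\{\pi^{t-1}(n)\}\right)$. Subroutine MovingKnife on $(G,A,\{v_i\}_{i\in A})$ (with $n$ still the number of agents of the original instance). Start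 with $S=\emptyset$, $\widehat G=G$, $\widehat A=A$, and $P_i=\emptyset$ for all $i\in A$. While $\widehat G\ne\emptyset$ and $\widehat A\ne\emptyset$: move an arbitrary good from $\widehat G$ into $S$; if some $\widehat a\in\widehat A$ has $v_{\widehat a}(S)\ge\frac{1}{2n}v_{\widehat a}(G)$, set $P_{\widehat a}=S$, remove $\widehat a$ from $\widehat A$, and reset $S=\emptyset$. After the loop, if $\widehat G\ne\emptyset$, add the goods of $\widehat G$ to the bundle of the last-indexed agent of $A$. Return $(P_i)_{i\in A}$.
   Formalization: If step (3) serves all agents, A is empty and goods left over go to an arbitrary agent. If m<n, step (1) is undefined and an allocation is output directly. Time: exact real arithmetic at unit cost, polynomial in n, m and the log of the largest ratio of an agent's values. *)

theory Defs
  imports "HOL-Library.Extended_Real" "HOL-Computational_Algebra.Polynomial"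
begin

section \<open>Fair division instances and Nash social welfare\<close>

text \<open>Agents are \<open>{1..n}\<close>, goods are \<open>{1..m}\<close>; \<open>v i S\<close> is the value of agent \<open>i\<close> for \<open>S\<close>.
  Only the values of \<open>v i\<close> on subsets of \<open>{1..m}\<close>, for \<open>i\<close> in \<open>{1..n}\<close>, are constrained.\<close>

definition nonnegative_val :: "nat \<Rightarrow> (nat set \<Rightarrow> real) \<Rightarrow> bool" where
  "nonnegative_val m f \<longleftrightarrow> (\<forall>S. S \<subseteq> {1..m} \<longrightarrow> 0 \<le> f S)"

definition normalized_val :: "(nat set \<Rightarrow> real) \<Rightarrow> bool" where
  "normalized_val f \<longleftrightarrow> f {} = 0"

definition monotone_val :: "nat \<Rightarrow> (nat set \<Rightarrow> real) \<Rightarrow> bool" where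
  "monotone_val m f \<longleftrightarrow> (\<forall>S T. S \<subseteq> T \<and> T \<subseteq> {1..m} \<longrightarrow> f S \<le> f T)"

definition subadditive_val :: "nat \<Rightarrow> (nat set \<Rightarrow> real) \<Rightarrow> bool" where
  "subadditive_val m f \<longleftrightarrow>
     (\<forall>S T. S \<subseteq> {1..m} \<and> T \<subseteq> {1..m} \<longrightarrow> f (S \<union> T) \<le> f S + f T)"

definition subadditive_instance :: "nat \<Rightarrow> nat \<Rightarrow> (nat \<Rightarrow> nat set \<Rightarrow> real) \<Rightarrow> bool" where
  "subadditive_instance n m v \<longleftrightarrow> 1 \<le> n \<and>
     (\<forall>i\<in>{1..n}. nonnegative_val m (v i) \<and> normalized_val (v i) \<and>
                 monotone_val m (v i) \<and> subadditive_val m (v i))"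

definition allocation :: "nat \<Rightarrow> nat \<Rightarrow> (nat \<Rightarrow> nat set) \<Rightarrow> bool" where
  "allocation n m B \<longleftrightarrow>
     (\<forall>i\<in>{1..n}. \<forall>j\<in>{1..n}. i \<noteq> j \<longrightarrow> B i \<inter> B j = {}) \<and> (\<Union>i\<in>{1..n}. B i) = {1..m}"

definition nsw :: "nat \<Rightarrow> (nat \<Rightarrow> nat set \<Rightarrow> real) \<Rightarrow> (nat \<Rightarrow> nat set) \<Rightarrow> real" where
  "nsw n v B = root n (\<Prod>i=1..n. v i (B i))"

definition nash_optimal ::
    "nat \<Rightarrow> nat \<Rightarrow> (nat \<Rightarrow> nat set \<Rightarrow> real) \<Rightarrow> (nat \<Rightarrow> nat set) \<Rightarrow> bool" where
  "nash_optimal n m v N \<longleftrightarrow>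
     allocation n m N \<and> (\<forall>B. allocation n m B \<longrightarrow> nsw n v B \<le> nsw n v N)"

definition nash_approx ::
    "real \<Rightarrow> nat \<Rightarrow> nat \<Rightarrow> (nat \<Rightarrow> nat set \<Rightarrow> real) \<Rightarrow> (nat \<Rightarrow> nat set) \<Rightarrow> bool" where
  "nash_approx \<alpha> n m v B \<longleftrightarrow>
     allocation n m B \<and> (\<forall>N. nash_optimal n m v N \<longrightarrow> nsw n v B \<ge> 1 / \<alpha> * nsw n v N)"


section \<open>The algorithm\<close>

text \<open>The algorithm leaves choices open (order among equal goods, optimal matching, pairs and
  goods processed by the loops), so it is a relation containing the outcomes of all choices.
  \<open>loop_result R s s'\<close>: iterating \<open>R\<close> from \<open>s\<close> until no step is possible can end in \<open>s'\<close>.\<close>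

definition loop_result :: "('s \<Rightarrow> 's \<Rightarrow> bool) \<Rightarrow> 's \<Rightarrow> 's \<Rightarrow> bool" where
  "loop_result R s s' \<longleftrightarrow> rtranclp R s s' \<and> (\<nexists>s''. R s' s'')"

text \<open>The real logarithm has \<open>ln 0 = 0\<close>; edge weights need \<open>log 0 = -\<infinity>\<close>.\<close>

definition elog :: "real \<Rightarrow> ereal" where
  "elog x = (if x > 0 then ereal (ln x) else -\<infinity>)"

definition matching :: "nat \<Rightarrow> nat \<Rightarrow> (nat \<Rightarrow> nat) \<Rightarrow> bool" where
  "matching n m \<pi> \<longleftrightarrow> inj_on \<pi> {1..n} \<and> \<pi> ` {1..n} \<subseteq> {1..m}"

definition matching_weight ::
    "nat \<Rightarrow> (nat \<Rightarrow> nat set \<Rightarrow> real) \<Rightarrow> (nat \<Rightarrow> real) \<Rightarrow> (nat \<Rightarrow> nat) \<Rightarrow> ereal" where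
  "matching_weight n v \<gamma> \<pi> = (\<Sum>i=1..n. elog (v i {\<pi> i} + \<gamma> i))"

definition max_weight_matching ::
    "nat \<Rightarrow> nat \<Rightarrow> (nat \<Rightarrow> nat set \<Rightarrow> real) \<Rightarrow> (nat \<Rightarrow> real) \<Rightarrow> (nat \<Rightarrow> nat) \<Rightarrow> bool" where
  "max_weight_matching n m v \<gamma> \<pi> \<longleftrightarrow> matching n m \<pi> \<and>
     (\<forall>\<sigma>. matching n m \<sigma> \<longrightarrow> matching_weight n v \<gamma> \<sigma> \<le> matching_weight n v \<gamma> \<pi>)"

text \<open>States are (unassigned goods, unassigned agents, bundles).\<close>

inductive single_good_step ::
    "nat \<Rightarrow> (nat \<Rightarrow> nat set \<Rightarrow> real) \<Rightarrow>
     nat set \<times> nat set \<times> (nat \<Rightarrow> nat set) \<Rightarrow> nat set \<times> nat set \<times> (nat \<Rightarrow> nat set) \<Rightarrow> bool"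
  for n v where
  "\<lbrakk>a \<in> A; g \<in> G; v a {g} \<ge> 1 / (2 * real n) * v a G\<rbrakk>
   \<Longrightarrow> single_good_step n v (G, A, B) (G - {g}, A - {a}, B(a := {g}))"

text \<open>The argument \<open>G\<close> is the set of goods the subroutine was called with; states are
  \<open>(S, Gh, Ah, P)\<close> with \<open>Gh\<close> and \<open>Ah\<close> the remaining goods and agents.\<close>

inductive knife_step ::
    "nat \<Rightarrow> (nat \<Rightarrow> nat set \<Rightarrow> real) \<Rightarrow> nat set \<Rightarrow>
     nat set \<times> nat set \<times> nat set \<times> (nat \<Rightarrow> nat set) \<Rightarrow>
     nat set \<times> nat set \<times> nat set \<times> (nat \<Rightarrow> nat set) \<Rightarrow> bool"
  for n v G where
  assign: "\<lbrakk>g \<in> Gh; a \<in> Ah; v a (insert g S) \<ge> 1 / (2 * real n) * v a G\<rbrakk>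
   \<Longrightarrow> knife_step n v G (S, Gh, Ah, P) ({}, Gh - {g}, Ah - {a}, P(a := insert g S))"
| extend: "\<lbrakk>g \<in> Gh; Ah \<noteq> {}; \<forall>a\<in>Ah. v a (insert g S) < 1 / (2 * real n) * v a G\<rbrakk>
   \<Longrightarrow> knife_step n v G (S, Gh, Ah, P) (insert g S, Gh - {g}, Ah, P)"

text \<open>Used only for nonempty \<open>A\<close>, so that there is a last-indexed agent \<open>Max A\<close>.\<close>

definition moving_knife ::
    "nat \<Rightarrow> (nat \<Rightarrow> nat set \<Rightarrow> real) \<Rightarrow> nat set \<Rightarrow> nat set \<Rightarrow> (nat \<Rightarrow> nat set) \<Rightarrow> bool" where
  "moving_knife n v G A P \<longleftrightarrow>
     (\<exists>S Gh Ah P0. loop_result (knife_step n v G) ({}, G, A, \<lambda>_. {}) (S, Gh, Ah, P0) \<and>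
                   P = P0(Max A := P0 (Max A) \<union> Gh))"

text \<open>One round of bundle formation. If every agent already received a single good, there is no
  last-indexed agent to take the remaining goods; they then go to an arbitrary agent,
  so that the outcome is a partition of all goods.\<close>

definition round_bundles ::
    "nat \<Rightarrow> nat \<Rightarrow> (nat \<Rightarrow> nat set \<Rightarrow> real) \<Rightarrow> (nat \<Rightarrow> nat) \<Rightarrow> (nat \<Rightarrow> nat set) \<Rightarrow> bool" where
  "round_bundles n m v \<pi> B \<longleftrightarrow>
     (\<exists>G A B1.
        loop_result (single_good_step n v) ({1..m} - \<pi> ` {1..n}, {1..n}, \<lambda>_. {}) (G, A, B1) \<and>
        (if A = {} then \<exists>h\<in>{1..n}. B = B1(h := B1 h \<union> G)
         else \<exists>P. moving_knife n v G A P \<and> B = (\<lambda>i. if i \<in> A then P i else B1 i)))"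

text \<open>State of the outer loop after \<open>t\<close> rounds: the thresholds \<open>\<gamma>\<^sup>t\<close>, the set \<open>UNSAT\<^sub>t\<close>, and the
  bundles \<open>B\<^sub>i\<close> together with the matched goods of round \<open>t - 1\<close> (empty for \<open>t = 0\<close>).\<close>

record alg_state =
  thr :: "nat \<Rightarrow> real"
  unsat :: "nat set"
  bundles :: "nat \<Rightarrow> nat set"

definition alg_init :: "nat \<Rightarrow> nat \<Rightarrow> (nat \<Rightarrow> nat set \<Rightarrow> real) \<Rightarrow> alg_state \<Rightarrow> bool" where
  "alg_init n m v s \<longleftrightarrow> unsat s = {1..n} \<and> bundles s = (\<lambda>_. {}) \<and>
     (\<forall>i\<in>{1..n}. \<exists>gs. distinct gs \<and> set gs = {1..m} \<and>
        sorted_wrt (\<lambda>g h. v i {g} \<ge> v i {h}) gs \<and>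
        thr s i = (if v i ({1..m} - set (take (2 * n) gs)) = 0 then 0 else v i {1..m}))"

definition alg_iteration ::
    "nat \<Rightarrow> nat \<Rightarrow> (nat \<Rightarrow> nat set \<Rightarrow> real) \<Rightarrow> alg_state \<Rightarrow> alg_state \<Rightarrow> bool" where
  "alg_iteration n m v s s' \<longleftrightarrow>
     (\<exists>\<pi> B. max_weight_matching n m v (thr s) \<pi> \<and> round_bundles n m v \<pi> B \<and>
        unsat s' = {i\<in>{1..n}. v i (B i) < thr s i} \<and>
        thr s' = (\<lambda>i. if i \<in> unsat s' then (1 - 1 / real m) * thr s i else thr s i) \<and>
        bundles s' = (\<lambda>i. if i \<in> {1..n} then B i \<union> {\<pi> i} else {}))"

inductive alg_run :: "nat \<Rightarrow> nat \<Rightarrow> (nat \<Rightarrow> nat set \<Rightarrow> real) \<Rightarrow> nat \<Rightarrow> alg_state \<Rightarrow> bool"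
  for n m v where
  init: "alg_init n m v s \<Longrightarrow> alg_run n m v 0 s"
| iter: "\<lbrakk>alg_run n m v t s; unsat s \<noteq> {}; alg_iteration n m v s s'\<rbrakk>
         \<Longrightarrow> alg_run n m v (Suc t) s'"

definition alg_output ::
    "nat \<Rightarrow> nat \<Rightarrow> (nat \<Rightarrow> nat set \<Rightarrow> real) \<Rightarrow> (nat \<Rightarrow> nat set) \<Rightarrow> bool" where
  "alg_output n m v B \<longleftrightarrow> (\<exists>t s. alg_run n m v t s \<and> unsat s = {} \<and> B = bundles s)"

text \<open>No run gets stuck before the exit condition holds or exceeds \<open>T\<close> rounds.\<close>

definition alg_halts_within ::
    "nat \<Rightarrow> nat \<Rightarrow> (nat \<Rightarrow> nat set \<Rightarrow> real) \<Rightarrow> real \<Rightarrow> bool" where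
  "alg_halts_within n m v T \<longleftrightarrow>
     (\<forall>t s. alg_run n m v t s \<longrightarrow>
        real t \<le> T \<and> (unsat s \<noteq> {} \<longrightarrow> (\<exists>s'. alg_iteration n m v s s')))"


section \<open>Running time: real RAM programs with a value oracle\<close>

text \<open>The memory consists of arrays of natural numbers and arrays of reals, with index lists
  whose length is fixed by the program text. There is no multiplication of natural numbers (with
  unit costs it would allow exponentially long integers); real arithmetic is exact, and reals cannot
  be converted back to natural numbers. Every assignment, test and
  oracle query costs one unit; as expressions have constant size, charging for their evaluation as
  well would change running times by a constant factor only.\<close>

datatype nexp =
    NConst nat
  | NVar string "nexp list"
  | NAdd nexp nexp
  | NSub nexp nexp

datatype rexp =
    RNat nexp
  | RVar string "nexp list"
  | RAdd rexp rexp
  | RSub rexp rexp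
  | RMul rexp rexp
  | RDiv rexp rexp

datatype bexp =
    NLess nexp nexp
  | RLess rexp rexp
  | BNot bexp
  | BAnd bexp bexp

text \<open>\<open>VQuery x is a y js\<close> stores in \<open>x[is]\<close> the value of agent \<open>a\<close> for the set of goods whose
  characteristic vector is the row \<open>y[js, _]\<close>.\<close>

datatype com =
    Skip
  | NAssign string "nexp list" nexp
  | RAssign string "nexp list" rexp
  | VQuery string "nexp list" nexp string "nexp list"
  | Seq com com
  | Cond bexp com com
  | While bexp com

record mem =
  nmem :: "string \<Rightarrow> nat list \<Rightarrow> nat"
  rmem :: "string \<Rightarrow> nat list \<Rightarrow> real"

primrec nval :: "mem \<Rightarrow> nexp \<Rightarrow> nat" where
  "nval \<sigma> (NConst k) = k"
| "nval \<sigma> (NVar x is) = nmem \<sigma> x (map (nval \<sigma>) is)"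
| "nval \<sigma> (NAdd a b) = nval \<sigma> a + nval \<sigma> b"
| "nval \<sigma> (NSub a b) = nval \<sigma> a - nval \<sigma> b"

primrec rval :: "mem \<Rightarrow> rexp \<Rightarrow> real" where
  "rval \<sigma> (RNat a) = real (nval \<sigma> a)"
| "rval \<sigma> (RVar x is) = rmem \<sigma> x (map (nval \<sigma>) is)"
| "rval \<sigma> (RAdd a b) = rval \<sigma> a + rval \<sigma> b"
| "rval \<sigma> (RSub a b) = rval \<sigma> a - rval \<sigma> b"
| "rval \<sigma> (RMul a b) = rval \<sigma> a * rval \<sigma> b"
| "rval \<sigma> (RDiv a b) = rval \<sigma> a / rval \<sigma> b"

primrec bval :: "mem \<Rightarrow> bexp \<Rightarrow> bool" where
  "bval \<sigma> (NLess a b) \<longleftrightarrow> nval \<sigma> a < nval \<sigma> b"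
| "bval \<sigma> (RLess a b) \<longleftrightarrow> rval \<sigma> a < rval \<sigma> b"
| "bval \<sigma> (BNot b) \<longleftrightarrow> \<not> bval \<sigma> b"
| "bval \<sigma> (BAnd b c) \<longleftrightarrow> bval \<sigma> b \<and> bval \<sigma> c"

definition nupd :: "string \<Rightarrow> nat list \<Rightarrow> nat \<Rightarrow> mem \<Rightarrow> mem" where
  "nupd x ks a \<sigma> = \<sigma>\<lparr>nmem := (nmem \<sigma>)(x := (nmem \<sigma> x)(ks := a))\<rparr>"

definition rupd :: "string \<Rightarrow> nat list \<Rightarrow> real \<Rightarrow> mem \<Rightarrow> mem" where
  "rupd x ks r \<sigma> = \<sigma>\<lparr>rmem := (rmem \<sigma>)(x := (rmem \<sigma> x)(ks := r))\<rparr>"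

definition row_set :: "nat \<Rightarrow> mem \<Rightarrow> string \<Rightarrow> nat list \<Rightarrow> nat set" where
  "row_set m \<sigma> y ks = {g\<in>{1..m}. nmem \<sigma> y (ks @ [g]) \<noteq> 0}"

text \<open>\<open>exec m v c \<sigma> t \<sigma>'\<close>: with value oracle \<open>v\<close>, program \<open>c\<close> started in \<open>\<sigma>\<close> halts
  after \<open>t\<close> time units in \<open>\<sigma>'\<close>.\<close>

inductive exec ::
    "nat \<Rightarrow> (nat \<Rightarrow> nat set \<Rightarrow> real) \<Rightarrow> com \<Rightarrow> mem \<Rightarrow> nat \<Rightarrow> mem \<Rightarrow> bool"
  for m v where
  Skip: "exec m v Skip \<sigma> 1 \<sigma>"
| NAssign: "exec m v (NAssign x is a) \<sigma> 1 (nupd x (map (nval \<sigma>) is) (nval \<sigma> a) \<sigma>)"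
| RAssign: "exec m v (RAssign x is r) \<sigma> 1 (rupd x (map (nval \<sigma>) is) (rval \<sigma> r) \<sigma>)"
| VQuery: "exec m v (VQuery x is a y js) \<sigma> 1
    (rupd x (map (nval \<sigma>) is) (v (nval \<sigma> a) (row_set m \<sigma> y (map (nval \<sigma>) js))) \<sigma>)"
| Seq: "\<lbrakk>exec m v c \<sigma> t \<sigma>'; exec m v d \<sigma>' t' \<sigma>''\<rbrakk> \<Longrightarrow> exec m v (Seq c d) \<sigma> (t + t') \<sigma>''"
| CondTrue: "\<lbrakk>bval \<sigma> b; exec m v c \<sigma> t \<sigma>'\<rbrakk> \<Longrightarrow> exec m v (Cond b c d) \<sigma> (Suc t) \<sigma>'"
| CondFalse: "\<lbrakk>\<not> bval \<sigma> b; exec m v d \<sigma> t \<sigma>'\<rbrakk> \<Longrightarrow> exec m v (Cond b c d) \<sigma> (Suc t) \<sigma>'"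
| WhileFalse: "\<not> bval \<sigma> b \<Longrightarrow> exec m v (While b c) \<sigma> 1 \<sigma>"
| WhileTrue: "\<lbrakk>bval \<sigma> b; exec m v c \<sigma> t \<sigma>'; exec m v (While b c) \<sigma>' t' \<sigma>''\<rbrakk>
    \<Longrightarrow> exec m v (While b c) \<sigma> (Suc (t + t')) \<sigma>''"

inductive_cases exec_elims:
  "exec m v Skip \<sigma> t \<sigma>'"
  "exec m v (NAssign x is a) \<sigma> t \<sigma>'"
  "exec m v (RAssign x is r) \<sigma> t \<sigma>'"
  "exec m v (VQuery x is a y js) \<sigma> t \<sigma>'"
  "exec m v (Seq c d) \<sigma> t \<sigma>'"
  "exec m v (Cond b c d) \<sigma> t \<sigma>'"
  "exec m v (While b c) \<sigma> t \<sigma>'"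

lemma exec_deterministic:
  assumes "exec m v c \<sigma> t \<sigma>1" and "exec m v c \<sigma> u \<sigma>2"
  shows "t = u \<and> \<sigma>1 = \<sigma>2"
  using assms
proof (induction arbitrary: u \<sigma>2 rule: exec.induct)
  case (Seq c \<sigma> t \<sigma>' d t' \<sigma>'')
  from Seq.prems Seq.IH show ?case by (elim exec_elims(5)) blast
next
  case (CondTrue \<sigma> b c t \<sigma>' d)
  from CondTrue.prems CondTrue.hyps CondTrue.IH show ?case by (elim exec_elims(6)) blast+
next
  case (CondFalse \<sigma> b d t \<sigma>' c)
  from CondFalse.prems CondFalse.hyps CondFalse.IH show ?case by (elim exec_elims(6)) blast+
next
  case (WhileFalse \<sigma> b c)
  from WhileFalse.prems show ?case
    by (rule exec_elims(7)) (use WhileFalse.hyps in simp_all)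
next
  case (WhileTrue \<sigma> b c t \<sigma>' t' \<sigma>'')
  from WhileTrue.prems show ?case
  proof (rule exec_elims(7))
    fix r \<rho> r'
    assume u: "u = Suc (r + r')" and r: "exec m v c \<sigma> r \<rho>" "exec m v (While b c) \<rho> r' \<sigma>2"
    from WhileTrue.IH(1)[OF r(1)] have "t = r" "\<sigma>' = \<rho>" by auto
    with WhileTrue.IH(2) r(2) u show ?thesis by blast
  qed (use WhileTrue.hyps in blast)
qed (auto elim: exec_elims(1) exec_elims(2) exec_elims(3) exec_elims(4))

definition input_mem :: "nat \<Rightarrow> nat \<Rightarrow> mem" where
  "input_mem n m = nupd ''n'' [] n (nupd ''m'' [] m \<lparr>nmem = (\<lambda>_ _. 0), rmem = (\<lambda>_ _. 0)\<rparr>)"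

text \<open>The output is read off the array \<open>owner\<close>, which holds the owner of each good.\<close>

definition output_bundles :: "nat \<Rightarrow> mem \<Rightarrow> nat \<Rightarrow> nat set" where
  "output_bundles m \<sigma> i = {g\<in>{1..m}. nmem \<sigma> ''owner'' [g] = i}"

text \<open>Input size. The number of rounds grows with the logarithm of the ratio between the
  largest and the smallest positive value of an agent. For rational values whose numerators and
  denominators have at most \<open>b\<close> bits, \<open>value_bits n m v \<le> 2 * b\<close>.\<close>

definition value_bits :: "nat \<Rightarrow> nat \<Rightarrow> (nat \<Rightarrow> nat set \<Rightarrow> real) \<Rightarrow> real" where
  "value_bits n m v =
     log 2 (Max (insert 1 {v i {1..m} / v i S | i S. i \<in> {1..n} \<and> S \<subseteq> {1..m} \<and> 0 < v i S}))"

definition input_size :: "nat \<Rightarrow> nat \<Rightarrow> (nat \<Rightarrow> nat set \<Rightarrow> real) \<Rightarrow> real" where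
  "input_size n m v = real n + real m + value_bits n m v"

end

theory Submission
  imports Defs "HOL-Library.FuncSet"
begin

text \<open>
  In every round, the bundle of an agent \<open>i\<close> is worth at least the fraction \<open>1 / (2 n)\<close> of a set that
  misses at most \<open>2 n\<close> goods. Hence, whenever \<open>i\<close> is unsatisfied, all goods but \<open>2 n\<close> are
  together worth at most \<open>2 n\<close> times the threshold, and after lowering the threshold \<open>\<gamma>\<close> at most \<open>4 n \<gamma>\<close>.
  So a bundle of an optimal allocation with best good \<open>g\<close> is worth at most \<open>4 n (v i {g} + \<gamma>)\<close>,
  and comparing the final matching with the one that assigns these best goods loses only another factor 2.
  The bundle of an agent with nonzero threshold always has positive value, so the thresholds never drop
  far below the smallest positive value, which bounds the number of rounds.

  Only products of weights are compared, so the matchings can be computed without logarithms by the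
  Hungarian method in multiplicative form. Apart from the outer loop, all loops of the program run over
  the agents or the goods; such programs denote total functions and have polynomial cost.
\<close>

text \<open>The obstacle to termination is an agent whose whole value lies in \<open>2 * n\<close>
  goods. A round may give such an agent a worthless bundle again and again, and a positive threshold
  would then be lowered for ever. The initialization sets exactly these thresholds to 0. Every other
  agent values some good outside any \<open>2 * n\<close> goods, so the guarantee of a round forces
  a positive bundle value. A weight 0 has logarithm minus infinity, and possibly no matching avoids
  such edges. When the matching is compared with an allocation of positive welfare, the best goods
  of that allocation form a matching of finite weight, so the problem disappears. The program has to
  solve the general case and therefore replaces 0 by a positive number that is small enough. The
  algorithm is a relation that admits all choices, and the bounds on rounds and welfare hold for all
  its runs. The program makes one choice at each point and is shown to follow a run of the relation;
  it inherits both bounds from there.\<close>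

declare One_nat_def [simp del]

section \<open>The bundles of a round\<close>

text \<open>For \<open>m < n\<close> no matching covers all agents, so the algorithm cannot take a
  step; that case is settled separately in \<open>nash_approx_few_goods\<close>.\<close>

locale fair_instance =
  fixes n m :: nat and v :: "nat \<Rightarrow> nat set \<Rightarrow> real"
  assumes inst: "subadditive_instance n m v" and n_le_m: "n \<le> m"
begin

lemma n_pos: "1 \<le> n" and m_pos: "1 \<le> m"
  using inst n_le_m by (auto simp: subadditive_instance_def)

lemma val_nonneg: "\<lbrakk>i \<in> {1..n}; S \<subseteq> {1..m}\<rbrakk> \<Longrightarrow> 0 \<le> v i S"
  using inst unfolding subadditive_instance_def nonnegative_val_def by blast

lemma val_empty: "i \<in> {1..n} \<Longrightarrow> v i {} = 0"
  using inst unfolding subadditive_instance_def normalized_val_def by blast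

lemma val_mono: "\<lbrakk>i \<in> {1..n}; S \<subseteq> T; T \<subseteq> {1..m}\<rbrakk> \<Longrightarrow> v i S \<le> v i T"
  using inst unfolding subadditive_instance_def monotone_val_def by blast

lemma val_Un: "\<lbrakk>i \<in> {1..n}; S \<subseteq> {1..m}; T \<subseteq> {1..m}\<rbrakk> \<Longrightarrow> v i (S \<union> T) \<le> v i S + v i T"
  using inst unfolding subadditive_instance_def subadditive_val_def by blast

lemma val_insert:
  assumes "i \<in> {1..n}" "S \<subseteq> {1..m}" "g \<in> {1..m}"
  shows "v i (insert g S) \<le> v i S + v i {g}"
  using val_Un[of i S "{g}"] assms by simp

lemma val_le_card:
  assumes i: "i \<in> {1..n}" and S: "S \<subseteq> {1..m}" and c: "\<And>g. g \<in> S \<Longrightarrow> v i {g} \<le> c"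
  shows "v i S \<le> real (card S) * c"
proof -
  have "finite S" using S finite_subset by blast
  then show ?thesis using S c
  proof (induction S)
    case empty
    then show ?case using val_empty[OF i] by simp
  next
    case (insert g S)
    have "v i (insert g S) \<le> v i S + v i {g}" using val_insert[OF i, of S g] insert.prems by simp
    moreover have "v i S \<le> real (card S) * c" using insert by simp
    moreover have "v i {g} \<le> c" using insert.prems by simp
    ultimately show ?case using insert.hyps by (simp add: algebra_simps)
  qed
qed

section \<open>Shares, and the value that survives the loss of few goods\<close>

definition share :: "nat \<Rightarrow> nat set \<Rightarrow> real" where
  "share a G = 1 / (2 * real n) * v a G"

lemma share_empty: "a \<in> {1..n} \<Longrightarrow> share a {} = 0"
  by (simp add: share_def val_empty)

lemma share_nonneg: "\<lbrakk>a \<in> {1..n}; G \<subseteq> {1..m}\<rbrakk> \<Longrightarrow> 0 \<le> share a G"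
  by (simp add: share_def val_nonneg)

lemma share_le_iff: "share a G \<le> x \<longleftrightarrow> v a G \<le> 2 * real n * x"
  using n_pos by (simp add: share_def field_simps)

text \<open>The number \<open>2 * n\<close> counts the \<open>n\<close> matched goods and at most
  \<open>n\<close> goods handed out singly. The instance \<open>x = 0\<close> characterizes the
  agents whose threshold starts at 0.\<close>

definition few_removed :: "nat \<Rightarrow> real \<Rightarrow> bool" where
  "few_removed i x \<longleftrightarrow> (\<exists>R. R \<subseteq> {1..m} \<and> card R \<le> 2 * n \<and> v i ({1..m} - R) \<le> x)"

lemma few_removed_mono: "\<lbrakk>few_removed i x; x \<le> y\<rbrakk> \<Longrightarrow> few_removed i y"
  unfolding few_removed_def by (meson order_trans)

section \<open>Goods handed out singly\<close>

definition single_inv :: "nat set \<Rightarrow> nat set \<times> nat set \<times> (nat \<Rightarrow> nat set) \<Rightarrow> bool" where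
  "single_inv G0 = (\<lambda>(G, A, B). G \<subseteq> G0 \<and> A \<subseteq> {1..n} \<and> (\<forall>i. i \<notin> {1..n} - A \<longrightarrow> B i = {}) \<and>
     (\<Union>i\<in>{1..n}. B i) \<union> G = G0 \<and> (\<forall>i\<in>{1..n}. B i \<inter> G = {}) \<and>
     (\<forall>i\<in>{1..n}. \<forall>j\<in>{1..n}. i \<noteq> j \<longrightarrow> B i \<inter> B j = {}) \<and>
     card ({1..m} - G) + card A \<le> 2 * n \<and>
     (\<forall>i\<in>{1..n} - A. few_removed i (2 * real n * v i (B i))))"

text \<open>Each step takes away one good and one agent, so the number of missing goods plus the
  number of waiting agents never changes. It starts at no more than \<open>n + n\<close>, which
  keeps the missing goods within \<open>2 * n\<close>.\<close>

lemma single_inv_step: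
  assumes "single_good_step n v s s'" "single_inv G0 s" "G0 \<subseteq> {1..m}"
  shows "single_inv G0 s'"
  using assms(1)
proof cases
  case (1 a A g G B)
  have inv: "G \<subseteq> G0" "A \<subseteq> {1..n}" "\<forall>i. i \<notin> {1..n} - A \<longrightarrow> B i = {}"
     "(\<Union>i\<in>{1..n}. B i) \<union> G = G0" "\<forall>i\<in>{1..n}. B i \<inter> G = {}"
     "\<forall>i\<in>{1..n}. \<forall>j\<in>{1..n}. i \<noteq> j \<longrightarrow> B i \<inter> B j = {}"
     "card ({1..m} - G) + card A \<le> 2 * n"
     "\<forall>i\<in>{1..n} - A. few_removed i (2 * real n * v i (B i))"
    using assms(2) unfolding 1 single_inv_def prod.case by - (elim conjE, assumption)+
  have fA: "finite A" using inv(2) finite_subset by blast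
  have a: "a \<in> {1..n}" using 1 inv by auto
  have Gm: "G \<subseteq> {1..m}" using inv(1) assms(3) by blast
  have "{1..m} - (G - {g}) = insert g ({1..m} - G)" using 1 Gm by auto
  then have c1: "card ({1..m} - (G - {g})) = Suc (card ({1..m} - G))" using 1 by simp
  have c2: "Suc (card (A - {a})) = card A" using 1 fA by (meson card_Suc_Diff1)
  have un: "(\<Union>i\<in>{1..n}. (B(a := {g})) i) \<union> (G - {g}) = G0"
  proof -
    have "B a = {}" using inv(3) 1 by auto
    then have "(\<Union>i\<in>{1..n}. (B(a := {g})) i) = insert g (\<Union>i\<in>{1..n}. B i)"
      using a by (auto split: if_splits)
    then show ?thesis using inv(4) 1 by auto
  qed
  \<comment> \<open>The witness consists of all goods missing before \<open>g\<close> is taken,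
    because the test of the step refers to the share of that very \<open>G\<close>.\<close>
  have fr: "few_removed a (2 * real n * v a {g})"
    unfolding few_removed_def
  proof (intro exI conjI)
    show "card ({1..m} - G) \<le> 2 * n" using inv(7) by simp
    have "{1..m} - ({1..m} - G) = G" using Gm by blast
    then show "v a ({1..m} - ({1..m} - G)) \<le> 2 * real n * v a {g}"
      using 1(5) n_pos by (simp add: field_simps)
  qed auto
  have "G - {g} \<subseteq> G0" "A - {a} \<subseteq> {1..n}" using inv by auto
  moreover have "\<forall>i. i \<notin> {1..n} - (A - {a}) \<longrightarrow> (B(a := {g})) i = {}" using inv(3) a by auto
  moreover have "\<forall>i\<in>{1..n}. (B(a := {g})) i \<inter> (G - {g}) = {}" using inv(5) by auto
  moreover have "\<forall>i\<in>{1..n}. \<forall>j\<in>{1..n}. i \<noteq> j \<longrightarrow> (B(a := {g})) i \<inter> (B(a := {g})) j = {}"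
    using inv(5,6) 1(4) by auto
  moreover have "card ({1..m} - (G - {g})) + card (A - {a}) \<le> 2 * n" using inv(7) c1 c2 by simp
  moreover have "\<forall>i\<in>{1..n} - (A - {a}). few_removed i (2 * real n * v i ((B(a := {g})) i))"
    using inv(8) fr by auto
  ultimately show ?thesis unfolding 1(2) single_inv_def prod.case
    using un by (intro conjI) assumption+
qed

lemma single_inv_rtranclp:
  assumes "(single_good_step n v)\<^sup>*\<^sup>* s s'" "single_inv G0 s" "G0 \<subseteq> {1..m}"
  shows "single_inv G0 s'"
  using assms by (induction rule: rtranclp_induct) (blast intro: single_inv_step)+

lemma single_inv_init:
  assumes "matching n m \<pi>"
  shows "single_inv ({1..m} - \<pi> ` {1..n}) ({1..m} - \<pi> ` {1..n}, {1..n}, \<lambda>_. {})"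
proof -
  have "\<pi> ` {1..n} \<subseteq> {1..m}" using assms by (auto simp: matching_def)
  then have "{1..m} - ({1..m} - \<pi> ` {1..n}) = \<pi> ` {1..n}" by blast
  then have "card ({1..m} - ({1..m} - \<pi> ` {1..n})) \<le> n"
    using card_image_le[of "{1..n}" \<pi>] by simp
  then show ?thesis by (auto simp: single_inv_def)
qed

section \<open>The moving knife\<close>

definition knife_inv ::
    "nat set \<Rightarrow> nat set \<Rightarrow> nat set \<times> nat set \<times> nat set \<times> (nat \<Rightarrow> nat set) \<Rightarrow> bool" where
  "knife_inv G A = (\<lambda>(S, Gh, Ah, P). S \<inter> Gh = {} \<and> Ah \<subseteq> A \<and>
     (\<forall>i. i \<notin> A - Ah \<longrightarrow> P i = {}) \<and> (\<Union>i\<in>A. P i) \<union> S \<union> Gh = G \<and>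
     (\<forall>i\<in>A. P i \<inter> (S \<union> Gh) = {}) \<and> (\<forall>i\<in>A. \<forall>j\<in>A. i \<noteq> j \<longrightarrow> P i \<inter> P j = {}) \<and>
     (\<forall>i\<in>A - Ah. share i G \<le> v i (P i)) \<and> (\<forall>i\<in>Ah. v i S \<le> share i G) \<and>
     (Ah = {} \<longrightarrow> S = {}) \<and>
     (\<forall>i\<in>Ah. v i G \<le> v i (S \<union> Gh) + 2 * real (card (A - Ah)) * share i G))"

text \<open>The last conjunct of \<open>knife_inv\<close> is the budget of a waiting agent: a piece
  that goes to somebody else was worth at most one share to it before the final good was added, and
  that good is worth at most another share by \<open>small\<close>. Every served agent thus costs it
  at most two shares.\<close>

lemma knife_inv_step:
  assumes "knife_step n v G s s'" "knife_inv G A s" "G \<subseteq> {1..m}" "A \<subseteq> {1..n}"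
    and small: "\<forall>a\<in>A. \<forall>g\<in>G. v a {g} \<le> share a G"
  shows "knife_inv G A s'"
  using assms(1)
proof cases
  case (assign g Gh a Ah S P)
  have inv: "S \<inter> Gh = {}" "Ah \<subseteq> A" "\<forall>i. i \<notin> A - Ah \<longrightarrow> P i = {}"
     "(\<Union>i\<in>A. P i) \<union> S \<union> Gh = G" "\<forall>i\<in>A. P i \<inter> (S \<union> Gh) = {}"
     "\<forall>i\<in>A. \<forall>j\<in>A. i \<noteq> j \<longrightarrow> P i \<inter> P j = {}" "\<forall>i\<in>A - Ah. share i G \<le> v i (P i)"
     "\<forall>i\<in>Ah. v i S \<le> share i G"
     "\<forall>i\<in>Ah. v i G \<le> v i (S \<union> Gh) + 2 * real (card (A - Ah)) * share i G"
    using assms(2) unfolding assign knife_inv_def prod.case by - (elim conjE, assumption)+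
  have fA: "finite A" using assms(4) finite_subset by blast
  have a: "a \<in> A" using assign inv by auto
  have g: "g \<in> G" using assign inv by auto
  have SG: "S \<subseteq> G" "Gh \<subseteq> G" using inv(4) by auto
  have un: "(\<Union>i\<in>A. (P(a := insert g S)) i) \<union> {} \<union> (Gh - {g}) = G"
  proof -
    have "P a = {}" using inv(3) assign by auto
    then have "(\<Union>i\<in>A. (P(a := insert g S)) i) = insert g S \<union> (\<Union>i\<in>A. P i)"
      using a by (auto split: if_splits)
    then show ?thesis using inv(4) assign by auto
  qed
  have dj: "\<forall>i\<in>A. \<forall>j\<in>A. i \<noteq> j \<longrightarrow> (P(a := insert g S)) i \<inter> (P(a := insert g S)) j = {}"
    using inv(5,6) assign(3) by auto
  have "A - (Ah - {a}) = insert a (A - Ah)" using a by auto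
  then have c: "card (A - (Ah - {a})) = Suc (card (A - Ah))" using assign fA by simp
  have est: "v i G \<le> v i ({} \<union> (Gh - {g})) + 2 * real (card (A - (Ah - {a}))) * share i G"
    if "i \<in> Ah - {a}" for i
  proof -
    have i: "i \<in> {1..n}" using that inv(2) assms(4) by auto
    have "S \<union> Gh = insert g S \<union> (Gh - {g})" using assign by auto
    moreover have "insert g S \<subseteq> {1..m}" "Gh - {g} \<subseteq> {1..m}" using SG g assms(3) by blast+
    ultimately have "v i (S \<union> Gh) \<le> v i (insert g S) + v i (Gh - {g})"
      using val_Un[OF i] by metis
    moreover have "v i (insert g S) \<le> v i S + v i {g}" 
      using val_insert[OF i, of S g] SG g assms(3) by blast
    moreover have "v i {g} \<le> share i G" using small that inv(2) g by blast
    moreover have "v i S \<le> share i G" "v i G \<le> v i (S \<union> Gh) + 2 * real (card (A - Ah)) * share i G"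
      using inv(8,9) that by auto
    ultimately show ?thesis unfolding c by (simp add: algebra_simps)
  qed
  have z: "\<forall>i\<in>Ah - {a}. v i {} \<le> share i G"
  proof
    fix i assume "i \<in> Ah - {a}"
    then have "i \<in> {1..n}" using inv(2) assms(4) by blast
    then show "v i {} \<le> share i G" using val_empty share_nonneg assms(3) by simp
  qed
  have sh: "\<forall>i\<in>A - (Ah - {a}). share i G \<le> v i ((P(a := insert g S)) i)"
    using inv(7) assign(5) a by (auto simp: share_def)
  have "\<forall>i. i \<notin> A - (Ah - {a}) \<longrightarrow> (P(a := insert g S)) i = {}" using inv(3) a by auto
  moreover have "\<forall>i\<in>A. (P(a := insert g S)) i \<inter> ({} \<union> (Gh - {g})) = {}" using inv(1,5) by auto
  moreover have "Ah - {a} \<subseteq> A" using inv by auto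
  moreover have "{} \<inter> (Gh - {g}) = {}" "Ah - {a} = {} \<longrightarrow> {} = {}" by simp_all
  moreover have "\<forall>i\<in>Ah - {a}. v i G \<le> v i ({} \<union> (Gh - {g})) + 2 * real (card (A - (Ah - {a}))) * share i G"
    using est by blast
  ultimately show ?thesis unfolding assign(2) knife_inv_def prod.case using un dj z sh
    by (intro conjI) assumption+
next
  case (extend g Gh Ah S P)
  have inv: "S \<inter> Gh = {}" "Ah \<subseteq> A" "\<forall>i. i \<notin> A - Ah \<longrightarrow> P i = {}"
     "(\<Union>i\<in>A. P i) \<union> S \<union> Gh = G" "\<forall>i\<in>A. P i \<inter> (S \<union> Gh) = {}"
     "\<forall>i\<in>A. \<forall>j\<in>A. i \<noteq> j \<longrightarrow> P i \<inter> P j = {}" "\<forall>i\<in>A - Ah. share i G \<le> v i (P i)"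
     "\<forall>i\<in>Ah. v i G \<le> v i (S \<union> Gh) + 2 * real (card (A - Ah)) * share i G"
    using assms(2) unfolding extend knife_inv_def prod.case by - (elim conjE, assumption)+
  have e: "insert g S \<union> (Gh - {g}) = S \<union> Gh" using extend by auto
  have "\<forall>i\<in>Ah. v i (insert g S) \<le> share i G" using extend(5) by (auto simp: share_def)
  moreover have "(\<Union>i\<in>A. P i) \<union> insert g S \<union> (Gh - {g}) = G" using inv(4) e by blast
  moreover have "insert g S \<inter> (Gh - {g}) = {}" using inv(1) by blast
  moreover have "Ah = {} \<longrightarrow> insert g S = {}" using extend(4) by simp
  ultimately show ?thesis unfolding extend(2) knife_inv_def prod.case e
    using inv by (intro conjI) assumption+
qed

lemma knife_inv_rtranclp:
  assumes "(knife_step n v G)\<^sup>*\<^sup>* s s'" "knife_inv G A s" "G \<subseteq> {1..m}" "A \<subseteq> {1..n}"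
    and "\<forall>a\<in>A. \<forall>g\<in>G. v a {g} \<le> share a G"
  shows "knife_inv G A s'"
  using assms by (induction rule: rtranclp_induct) (blast intro: knife_inv_step)+

lemma knife_final: "(\<nexists>s'. knife_step n v G (S, Gh, Ah, P) s') \<longleftrightarrow> Gh = {} \<or> Ah = {}"
proof -
  have "\<exists>s'. knife_step n v G (S, Gh, Ah, P) s'" if "g \<in> Gh" "a \<in> Ah" for g a
  proof (cases "\<exists>a\<in>Ah. v a (insert g S) \<ge> 1 / (2 * real n) * v a G")
    case True
    then show ?thesis using knife_step.assign[of g Gh _ Ah n v G S P] that by blast
  next
    case False
    then have "\<forall>a\<in>Ah. v a (insert g S) < 1 / (2 * real n) * v a G" by force
    then show ?thesis using knife_step.extend[of g Gh Ah v S n G P] that by blast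
  qed
  then show ?thesis by (auto elim: knife_step.cases)
qed

lemma single_final:
  "(\<nexists>s'. single_good_step n v (G, A, B) s') \<longleftrightarrow> (\<forall>a\<in>A. \<forall>g\<in>G. v a {g} < share a G)"
proof
  assume "\<nexists>s'. single_good_step n v (G, A, B) s'"
  then show "\<forall>a\<in>A. \<forall>g\<in>G. v a {g} < share a G"
    unfolding share_def using single_good_step.intros[of _ A _ G n v B] by (meson not_le)
next
  assume "\<forall>a\<in>A. \<forall>g\<in>G. v a {g} < share a G"
  then show "\<nexists>s'. single_good_step n v (G, A, B) s'"
    unfolding share_def by (auto elim!: single_good_step.cases simp: not_le[symmetric])
qed

text \<open>An agent that still waits when the goods run out has lost at most two shares to each of
  at most \<open>n - 1\<close> others and values the unclaimed piece at no more than one share. That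
  is less than the \<open>2 * n\<close> shares that make up \<open>v a G\<close>, a contradiction if
  the share is positive. So everybody is served unless \<open>G\<close> is empty, and then all
  shares are 0.\<close>

lemma moving_knife_result:
  assumes P: "moving_knife n v G A P" and G: "G \<subseteq> {1..m}" and A: "A \<subseteq> {1..n}" "A \<noteq> {}"
    and small: "\<forall>a\<in>A. \<forall>g\<in>G. v a {g} < share a G"
  shows "(\<Union>i\<in>A. P i) = G" "\<forall>i\<in>A. \<forall>j\<in>A. i \<noteq> j \<longrightarrow> P i \<inter> P j = {}"
    "\<forall>i\<in>A. share i G \<le> v i (P i)"
proof -
  obtain S Gh Ah P0 where run: "(knife_step n v G)\<^sup>*\<^sup>* ({}, G, A, \<lambda>_. {}) (S, Gh, Ah, P0)"
    and fin: "\<nexists>s'. knife_step n v G (S, Gh, Ah, P0) s'" and Pd: "P = P0(Max A := P0 (Max A) \<union> Gh)"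
    using P unfolding moving_knife_def loop_result_def by blast
  have fA: "finite A" using A(1) finite_subset by blast
  have mx: "Max A \<in> A" using fA A(2) by simp
  have "v i {} \<le> share i G" if "i \<in> A" for i
    using share_nonneg[of i G] val_empty[of i] that A(1) G by (metis subsetD)
  then have "knife_inv G A ({}, G, A, \<lambda>_. {})"
    using A by (simp add: knife_inv_def)
  then have "knife_inv G A (S, Gh, Ah, P0)"
    using knife_inv_rtranclp[OF run _ G A(1)] small by (simp add: less_imp_le)
  then have inv: "S \<inter> Gh = {}" "Ah \<subseteq> A" "\<forall>i. i \<notin> A - Ah \<longrightarrow> P0 i = {}"
     "(\<Union>i\<in>A. P0 i) \<union> S \<union> Gh = G" "\<forall>i\<in>A. P0 i \<inter> (S \<union> Gh) = {}"
     "\<forall>i\<in>A. \<forall>j\<in>A. i \<noteq> j \<longrightarrow> P0 i \<inter> P0 j = {}" "\<forall>i\<in>A - Ah. share i G \<le> v i (P0 i)"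
     "\<forall>i\<in>Ah. v i S \<le> share i G" "Ah = {} \<longrightarrow> S = {}"
     "\<forall>i\<in>Ah. v i G \<le> v i (S \<union> Gh) + 2 * real (card (A - Ah)) * share i G"
    unfolding knife_inv_def prod.case by - (elim conjE, assumption)+
  have Ge: "G = {}" if "Ah \<noteq> {}"
  proof (rule ccontr)
    assume "G \<noteq> {}"
    then obtain g where g: "g \<in> G" by blast
    from that obtain a where a: "a \<in> Ah" by blast
    have aA: "a \<in> A" and an: "a \<in> {1..n}" using a inv(2) A by auto
    have "0 \<le> v a {g}" using val_nonneg[OF an, of "{g}"] g G by auto
    \<comment> \<open>This is where the strict inequality of \<open>small\<close> is essential: a
      share of 0 would admit no contradiction below.\<close>
    then have pos: "0 < share a G" using small aA g by force
    have "Gh = {}" using fin knife_final[of G S Gh Ah P0] that by simp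
    then have le: "v a G \<le> share a G + 2 * real (card (A - Ah)) * share a G"
      using inv(8,10) a by fastforce
    have "A - Ah \<subseteq> {1..n} - {a}" using A a by auto
    then have "card (A - Ah) \<le> card ({1..n} - {a})" by (rule card_mono[rotated]) simp
    then have c: "real (card (A - Ah)) \<le> real n - 1" using an n_pos by (simp add: of_nat_diff nat_le_real_less)
    have "v a G = 2 * real n * share a G" using n_pos by (simp add: share_def)
    with le have "2 * real n * share a G \<le> (1 + 2 * real (card (A - Ah))) * share a G"
      by (simp add: algebra_simps)
    then have "2 * real n \<le> 1 + 2 * real (card (A - Ah))" using pos by simp
    then show False using c by simp
  qed
  \<comment> \<open>Goods left over in \<open>S\<close> would belong to nobody, since only
    \<open>Gh\<close> is handed out after the loop.\<close>
  have Se: "S = {}" using Ge inv(4,9) by blast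
  show "(\<Union>i\<in>A. P i) = G" 
  proof -
    have "(\<Union>i\<in>A. P i) = (\<Union>i\<in>A. P0 i) \<union> Gh" unfolding Pd using mx by (auto split: if_splits)
    then show ?thesis using inv(4) Se by auto
  qed
  show "\<forall>i\<in>A. \<forall>j\<in>A. i \<noteq> j \<longrightarrow> P i \<inter> P j = {}"
  proof (intro ballI impI)
    fix i j assume "i \<in> A" "j \<in> A" "i \<noteq> j"
    then have "P0 i \<inter> P0 j = {}" "P0 i \<inter> Gh = {}" "P0 j \<inter> Gh = {}" using inv(5,6) by blast+
    then show "P i \<inter> P j = {}" unfolding Pd using \<open>i \<noteq> j\<close> by auto
  qed
  show "\<forall>i\<in>A. share i G \<le> v i (P i)"
  proof
    fix i assume i: "i \<in> A"
    have i': "i \<in> {1..n}" using i A(1) by blast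
    have "P i \<subseteq> {1..m}" using \<open>(\<Union>i\<in>A. P i) = G\<close> G i by blast
    moreover have "P0 i \<subseteq> P i" unfolding Pd by auto
    ultimately have "v i (P0 i) \<le> v i (P i)" using val_mono[OF i'] by blast
    moreover have "share i G \<le> v i (P0 i)"
    proof (cases "i \<in> Ah")
      case True
      have "G = {}" using Ge True by blast
      moreover have "P0 i = {}" using inv(3) True by blast
      ultimately show ?thesis using share_empty[OF i'] val_empty[OF i'] by simp
    next
      case False
      then show ?thesis using inv(7) i by blast
    qed
    ultimately show "share i G \<le> v i (P i)" by simp
  qed
qed

section \<open>Guarantees of a whole round\<close>

lemma round_bundles_result:
  assumes \<pi>: "matching n m \<pi>" and B: "round_bundles n m v \<pi> B"
  shows "(\<Union>i\<in>{1..n}. B i) = {1..m} - \<pi> ` {1..n}"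
    "\<forall>i\<in>{1..n}. \<forall>j\<in>{1..n}. i \<noteq> j \<longrightarrow> B i \<inter> B j = {}"
    "\<forall>i\<in>{1..n}. few_removed i (2 * real n * v i (B i))"
proof -
  define G0 where "G0 = {1..m} - \<pi> ` {1..n}"
  have G0m: "G0 \<subseteq> {1..m}" by (auto simp: G0_def)
  obtain G A B1 where run: "(single_good_step n v)\<^sup>*\<^sup>* (G0, {1..n}, \<lambda>_. {}) (G, A, B1)"
    and fin: "\<nexists>s'. single_good_step n v (G, A, B1) s'"
    and Bd: "if A = {} then \<exists>h\<in>{1..n}. B = B1(h := B1 h \<union> G)
         else \<exists>P. moving_knife n v G A P \<and> B = (\<lambda>i. if i \<in> A then P i else B1 i)"
    using B unfolding round_bundles_def loop_result_def G0_def by blast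
  have "single_inv G0 (G, A, B1)"
    using single_inv_rtranclp[OF run] single_inv_init[OF \<pi>] G0m by (simp add: G0_def)
  then have inv: "G \<subseteq> G0" "A \<subseteq> {1..n}" "\<forall>i. i \<notin> {1..n} - A \<longrightarrow> B1 i = {}"
     "(\<Union>i\<in>{1..n}. B1 i) \<union> G = G0" "\<forall>i\<in>{1..n}. B1 i \<inter> G = {}"
     "\<forall>i\<in>{1..n}. \<forall>j\<in>{1..n}. i \<noteq> j \<longrightarrow> B1 i \<inter> B1 j = {}"
     "card ({1..m} - G) + card A \<le> 2 * n"
     "\<forall>i\<in>{1..n} - A. few_removed i (2 * real n * v i (B1 i))"
    unfolding single_inv_def prod.case by - (elim conjE, assumption)+
  have Gm: "G \<subseteq> {1..m}" using inv(1) G0m by blast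
  have "(\<Union>i\<in>{1..n}. B i) = G0 \<and> (\<forall>i\<in>{1..n}. \<forall>j\<in>{1..n}. i \<noteq> j \<longrightarrow> B i \<inter> B j = {}) \<and>
    (\<forall>i\<in>{1..n}. few_removed i (2 * real n * v i (B i)))"
  proof (cases "A = {}")
    case True
    then obtain h where h: "h \<in> {1..n}" and Bh: "B = B1(h := B1 h \<union> G)" using Bd by auto
    have "(\<Union>i\<in>{1..n}. B i) = (\<Union>i\<in>{1..n}. B1 i) \<union> G" unfolding Bh using h by (auto split: if_splits)
    then have un: "(\<Union>i\<in>{1..n}. B i) = G0" using inv(4) by simp
    have "few_removed i (2 * real n * v i (B i))" if i: "i \<in> {1..n}" for i
    proof -
      have "B i \<subseteq> {1..m}" using un i G0m by blast
      moreover have "B1 i \<subseteq> B i" unfolding Bh by auto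
      ultimately have "v i (B1 i) \<le> v i (B i)" using val_mono[OF i] by simp
      then have "2 * real n * v i (B1 i) \<le> 2 * real n * v i (B i)" by (simp add: mult_left_mono)
      moreover have "few_removed i (2 * real n * v i (B1 i))" using inv(8) i True by auto
      ultimately show ?thesis by (blast intro: few_removed_mono)
    qed
    moreover have "B i \<inter> B j = {}" if "i \<in> {1..n}" "j \<in> {1..n}" "i \<noteq> j" for i j
    proof -
      have "B1 i \<inter> B1 j = {}" "B1 i \<inter> G = {}" "B1 j \<inter> G = {}" using inv(5,6) that by blast+
      then show ?thesis unfolding Bh using that by auto
    qed
    ultimately show ?thesis using un by blast
  next
    case False
    then obtain P where P: "moving_knife n v G A P" and Bp: "B = (\<lambda>i. if i \<in> A then P i else B1 i)"
      using Bd by auto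
    have small: "\<forall>a\<in>A. \<forall>g\<in>G. v a {g} < share a G" using fin single_final by blast
    note K = moving_knife_result[OF P Gm inv(2) False small]
    have "(\<Union>i\<in>{1..n}. B i) = (\<Union>i\<in>{1..n}. B1 i) \<union> (\<Union>i\<in>A. P i)"
      unfolding Bp using inv(2,3) by (auto split: if_splits)
    then have un: "(\<Union>i\<in>{1..n}. B i) = G0" using inv(4) K(1) by simp
    have PG: "P i \<subseteq> G" if "i \<in> A" for i using K(1) that by blast
    have "B i \<inter> B j = {}" if "i \<in> {1..n}" "j \<in> {1..n}" "i \<noteq> j" for i j
    proof -
      have "B1 i \<inter> B1 j = {}" "B1 i \<inter> G = {}" "B1 j \<inter> G = {}" using inv(5,6) that by blast+
      moreover have "P i \<inter> P j = {}" if "i \<in> A" "j \<in> A" using K(2) that \<open>i \<noteq> j\<close> by blast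
      moreover have "i \<in> A \<Longrightarrow> P i \<subseteq> G" "j \<in> A \<Longrightarrow> P j \<subseteq> G" using PG by blast+
      ultimately show ?thesis unfolding Bp by (cases "i \<in> A"; cases "j \<in> A") (simp; blast)+
    qed
    moreover have "few_removed i (2 * real n * v i (B i))" if i: "i \<in> {1..n}" for i
    proof (cases "i \<in> A")
      case True
      have "v i G \<le> 2 * real n * v i (P i)" using K(3) True share_le_iff by blast
      moreover have "{1..m} - ({1..m} - G) = G" using Gm by blast
      ultimately show ?thesis
        unfolding few_removed_def Bp using True inv(7) by (intro exI[of _ "{1..m} - G"]) auto
    qed (use inv(8) i in \<open>auto simp: Bp\<close>)
    ultimately show ?thesis using un by blast
  qed
  then show "(\<Union>i\<in>{1..n}. B i) = {1..m} - \<pi> ` {1..n}"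
    "\<forall>i\<in>{1..n}. \<forall>j\<in>{1..n}. i \<noteq> j \<longrightarrow> B i \<inter> B j = {}"
    "\<forall>i\<in>{1..n}. few_removed i (2 * real n * v i (B i))" by (auto simp: G0_def)
qed

end

section \<open>Number of rounds and approximation factor\<close>

lemma loop_result_exists:
  fixes f :: "'s \<Rightarrow> nat"
  assumes "I s" and step: "\<And>s s'. \<lbrakk>I s; R s s'\<rbrakk> \<Longrightarrow> I s' \<and> f s' < f s"
  shows "\<exists>s'. loop_result R s s'"
  using assms(1)
proof (induction "f s" arbitrary: s rule: less_induct)
  case less
  show ?case
  proof (cases "\<exists>s'. R s s'")
    case True
    then obtain s1 where s1: "R s s1" by blast
    then obtain s' where "loop_result R s1 s'" using less step by blast
    then show ?thesis using s1 unfolding loop_result_def by (blast intro: converse_rtranclp_into_rtranclp)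
  qed (auto simp: loop_result_def)
qed

lemma finite_ratios:
  "finite {v i {1..m} / v i S | i S. i \<in> {1..n :: nat} \<and> S \<subseteq> {1..m :: nat} \<and> 0 < (v i S :: real)}"
proof (rule finite_subset)
  show "{v i {1..m} / v i S | i S. i \<in> {1..n} \<and> S \<subseteq> {1..m} \<and> 0 < v i S}
      \<subseteq> (\<lambda>(i, S). v i {1..m} / v i S) ` ({1..n} \<times> Pow {1..m})" by auto
qed simp

lemma value_bits_nonneg: "0 \<le> value_bits n m v"
proof -
  have "1 \<le> Max (insert 1 {v i {1..m} / v i S | i S. i \<in> {1..n} \<and> S \<subseteq> {1..m} \<and> 0 < v i S})"
    using finite_ratios by (intro Max_ge) auto
  then show ?thesis by (simp only: value_bits_def zero_le_log_cancel_iff)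
qed

lemma matching_weight_eq_minus_infinity:
  assumes "i \<in> {1..n}" "v i {\<pi> i} + \<gamma> i \<le> 0"
  shows "matching_weight n v \<gamma> \<pi> = -\<infinity>"
proof -
  have "matching_weight n v \<gamma> \<pi>
      = elog (v i {\<pi> i} + \<gamma> i) + (\<Sum>j\<in>{1..n} - {i}. elog (v j {\<pi> j} + \<gamma> j))"
    unfolding matching_weight_def using assms(1) by (simp add: sum.remove)
  moreover have "elog (v i {\<pi> i} + \<gamma> i) = -\<infinity>" using assms(2) by (simp add: elog_def)
  \<comment> \<open>In \<open>ereal\<close> the sum of minus infinity and infinity is infinity, so
    the remaining sum has to be kept away from that value.\<close>
  moreover have "(\<Sum>j\<in>{1..n} - {i}. elog (v j {\<pi> j} + \<gamma> j)) \<noteq> \<infinity>"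
    by (simp add: sum_Pinfty elog_def)
  ultimately show ?thesis by simp
qed

context fair_instance
begin

section \<open>No run gets stuck\<close>

lemma max_weight_matching_exists: "\<exists>\<pi>. max_weight_matching n m v \<gamma> \<pi>"
proof -
  define W where "W = matching_weight n v \<gamma> ` {\<pi>. matching n m \<pi>}"
  \<comment> \<open>A matching is a function on all naturals, so there are infinitely many of them.
    Its weight depends only on the restriction to the agents, which leaves finitely many
    weights.\<close>
  have "W \<subseteq> matching_weight n v \<gamma> ` (PiE {1..n} (\<lambda>_. {1..m}))"
  proof
    fix w assume "w \<in> W"
    then obtain \<pi> where \<pi>: "matching n m \<pi>" "w = matching_weight n v \<gamma> \<pi>" by (auto simp: W_def)
    then have "restrict \<pi> {1..n} \<in> PiE {1..n} (\<lambda>_. {1..m})"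
      by (auto simp: matching_def image_subset_iff)
    moreover have "w = matching_weight n v \<gamma> (restrict \<pi> {1..n})"
      unfolding \<pi>(2) matching_weight_def by (rule sum.cong) auto
    ultimately show "w \<in> matching_weight n v \<gamma> ` (PiE {1..n} (\<lambda>_. {1..m}))" by blast
  qed
  then have "finite W" by (rule finite_subset) (simp add: finite_PiE)
  moreover have "matching n m id" using n_le_m by (auto simp: matching_def)
  then have "W \<noteq> {}" unfolding W_def by blast
  ultimately have "Max W \<in> W" "\<forall>w\<in>W. w \<le> Max W" by auto
  then show ?thesis unfolding W_def max_weight_matching_def by fastforce
qed

lemma moving_knife_exists:
  assumes "finite G"
  shows "\<exists>P. moving_knife n v G A P"
proof -
  have "\<exists>s'. loop_result (knife_step n v G) ({}, G, A, \<lambda>_. {}) s'"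
  proof (rule loop_result_exists[where I = "\<lambda>(S, Gh, Ah, P). finite Gh" and f = "\<lambda>(S, Gh, Ah, P). card Gh"])
    fix s s' assume "case s of (S, Gh, Ah, P) \<Rightarrow> finite Gh" "knife_step n v G s s'"
    then show "(case s' of (S, Gh, Ah, P) \<Rightarrow> finite Gh) \<and>
        (case s' of (S, Gh, Ah, P) \<Rightarrow> card Gh) < (case s of (S, Gh, Ah, P) \<Rightarrow> card Gh)"
      by (auto elim!: knife_step.cases intro: card_Diff1_less)
  qed (use assms in simp)
  then show ?thesis unfolding moving_knife_def by fastforce
qed

lemma round_bundles_exists: "\<exists>B. round_bundles n m v \<pi> B"
proof -
  let ?G0 = "{1..m} - \<pi> ` {1..n}"
  have "\<exists>s'. loop_result (single_good_step n v) (?G0, {1..n}, \<lambda>_. {}) s'"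
  proof (rule loop_result_exists[where I = "\<lambda>(G, A, B). finite G" and f = "\<lambda>(G, A, B). card G"])
    fix s s' assume "case s of (G, A, B) \<Rightarrow> finite G" "single_good_step n v s s'"
    then show "(case s' of (G, A, B) \<Rightarrow> finite G) \<and>
        (case s' of (G, A, B) \<Rightarrow> card G) < (case s of (G, A, B) \<Rightarrow> card G)"
      by (auto elim!: single_good_step.cases intro: card_Diff1_less)
  qed simp
  then obtain G A B1 where run: "loop_result (single_good_step n v) (?G0, {1..n}, \<lambda>_. {}) (G, A, B1)"
    by (metis prod_cases3)
  have "finite (fst s')" if "(single_good_step n v)\<^sup>*\<^sup>* s s'" "finite (fst s)" for s s'
    using that by (induction rule: rtranclp_induct) (auto elim!: single_good_step.cases)
  then have "finite G" using run unfolding loop_result_def by fastforce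
  then obtain P where P: "moving_knife n v G A P" using moving_knife_exists by blast
  have "1 \<in> {1..n}" using n_pos by simp
  then have "\<exists>B. if A = {} then \<exists>h\<in>{1..n}. B = B1(h := B1 h \<union> G)
      else \<exists>P. moving_knife n v G A P \<and> B = (\<lambda>i. if i \<in> A then P i else B1 i)"
    using P by (cases "A = {}") (simp only: if_True if_False simp_thms, blast)+
  then show ?thesis using run unfolding round_bundles_def by blast
qed

lemma alg_iteration_exists: "\<exists>s'. alg_iteration n m v s s'"
proof -
  obtain \<pi> where \<pi>: "max_weight_matching n m v (thr s) \<pi>" using max_weight_matching_exists by blast
  obtain B where B: "round_bundles n m v \<pi> B" using round_bundles_exists by blast
  define U where "U = {i\<in>{1..n}. v i (B i) < thr s i}"
  have "alg_iteration n m v s \<lparr>thr = \<lambda>i. if i \<in> U then (1 - 1 / real m) * thr s i else thr s i,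
      unsat = U, bundles = \<lambda>i. if i \<in> {1..n} then B i \<union> {\<pi> i} else {}\<rparr>"
    unfolding alg_iteration_def using \<pi> B by (intro exI[of _ \<pi>] exI[of _ B]) (simp add: U_def)
  then show ?thesis by blast
qed

section \<open>Thresholds and the number of rounds\<close>

definition value_ratio :: real where
  "value_ratio = Max (insert 1 {v i {1..m} / v i S | i S. i \<in> {1..n} \<and> S \<subseteq> {1..m} \<and> 0 < v i S})"

lemma value_bits_eq: "value_bits n m v = log 2 value_ratio"
  by (simp add: value_bits_def value_ratio_def)

lemma value_ratio_ge_1: "1 \<le> value_ratio"
  unfolding value_ratio_def using finite_ratios by simp

lemma value_le_ratio:
  assumes "i \<in> {1..n}" "S \<subseteq> {1..m}" "0 < v i S"
  shows "v i {1..m} \<le> value_ratio * v i S"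
proof -
  have "v i {1..m} / v i S \<le> value_ratio"
    unfolding value_ratio_def using assms finite_ratios by (intro Max_ge) auto
  then show ?thesis using assms(3) by (simp add: field_simps)
qed

text \<open>In \<open>4 * real n\<close>, the factor \<open>2 * n\<close> stems from the share and
  the other 2 from one reduction of the threshold. The condition \<open>2 \<le> m\<close> ensures
  that a reduction at most halves a positive threshold.\<close>

definition thr_inv :: "(nat \<Rightarrow> real) \<Rightarrow> bool" where
  "thr_inv \<gamma> \<longleftrightarrow> (\<forall>i\<in>{1..n}. 0 \<le> \<gamma> i \<and> few_removed i (4 * real n * \<gamma> i) \<and>
     (0 < \<gamma> i \<longrightarrow> 2 \<le> m \<and> \<not> few_removed i 0))"

text \<open>If the goods behind the first \<open>2 * n\<close> still have positive value,
  subadditivity provides one good \<open>h\<close> of positive value among them, and by the sorting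
  the \<open>2 * n\<close> goods in front are worth at least as much. No \<open>2 * n\<close> goods
  can cover these \<open>2 * n + 1\<close> goods, so whatever is removed, positive value
  remains.\<close>

lemma thr_inv_init:
  assumes "alg_init n m v s"
  shows "thr_inv (thr s)" "\<And>i. i \<in> {1..n} \<Longrightarrow> thr s i \<le> v i {1..m}"
proof -
  have *: "0 \<le> thr s i \<and> few_removed i (4 * real n * thr s i) \<and>
     (0 < thr s i \<longrightarrow> 2 \<le> m \<and> \<not> few_removed i 0) \<and> thr s i \<le> v i {1..m}" if i: "i \<in> {1..n}" for i
  proof -
    obtain gs where gs: "distinct gs" "set gs = {1..m}" "sorted_wrt (\<lambda>g h. v i {g} \<ge> v i {h}) gs"
      and t: "thr s i = (if v i ({1..m} - set (take (2 * n) gs)) = 0 then 0 else v i {1..m})"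
      using assms i unfolding alg_init_def by blast
    define X where "X = set (take (2 * n) gs)"
    have X: "X \<subseteq> {1..m}" "card X \<le> 2 * n"
      using gs(1) set_take_subset[of "2 * n" gs] gs(2) by (auto simp: X_def distinct_card)
    have len: "length gs = m" using gs distinct_card[of gs] by simp
    have vm: "0 \<le> v i {1..m}" using val_nonneg[OF i] by simp
    show ?thesis
    proof (cases "v i ({1..m} - X) = 0")
      case True
      then have "few_removed i 0" using X unfolding few_removed_def by auto
      then show ?thesis using True t vm unfolding X_def by simp
    next
      case False
      have X0: "0 < v i ({1..m} - X)" using False val_nonneg[OF i, of "{1..m} - X"] by auto
      have "\<exists>h\<in>{1..m} - X. 0 < v i {h}"
      proof (rule ccontr)
        assume "\<not> (\<exists>h\<in>{1..m} - X. 0 < v i {h})"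
        then have "v i ({1..m} - X) \<le> real (card ({1..m} - X)) * 0"
          by (intro val_le_card[OF i]) (auto simp: not_less)
        then show False using X0 by simp
      qed
      then obtain h where h: "h \<in> {1..m}" "h \<notin> X" "0 < v i {h}" by blast
      have m2: "2 * n < m"
      proof (rule ccontr)
        assume "\<not> 2 * n < m"
        then have "X = {1..m}" using gs(2) len by (simp add: X_def)
        then show False using h by simp
      qed
      have cX: "card (insert h X) = 2 * n + 1"
        using h(2) gs(1) len m2 by (simp add: X_def distinct_card)
      have h': "h \<in> set (drop (2 * n) gs)"
        using h gs(2) append_take_drop_id[of "2 * n" gs] by (metis Un_iff X_def set_append)
      have "sorted_wrt (\<lambda>g h. v i {g} \<ge> v i {h}) (take (2 * n) gs @ drop (2 * n) gs)" using gs(3) by simp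
      then have ge: "v i {h} \<le> v i {x}" if "x \<in> insert h X" for x
        using that h' unfolding sorted_wrt_append X_def by auto
      have "\<not> few_removed i 0"
      proof
        assume "few_removed i 0"
        then obtain R where R: "R \<subseteq> {1..m}" "card R \<le> 2 * n" "v i ({1..m} - R) \<le> 0"
          unfolding few_removed_def by blast
        have "finite R" using R(1) finite_subset by blast
        then have "\<not> insert h X \<subseteq> R" using card_mono[of R "insert h X"] cX R(2) by linarith
        then obtain x where x: "x \<in> insert h X" "x \<notin> R" by blast
        then have "v i {x} \<le> v i ({1..m} - R)" using h X by (intro val_mono[OF i]) auto
        then show False using ge[OF x(1)] h(3) R(3) by linarith
      qed
      moreover have "few_removed i (4 * real n * v i {1..m})"
        unfolding few_removed_def
      proof (intro exI[of _ "{}"] conjI)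
        have "v i {1..m} * 1 \<le> v i {1..m} * (4 * real n)" using n_pos vm by (intro mult_left_mono) auto
        then show "v i ({1..m} - {}) \<le> 4 * real n * v i {1..m}" by (simp add: mult.commute)
      qed auto
      ultimately show ?thesis using False t vm m2 n_pos unfolding X_def by simp
    qed
  qed
  show "thr_inv (thr s)" unfolding thr_inv_def using * by blast
  show "\<And>i. i \<in> {1..n} \<Longrightarrow> thr s i \<le> v i {1..m}" using * by blast
qed

text \<open>As values are nonnegative, an unsatisfied agent has a positive threshold. If its bundle
  were worthless, the guarantee of the round would give \<open>few_removed i 0\<close>, which the
  invariant excludes.\<close>

lemma unsat_positive:
  assumes "thr_inv \<gamma>" "matching n m \<pi>" "round_bundles n m v \<pi> B" "i \<in> {1..n}" "v i (B i) < \<gamma> i"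
  shows "B i \<subseteq> {1..m}" "0 < v i (B i)" "2 \<le> m" "few_removed i (2 * real n * v i (B i))"
proof -
  note r = round_bundles_result[OF assms(2,3)]
  show B: "B i \<subseteq> {1..m}" using r(1) assms(4) by blast
  show f: "few_removed i (2 * real n * v i (B i))" using r(3) assms(4) by blast
  have nn: "0 \<le> v i (B i)" using val_nonneg[OF assms(4) B] .
  then have "2 \<le> m \<and> \<not> few_removed i 0" using assms(1,4,5) unfolding thr_inv_def by force
  then show "0 < v i (B i)" "2 \<le> m" using f nn by (auto simp: less_le)
qed

lemma thr_inv_iteration:
  assumes inv: "thr_inv (thr s)" and it: "alg_iteration n m v s s'"
  shows "thr_inv (thr s')"
proof -
  obtain \<pi> B where \<pi>: "matching n m \<pi>" and B: "round_bundles n m v \<pi> B"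
    and U: "unsat s' = {i\<in>{1..n}. v i (B i) < thr s i}"
    and T: "thr s' = (\<lambda>i. if i \<in> unsat s' then (1 - 1 / real m) * thr s i else thr s i)"
    using it unfolding alg_iteration_def max_weight_matching_def by blast
  show ?thesis unfolding thr_inv_def
  proof
    fix i assume i: "i \<in> {1..n}"
    show "0 \<le> thr s' i \<and> few_removed i (4 * real n * thr s' i) \<and> (0 < thr s' i \<longrightarrow> 2 \<le> m \<and> \<not> few_removed i 0)"
    proof (cases "i \<in> unsat s'")
      case True
      then have lt: "v i (B i) < thr s i" using U by simp
      note u = unsat_positive[OF inv \<pi> B i lt]
      \<comment> \<open>This trades the bound by \<open>2 * real n\<close> times the old threshold
        for \<open>4 * real n\<close> times the new one.\<close>
      have "1 / 2 * thr s i \<le> (1 - 1 / real m) * thr s i"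
        using u(2,3) lt by (intro mult_right_mono) (auto simp: field_simps)
      then have half: "thr s i \<le> 2 * thr s' i" using True T by (simp add: mult.commute)
      then have "2 * real n * v i (B i) \<le> 2 * real n * (2 * thr s' i)" using lt by (intro mult_left_mono) auto
      then have "few_removed i (4 * real n * thr s' i)" using u(4) few_removed_mono by fastforce
      moreover have "0 < thr s i" using u(2) lt by linarith
      moreover have "\<not> few_removed i 0" using inv i \<open>0 < thr s i\<close> unfolding thr_inv_def by blast
      ultimately show ?thesis using half u(3) by simp
    next
      case False
      then show ?thesis using inv i T unfolding thr_inv_def by simp
    qed
  qed
qed

lemma thr_inv_run: "alg_run n m v t s \<Longrightarrow> thr_inv (thr s)"
  by (induction rule: alg_run.induct) (auto intro: thr_inv_init thr_inv_iteration)

text \<open>Since \<open>ln (1 - 1 / m) \<le> - (1 / m)\<close>, taking logarithms in the hypothesis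
  gives \<open>k / m \<le> ln r\<close>. The binary logarithm is no smaller because
  \<open>ln 2 < 1\<close> and \<open>1 \<le> r\<close>.\<close>

lemma decay_count_bound:
  assumes "2 \<le> m" "1 \<le> r * (1 - 1 / real m) ^ k"
  shows "real k \<le> real m * log 2 r"
proof -
  have m: "0 < real m" and q: "0 < 1 - 1 / real m" using assms(1) by (auto simp: field_simps)
  have "0 < r" using assms(2) q by (smt (verit) mult_nonpos_nonneg zero_le_power)
  have "0 \<le> ln (r * (1 - 1 / real m) ^ k)" using assms(2) by simp
  also have "\<dots> = ln r + real k * ln (1 - 1 / real m)"
    using q \<open>0 < r\<close> by (subst ln_mult_pos) (auto simp del: diff_gt_0_iff_gt simp: ln_realpow)
  also have "\<dots> \<le> ln r + real k * (- (1 / real m))"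
    using ln_le_minus_one[OF q] by (intro add_left_mono mult_left_mono) auto
  finally have "real k \<le> real m * ln r" using m by (simp add: field_simps)
  moreover have "1 \<le> r"
  proof -
    have "(1 - 1 / real m) ^ k \<le> 1" using q by (intro power_le_one) auto
    then have "r * (1 - 1 / real m) ^ k \<le> r" using \<open>0 < r\<close> by (simp add: mult_left_le)
    then show ?thesis using assms(2) by linarith
  qed
  then have "ln r \<le> log 2 r"
    using ln_2_less_1 by (simp add: log_def field_simps mult_left_le)
  then have "real m * ln r \<le> real m * log 2 r" using m by simp
  ultimately show ?thesis by linarith
qed

text \<open>\<open>k i\<close> counts the reductions of the threshold of agent \<open>i\<close>.
  Every round but the last lowers some threshold, so the rounds number at most the sum of all
  \<open>k i\<close> plus 1. Before each reduction the threshold still exceeds a positive bundle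
  value, which limits the earlier reductions by \<open>decay_count_bound\<close>; the 1 inside
  \<open>b\<close> is the reduction at hand.\<close>

lemma rounds_bound:
  assumes "alg_run n m v t s"
  shows "real t \<le> real n * (1 + real m * value_bits n m v) + 1"
proof -
  define b where "b = 1 + real m * value_bits n m v"
  have b1: "1 \<le> b" using value_bits_nonneg by (simp add: b_def)
  have "\<exists>k. (\<forall>i\<in>{1..n}. thr s i \<le> (1 - 1 / real m) ^ k i * v i {1..m} \<and> real (k i) \<le> b) \<and>
      t \<le> (\<Sum>i\<in>{1..n}. k i) + (if unsat s = {} then 1 else 0)"
    using assms
  proof (induction rule: alg_run.induct)
    case (init s)
    then show ?case using thr_inv_init(2)[OF init] b1 by (intro exI[of _ "\<lambda>_. 0"]) auto
  next
    case (iter t s s')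
    from iter.IH obtain k where k: "\<forall>i\<in>{1..n}. thr s i \<le> (1 - 1 / real m) ^ k i * v i {1..m} \<and> real (k i) \<le> b"
      and t: "t \<le> (\<Sum>i\<in>{1..n}. k i)" using iter.hyps(2) by auto
    obtain \<pi> B where \<pi>: "matching n m \<pi>" and B: "round_bundles n m v \<pi> B"
      and U: "unsat s' = {i\<in>{1..n}. v i (B i) < thr s i}"
      and T: "thr s' = (\<lambda>i. if i \<in> unsat s' then (1 - 1 / real m) * thr s i else thr s i)"
      using iter.hyps(3) unfolding alg_iteration_def max_weight_matching_def by blast
    define k' where "k' = (\<lambda>i. if i \<in> unsat s' then Suc (k i) else k i)"
    have "thr s' i \<le> (1 - 1 / real m) ^ k' i * v i {1..m} \<and> real (k' i) \<le> b" if i: "i \<in> {1..n}" for i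
    proof (cases "i \<in> unsat s'")
      case True
      then have lt: "v i (B i) < thr s i" using U by simp
      note u = unsat_positive[OF thr_inv_run[OF iter.hyps(1)] \<pi> B i lt]
      have ki: "thr s i \<le> (1 - 1 / real m) ^ k i * v i {1..m}" using k i by blast
      \<comment> \<open>The aim is to have \<open>v i {1..m}\<close> on both sides, once with the
        decay factor, and to cancel it.\<close>
      have "v i {1..m} * 1 \<le> value_ratio * v i (B i)" using value_le_ratio[OF i u(1,2)] by simp
      also have "\<dots> \<le> value_ratio * ((1 - 1 / real m) ^ k i * v i {1..m})"
        using lt ki value_ratio_ge_1 by (intro mult_left_mono) auto
      finally have "v i {1..m} * 1 \<le> v i {1..m} * (value_ratio * (1 - 1 / real m) ^ k i)"
        by (simp add: algebra_simps)
      moreover have "0 < v i {1..m}" using val_mono[OF i u(1)] u(2) by simp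
      ultimately have "1 \<le> value_ratio * (1 - 1 / real m) ^ k i" by (simp only: mult_le_cancel_left_pos)
      then have "real (k i) \<le> real m * value_bits n m v"
        using decay_count_bound[OF u(3)] value_bits_eq by simp
      then have "real (k' i) \<le> b" using True by (simp add: k'_def b_def)
      moreover have "thr s' i \<le> (1 - 1 / real m) * ((1 - 1 / real m) ^ k i * v i {1..m})"
        using T True ki u(3) by (simp add: mult_left_mono)
      ultimately show ?thesis using True by (simp add: k'_def algebra_simps)
    next
      case False
      then show ?thesis using k i T by (simp add: k'_def)
    qed
    moreover have "Suc t \<le> (\<Sum>i\<in>{1..n}. k' i) + (if unsat s' = {} then 1 else 0)"
    proof (cases "unsat s' = {}")
      case True
      then show ?thesis using t by (simp add: k'_def)
    next
      case False
      then obtain j where j: "j \<in> {1..n}" "j \<in> unsat s'" using U by auto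
      have "(\<Sum>i\<in>{1..n}. k i) < (\<Sum>i\<in>{1..n}. k' i)"
        by (rule sum_strict_mono_ex1) (use j in \<open>auto simp: k'_def\<close>)
      then show ?thesis using t by simp
    qed
    ultimately show ?case by blast
  qed
  then obtain k where k: "\<forall>i\<in>{1..n}. real (k i) \<le> b" and t: "t \<le> (\<Sum>i\<in>{1..n}. k i) + 1"
    by (fastforce split: if_splits)
  have "real t \<le> real ((\<Sum>i\<in>{1..n}. k i) + 1)" using t by (rule of_nat_mono)
  also have "\<dots> = (\<Sum>i\<in>{1..n}. real (k i)) + 1" by simp
  also have "(\<Sum>i\<in>{1..n}. real (k i)) \<le> (\<Sum>i\<in>{1..n}. b)" using k by (intro sum_mono) auto
  finally show ?thesis by (simp add: b_def)
qed

lemma halts_within: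
  assumes "real n * (1 + real m * value_bits n m v) + 1 \<le> T"
  shows "alg_halts_within n m v T"
  unfolding alg_halts_within_def using rounds_bound alg_iteration_exists assms by fastforce

section \<open>The approximation factor\<close>

lemma nsw_nonneg:
  assumes "allocation n m N"
  shows "0 \<le> nsw n v N"
proof -
  have "N i \<subseteq> {1..m}" if "i \<in> {1..n}" for i using assms that unfolding allocation_def by blast
  then have "0 \<le> (\<Prod>i=1..n. v i (N i))" by (intro prod_nonneg ballI val_nonneg) auto
  then show ?thesis unfolding nsw_def by (rule real_root_ge_zero)
qed

text \<open>Positivity of all edges makes the weight of \<open>\<sigma>\<close> finite. A matching
  of maximum weight then uses no edge of weight minus infinity, and the logarithms can be removed on
  both sides.\<close>

lemma max_weight_matching_prod:
  assumes \<pi>: "max_weight_matching n m v \<gamma> \<pi>" and \<sigma>: "matching n m \<sigma>"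
    and pos: "\<And>i. i \<in> {1..n} \<Longrightarrow> 0 < v i {\<sigma> i} + \<gamma> i" 
    and nonneg: "\<And>i. i \<in> {1..n} \<Longrightarrow> 0 \<le> v i {\<pi> i} + \<gamma> i" 
  shows "(\<Prod>i\<in>{1..n}. v i {\<sigma> i} + \<gamma> i) \<le> (\<Prod>i\<in>{1..n}. v i {\<pi> i} + \<gamma> i)"
proof -
  have le: "matching_weight n v \<gamma> \<sigma> \<le> matching_weight n v \<gamma> \<pi>"
    using \<pi> \<sigma> unfolding max_weight_matching_def by blast
  have ws: "matching_weight n v \<gamma> \<sigma> = ereal (\<Sum>i\<in>{1..n}. ln (v i {\<sigma> i} + \<gamma> i))"
    unfolding matching_weight_def using pos by (simp add: elog_def)
  have pp: "0 < v i {\<pi> i} + \<gamma> i" if i: "i \<in> {1..n}" for i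
  proof (rule ccontr)
    assume "\<not> 0 < v i {\<pi> i} + \<gamma> i"
    then have "matching_weight n v \<gamma> \<pi> = -\<infinity>"
      using matching_weight_eq_minus_infinity[of i n v \<pi> \<gamma>] i by simp
    then show False using le ws by simp
  qed
  have "matching_weight n v \<gamma> \<pi> = ereal (\<Sum>i\<in>{1..n}. ln (v i {\<pi> i} + \<gamma> i))"
    unfolding matching_weight_def using pp by (simp add: elog_def)
  then have "(\<Sum>i\<in>{1..n}. ln (v i {\<sigma> i} + \<gamma> i)) \<le> (\<Sum>i\<in>{1..n}. ln (v i {\<pi> i} + \<gamma> i))"
    using le ws by simp
  then have "ln (\<Prod>i\<in>{1..n}. v i {\<sigma> i} + \<gamma> i) \<le> ln (\<Prod>i\<in>{1..n}. v i {\<pi> i} + \<gamma> i)"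
    using pos pp by (subst (1 2) ln_prod) (force intro: less_imp_neq[symmetric])+
  moreover have "0 < (\<Prod>i\<in>{1..n}. v i {\<sigma> i} + \<gamma> i)" "0 < (\<Prod>i\<in>{1..n}. v i {\<pi> i} + \<gamma> i)"
    using pos pp by (intro prod_pos; blast)+
  ultimately show ?thesis by simp
qed

text \<open>The bundle is split along the removed set \<open>R\<close>. The part inside
  \<open>R\<close> has at most \<open>2 * n\<close> goods, each worth at most
  \<open>v i {b}\<close>, and the part outside is worth at most
  \<open>4 * n * \<gamma>\<close>.\<close>

lemma bundle_le_best_good:
  assumes i: "i \<in> {1..n}" and N: "N \<subseteq> {1..m}" and \<gamma>: "0 \<le> \<gamma>" "few_removed i (4 * real n * \<gamma>)"
    and b: "b \<in> {1..m}" "\<And>g. g \<in> N \<Longrightarrow> v i {g} \<le> v i {b}"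
  shows "v i N \<le> 4 * real n * (v i {b} + \<gamma>)"
proof -
  obtain R where R: "R \<subseteq> {1..m}" "card R \<le> 2 * n" "v i ({1..m} - R) \<le> 4 * real n * \<gamma>"
    using \<gamma> unfolding few_removed_def by blast
  have vb: "0 \<le> v i {b}" using val_nonneg[OF i] b(1) by simp
  have fR: "finite R" using R(1) finite_subset by blast
  have "v i N = v i ((N \<inter> R) \<union> (N - R))" by (simp add: Int_Diff_Un)
  also have "\<dots> \<le> v i (N \<inter> R) + v i (N - R)" using N by (intro val_Un[OF i]) auto
  also have "v i (N - R) \<le> v i ({1..m} - R)" using N by (intro val_mono[OF i]) auto
  also have "v i (N \<inter> R) \<le> real (card (N \<inter> R)) * v i {b}"
    using N b by (intro val_le_card[OF i]) auto
  also have "real (card (N \<inter> R)) \<le> 2 * real n"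
  proof -
    have "card (N \<inter> R) \<le> card R" using fR by (simp add: card_mono)
    then show ?thesis using R(2) by linarith
  qed
  finally have "v i N \<le> 2 * real n * v i {b} + 4 * real n * \<gamma>"
    using R(3) vb by (simp add: mult_right_mono)
  moreover have "2 * real n * v i {b} \<le> 4 * real n * v i {b}" using vb by (simp add: mult_right_mono)
  ultimately show ?thesis by (simp add: algebra_simps)
qed

text \<open>The bundles of any allocation are disjoint, so their best goods form a matching, which
  competes with \<open>\<pi>\<close>. Once all agents are satisfied, \<open>v i {\<pi> i}\<close>
  and \<open>\<gamma> i\<close> are both at most the value of the final bundle of \<open>i\<close>.
  This gives the factor 2 that turns \<open>4 * n\<close> into \<open>8 * n\<close>.\<close>

lemma final_round_approx:
  assumes inv: "thr_inv \<gamma>" and \<pi>: "max_weight_matching n m v \<gamma> \<pi>" and B: "round_bundles n m v \<pi> B"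
    and sat: "\<And>i. i \<in> {1..n} \<Longrightarrow> \<gamma> i \<le> v i (B i)"
  shows "nash_approx (8 * real n) n m v (\<lambda>i. if i \<in> {1..n} then B i \<union> {\<pi> i} else {})"
    (is "nash_approx _ n m v ?C")
proof -
  have mt: "matching n m \<pi>" using \<pi> by (simp add: max_weight_matching_def)
  then have \<pi>i: "inj_on \<pi> {1..n}" and \<pi>m: "\<pi> ` {1..n} \<subseteq> {1..m}" by (auto simp: matching_def)
  note r = round_bundles_result[OF mt B]
  have al: "allocation n m ?C"
    unfolding allocation_def
  proof (intro conjI ballI impI)
    fix i j assume ij: "i \<in> {1..n}" "j \<in> {1..n}" "i \<noteq> j"
    have "B i \<inter> B j = {}" using r(2) ij by blast
    moreover have "\<pi> i \<noteq> \<pi> j" using \<pi>i ij by (auto dest: inj_onD)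
    moreover have "\<pi> i \<notin> B j" "\<pi> j \<notin> B i" using r(1) ij by blast+
    ultimately show "?C i \<inter> ?C j = {}" using ij by auto
  next
    have "(\<Union>i\<in>{1..n}. ?C i) = (\<Union>i\<in>{1..n}. B i \<union> {\<pi> i})" by (rule SUP_cong) simp_all
    also have "\<dots> = (\<Union>i\<in>{1..n}. B i) \<union> \<pi> ` {1..n}" by blast
    also have "\<dots> = {1..m}" unfolding r(1) using \<pi>m by blast
    finally show "(\<Union>i\<in>{1..n}. ?C i) = {1..m}" .
  qed
  have "nsw n v ?C \<ge> 1 / (8 * real n) * nsw n v N" if N: "allocation n m N" for N
  proof (cases "\<forall>i\<in>{1..n}. 0 < v i (N i)")
    case False
    have Nm: "i \<in> {1..n} \<Longrightarrow> N i \<subseteq> {1..m}" for i using N unfolding allocation_def by blast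
    obtain i where i: "i \<in> {1..n}" "\<not> 0 < v i (N i)" using False by blast
    then have "v i (N i) = 0" using val_nonneg[OF i(1) Nm[OF i(1)]] by simp
    then have "(\<Prod>i=1..n. v i (N i)) = 0" using i(1) by (intro prod_zero) auto
    then have "nsw n v N = 0" by (simp only: nsw_def real_root_zero)
    then show ?thesis using nsw_nonneg[OF al] by simp
  next
    case True
    have Nm: "i \<in> {1..n} \<Longrightarrow> N i \<subseteq> {1..m}" for i using N unfolding allocation_def by blast
    have "\<exists>b. b \<in> N i \<and> (\<forall>g\<in>N i. v i {g} \<le> v i {b})" if i: "i \<in> {1..n}" for i
    proof -
      have "N i \<noteq> {}" using True i val_empty by fastforce
      moreover have fin: "finite (N i)" using Nm[OF i] finite_subset by blast
      ultimately have "Max ((\<lambda>g. v i {g}) ` N i) \<in> (\<lambda>g. v i {g}) ` N i" by (intro Max_in) auto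
      then obtain b where "b \<in> N i" "Max ((\<lambda>g. v i {g}) ` N i) = v i {b}" by auto
      moreover have "v i {g} \<le> Max ((\<lambda>g. v i {g}) ` N i)" if "g \<in> N i" for g
        using that fin by (intro Max_ge) auto
      ultimately show ?thesis by metis
    qed
    then obtain b where b: "\<And>i. i \<in> {1..n} \<Longrightarrow> b i \<in> N i"
      "\<And>i g. i \<in> {1..n} \<Longrightarrow> g \<in> N i \<Longrightarrow> v i {g} \<le> v i {b i}" by metis
    have \<gamma>0: "0 \<le> \<gamma> i" "few_removed i (4 * real n * \<gamma> i)" if "i \<in> {1..n}" for i
      using inv that unfolding thr_inv_def by blast+
    have bm: "matching n m b"
      unfolding matching_def
    proof
      show "inj_on b {1..n}"
      proof (rule inj_onI)
        fix i j assume ij: "i \<in> {1..n}" "j \<in> {1..n}" "b i = b j"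
        then have "N i \<inter> N j \<noteq> {}" using b(1)[of i] b(1)[of j] by auto
        then show "i = j" using N ij(1,2) unfolding allocation_def by blast
      qed
      show "b ` {1..n} \<subseteq> {1..m}" using b(1) Nm by blast
    qed
    have key: "v i (N i) \<le> 4 * real n * (v i {b i} + \<gamma> i)" if i: "i \<in> {1..n}" for i
      using bundle_le_best_good[OF i Nm[OF i] \<gamma>0[OF i]] b[OF i] Nm[OF i] by blast
    have pos: "0 < v i {b i} + \<gamma> i" if i: "i \<in> {1..n}" for i
    proof -
      have "0 < 4 * real n * (v i {b i} + \<gamma> i)" using key[OF i] True i by fastforce
      then show ?thesis using n_pos by (simp add: zero_less_mult_iff)
    qed
    have out: "v i {\<pi> i} + \<gamma> i \<le> 2 * v i (?C i)" if i: "i \<in> {1..n}" for i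
    proof -
      have C: "?C i \<subseteq> {1..m}" using al i unfolding allocation_def by blast
      have "v i {\<pi> i} \<le> v i (?C i)" "v i (B i) \<le> v i (?C i)"
        using i by (intro val_mono[OF i _ C]; auto)+
      then show ?thesis using sat[OF i] by linarith
    qed
    have nn: "0 \<le> v i {\<pi> i} + \<gamma> i" if i: "i \<in> {1..n}" for i
    proof -
      have "{\<pi> i} \<subseteq> {1..m}" using \<pi>m i by blast
      then show ?thesis using val_nonneg[OF i] \<gamma>0[OF i] by simp
    qed
    have "(\<Prod>i\<in>{1..n}. v i (N i)) \<le> (\<Prod>i\<in>{1..n}. 4 * real n * (v i {b i} + \<gamma> i))"
      using key True by (intro prod_mono) (auto intro: less_imp_le)
    also have "\<dots> = (4 * real n) ^ n * (\<Prod>i\<in>{1..n}. v i {b i} + \<gamma> i)"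
      by (simp add: prod.distrib power_mult_distrib)
    also have "\<dots> \<le> (4 * real n) ^ n * (\<Prod>i\<in>{1..n}. v i {\<pi> i} + \<gamma> i)"
      by (intro mult_left_mono max_weight_matching_prod[OF \<pi> bm pos nn]) auto
    also have "\<dots> \<le> (4 * real n) ^ n * (\<Prod>i\<in>{1..n}. 2 * v i (?C i))"
      using out nn by (intro mult_left_mono prod_mono) auto
    also have "\<dots> = (4 * real n * 2) ^ n * (\<Prod>i\<in>{1..n}. v i (?C i))"
      by (simp only: prod.distrib power_mult_distrib prod_constant card_atLeastAtMost) simp
    finally have "(\<Prod>i=1..n. v i (N i)) \<le> (8 * real n) ^ n * (\<Prod>i=1..n. v i (?C i))" by simp
    then have "nsw n v N \<le> root n ((8 * real n) ^ n * (\<Prod>i=1..n. v i (?C i)))"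
      unfolding nsw_def using n_pos by (intro real_root_le_mono) auto
    also have "\<dots> = 8 * real n * nsw n v ?C"
      unfolding nsw_def using n_pos by (simp add: real_root_mult real_root_power_cancel)
    finally show ?thesis using n_pos by (simp add: field_simps)
  qed
  then show ?thesis using al unfolding nash_approx_def nash_optimal_def by blast
qed

lemma output_approx:
  assumes "alg_output n m v C"
  shows "nash_approx (8 * real n) n m v C"
proof -
  obtain t s where run: "alg_run n m v t s" and fin: "unsat s = {}" and C: "C = bundles s"
    using assms unfolding alg_output_def by blast
  from run show ?thesis
  proof cases
    case init
    then show ?thesis using fin n_pos by (simp add: alg_init_def)
  next
    case (iter t' s0)
    then obtain \<pi> B where "max_weight_matching n m v (thr s0) \<pi>" "round_bundles n m v \<pi> B"
      and U: "unsat s = {i\<in>{1..n}. v i (B i) < thr s0 i}"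
      and Cs: "bundles s = (\<lambda>i. if i \<in> {1..n} then B i \<union> {\<pi> i} else {})"
      unfolding alg_iteration_def by blast
    moreover have "thr s0 i \<le> v i (B i)" if "i \<in> {1..n}" for i using U fin that by auto
    ultimately show ?thesis unfolding C Cs using final_round_approx thr_inv_run[OF iter(2)] by blast
  qed
qed

end

text \<open>By the pigeonhole principle some agent receives nothing in every allocation, so all
  allocations have welfare 0.\<close>

lemma nash_approx_few_goods:
  assumes inst: "subadditive_instance n m v" and "m < n" and B: "allocation n m B" "0 < \<alpha>"
  shows "nash_approx \<alpha> n m v B"
proof -
  have 0: "nsw n v N = 0" if N: "allocation n m N" for N
  proof -
    have "\<exists>i\<in>{1..n}. N i = {}"
    proof (rule ccontr)
      assume "\<not> (\<exists>i\<in>{1..n}. N i = {})"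
      then have "\<forall>i\<in>{1..n}. \<exists>g. g \<in> N i" by blast
      from bchoice[OF this] obtain f where f: "\<And>i. i \<in> {1..n} \<Longrightarrow> f i \<in> N i" by blast
      have "inj_on f {1..n}"
      proof (rule inj_onI)
        fix i j assume ij: "i \<in> {1..n}" "j \<in> {1..n}" "f i = f j"
        then have "N i \<inter> N j \<noteq> {}" using f[of i] f[of j] by auto
        then show "i = j" using N ij(1,2) unfolding allocation_def by blast
      qed
      moreover have "f ` {1..n} \<subseteq> {1..m}" using f N unfolding allocation_def by blast
      ultimately have "card {1..n} \<le> card {1..m}" by (rule card_inj_on_le) simp
      then show False using \<open>m < n\<close> by simp
    qed
    then obtain i where i: "i \<in> {1..n}" "N i = {}" by blast
    moreover have "v i {} = 0"
      using inst i unfolding subadditive_instance_def normalized_val_def by blast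
    ultimately have "(\<Prod>i=1..n. v i (N i)) = 0" by (intro prod_zero bexI[of _ i]) simp_all
    then show ?thesis by (simp only: nsw_def real_root_zero)
  qed
  then show ?thesis using B unfolding nash_approx_def nash_optimal_def by simp
qed

section \<open>Programs with bounded loops\<close>

datatype prog =
    Nop
  | SetN string "nexp list" nexp
  | SetR string "nexp list" rexp
  | Ask string "nexp list" nexp string "nexp list"
  | Then prog prog (infixr ";;" 60)
  | Test bexp prog prog
  | For string string prog

primrec compile :: "prog \<Rightarrow> com" where
  "compile Nop = Skip"
| "compile (SetN x is a) = NAssign x is a"
| "compile (SetR x is r) = RAssign x is r"
| "compile (Ask x is a y js) = VQuery x is a y js"
| "compile (p ;; q) = Seq (compile p) (compile q)"
| "compile (Test b p q) = Cond b (compile p) (compile q)"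
| "compile (For x b p) = Seq (NAssign x [] (NConst 1))
     (While (NLess (NVar x []) (NAdd (NVar b []) (NConst 1)))
        (Seq (compile p) (NAssign x [] (NAdd (NVar x []) (NConst 1)))))"

text \<open>The number of passes of a \<open>For\<close> is read from \<open>b\<close> once at the
  start, while the compiled loop compares the counter with \<open>b\<close> before every pass. Both
  agree for \<open>well_formed\<close> programs that leave \<open>n\<close> and \<open>m\<close>
  alone.\<close>

primrec run :: "nat \<Rightarrow> (nat \<Rightarrow> nat set \<Rightarrow> real) \<Rightarrow> prog \<Rightarrow> mem \<Rightarrow> mem" where
  "run m v Nop \<sigma> = \<sigma>"
| "run m v (SetN x is a) \<sigma> = nupd x (map (nval \<sigma>) is) (nval \<sigma> a) \<sigma>"
| "run m v (SetR x is r) \<sigma> = rupd x (map (nval \<sigma>) is) (rval \<sigma> r) \<sigma>"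
| "run m v (Ask x is a y js) \<sigma> =
     rupd x (map (nval \<sigma>) is) (v (nval \<sigma> a) (row_set m \<sigma> y (map (nval \<sigma>) js))) \<sigma>"
| "run m v (p ;; q) \<sigma> = run m v q (run m v p \<sigma>)"
| "run m v (Test b p q) \<sigma> = (if bval \<sigma> b then run m v p \<sigma> else run m v q \<sigma>)"
| "run m v (For x b p) \<sigma> =
     ((\<lambda>\<tau>. let \<tau>' = run m v p \<tau> in nupd x [] (Suc (nmem \<tau>' x [])) \<tau>') ^^ nmem \<sigma> b []) (nupd x [] 1 \<sigma>)"

primrec nmods :: "prog \<Rightarrow> string set" where
  "nmods Nop = {}"
| "nmods (SetN x is a) = {x}"
| "nmods (SetR x is r) = {}"
| "nmods (Ask x is a y js) = {}"
| "nmods (p ;; q) = nmods p \<union> nmods q"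
| "nmods (Test b p q) = nmods p \<union> nmods q"
| "nmods (For x b p) = insert x (nmods p)"

primrec rmods :: "prog \<Rightarrow> string set" where
  "rmods Nop = {}"
| "rmods (SetN x is a) = {}"
| "rmods (SetR x is r) = {x}"
| "rmods (Ask x is a y js) = {x}"
| "rmods (p ;; q) = rmods p \<union> rmods q"
| "rmods (Test b p q) = rmods p \<union> rmods q"
| "rmods (For x b p) = rmods p"

primrec well_formed :: "prog \<Rightarrow> bool" where
  "well_formed Nop = True"
| "well_formed (SetN x is a) = True"
| "well_formed (SetR x is r) = True"
| "well_formed (Ask x is a y js) = True"
| "well_formed (p ;; q) = (well_formed p \<and> well_formed q)"
| "well_formed (Test b p q) = (well_formed p \<and> well_formed q)"
| "well_formed (For x b p) = (b \<in> {''n'', ''m''} \<and> x \<notin> nmods p \<and> well_formed p)"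

text \<open>This is an upper bound for inputs with \<open>n\<close> and \<open>m\<close> at most
  \<open>N\<close>. A \<open>For\<close> pays 2 for the first assignment and the failing test, and
  in each pass 2 for the test and the increment; a \<open>Test\<close> is charged for both
  branches.\<close>

primrec cost :: "nat \<Rightarrow> prog \<Rightarrow> nat" where
  "cost N Nop = 1"
| "cost N (SetN x is a) = 1"
| "cost N (SetR x is r) = 1"
| "cost N (Ask x is a y js) = 1"
| "cost N (p ;; q) = cost N p + cost N q"
| "cost N (Test b p q) = Suc (cost N p + cost N q)"
| "cost N (For x b p) = 2 + N * (cost N p + 2)"

section \<open>Unmodified variables and the loop rule\<close>

lemma nmem_nupd [simp]:
  "nmem (nupd x ks a \<sigma>) y = (if x = y then (nmem \<sigma> x)(ks := a) else nmem \<sigma> y)"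
  "rmem (nupd x ks a \<sigma>) = rmem \<sigma>"
  by (auto simp: nupd_def)

lemma rmem_rupd [simp]:
  "rmem (rupd x ks r \<sigma>) y = (if x = y then (rmem \<sigma> x)(ks := r) else rmem \<sigma> y)"
  "nmem (rupd x ks r \<sigma>) = nmem \<sigma>"
  by (auto simp: rupd_def)

lemma row_set_cong: "nmem \<sigma> y = nmem \<tau> y \<Longrightarrow> row_set m \<sigma> y ks = row_set m \<tau> y ks"
  by (simp add: row_set_def)

lemma run_frame:
  "y \<notin> nmods p \<Longrightarrow> nmem (run m v p \<sigma>) y = nmem \<sigma> y"
  "z \<notin> rmods p \<Longrightarrow> rmem (run m v p \<sigma>) z = rmem \<sigma> z"
proof (induction p arbitrary: \<sigma>)
  case (For x b p)
  { case 1
    have "nmem (((\<lambda>\<tau>. let \<tau>' = run m v p \<tau> in nupd x [] (Suc (nmem \<tau>' x [])) \<tau>') ^^ k) \<tau>) y = nmem \<tau> y" for k \<tau>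
      using 1 For.IH(1) by (induction k) (auto simp: Let_def)
    then show ?case using 1 by auto
  next
    case 2
    have "rmem (((\<lambda>\<tau>. let \<tau>' = run m v p \<tau> in nupd x [] (Suc (nmem \<tau>' x [])) \<tau>') ^^ k) \<tau>) z = rmem \<tau> z" for k \<tau>
      using 2 For.IH(2) by (induction k) (auto simp: Let_def)
    then show ?case by simp }
qed auto

definition frame :: "prog \<Rightarrow> mem \<Rightarrow> mem \<Rightarrow> bool" where
  "frame p \<sigma> \<tau> \<longleftrightarrow> (\<forall>y. y \<notin> nmods p \<longrightarrow> nmem \<tau> y = nmem \<sigma> y) \<and>
     (\<forall>z. z \<notin> rmods p \<longrightarrow> rmem \<tau> z = rmem \<sigma> z)"

text \<open>The loop rule behind all correctness proofs: \<open>I k\<close> describes the memory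
  after \<open>k\<close> passes. By \<open>ins\<close> the invariant is insensitive to the counter,
  and the frame fact available in \<open>step\<close> spares every invariant from listing the
  variables that the loop leaves unchanged.\<close>

lemma For_induct:
  assumes "nmem \<sigma> b [] = N" "x \<notin> nmods p"
    and ins: "\<And>k a \<tau>. I k (nupd x [] a \<tau>) = I k \<tau>"
    and init: "I 0 \<sigma>"
    and step: "\<And>k \<tau>. \<lbrakk>I k \<tau>; k < N; nmem \<tau> x [] = Suc k; frame (For x b p) \<sigma> \<tau>\<rbrakk>
      \<Longrightarrow> I (Suc k) (run m v p \<tau>)"
  shows "I N (run m v (For x b p) \<sigma>)"
proof -
  define f where "f = (\<lambda>\<tau>. let \<tau>' = run m v p \<tau> in nupd x [] (Suc (nmem \<tau>' x [])) \<tau>')"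
  have "k \<le> N \<Longrightarrow> I k ((f ^^ k) (nupd x [] 1 \<sigma>)) \<and> nmem ((f ^^ k) (nupd x [] 1 \<sigma>)) x [] = Suc k \<and>
      frame (For x b p) \<sigma> ((f ^^ k) (nupd x [] 1 \<sigma>))" for k
  proof (induction k)
    case 0
    then show ?case using ins init by (simp add: frame_def One_nat_def)
  next
    case (Suc k)
    let ?\<tau> = "(f ^^ k) (nupd x [] 1 \<sigma>)"
    have IH: "I k ?\<tau>" "nmem ?\<tau> x [] = Suc k" "frame (For x b p) \<sigma> ?\<tau>" using Suc by auto
    have "nmem (run m v p ?\<tau>) x [] = Suc k" using IH(2) run_frame(1)[OF assms(2)] by simp
    then have f: "(f ^^ Suc k) (nupd x [] 1 \<sigma>) = nupd x [] (Suc (Suc k)) (run m v p ?\<tau>)"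
      by (simp add: f_def Let_def)
    show ?case unfolding f using step[OF IH(1) _ IH(2,3)] Suc.prems IH(3)
      by (auto simp: ins frame_def run_frame)
  qed
  then show ?thesis using assms(1) by (simp add: f_def)
qed

section \<open>Translation into the machine model\<close>

lemma exec_compile:
  assumes "well_formed p" "''n'' \<notin> nmods p" "''m'' \<notin> nmods p"
    and "nmem \<sigma> ''n'' [] \<le> N" "nmem \<sigma> ''m'' [] \<le> N"
  shows "\<exists>t. t \<le> cost N p \<and> exec m v (compile p) \<sigma> t (run m v p \<sigma>)"
  using assms
proof (induction p arbitrary: \<sigma>)
  case (Then p q)
  obtain t where t: "t \<le> cost N p" "exec m v (compile p) \<sigma> t (run m v p \<sigma>)"
    using Then.IH(1)[of \<sigma>] Then.prems by auto
  obtain u where u: "u \<le> cost N q" "exec m v (compile q) (run m v p \<sigma>) u (run m v q (run m v p \<sigma>))"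
    using Then.IH(2)[of "run m v p \<sigma>"] Then.prems by (auto simp: run_frame)
  show ?case using t u exec.Seq[OF t(2) u(2)] by (intro exI[of _ "t + u"]) simp
next
  case (Test b p q)
  show ?case
  proof (cases "bval \<sigma> b")
    case True
    obtain t where t: "t \<le> cost N p" "exec m v (compile p) \<sigma> t (run m v p \<sigma>)"
      using Test.IH(1)[of \<sigma>] Test.prems by auto
    show ?thesis using t True exec.CondTrue[OF True t(2)] by (intro exI[of _ "Suc t"]) simp
  next
    case False
    obtain t where t: "t \<le> cost N q" "exec m v (compile q) \<sigma> t (run m v q \<sigma>)"
      using Test.IH(2)[of \<sigma>] Test.prems by auto
    show ?thesis using t False exec.CondFalse[OF False t(2)] by (intro exI[of _ "Suc t"]) simp
  qed
next
  case (For x b p)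
  define f where "f = (\<lambda>\<tau>. let \<tau>' = run m v p \<tau> in nupd x [] (Suc (nmem \<tau>' x [])) \<tau>')"
  define W where "W = While (NLess (NVar x []) (NAdd (NVar b []) (NConst 1)))
        (Seq (compile p) (NAssign x [] (NAdd (NVar x []) (NConst 1))))"
  have b: "b \<in> {''n'', ''m''}" "b \<notin> nmods p" "x \<noteq> b" "x \<notin> nmods p"
    and nm: "x \<noteq> ''n''" "x \<noteq> ''m''" "''n'' \<notin> nmods p" "''m'' \<notin> nmods p" using For.prems by auto
  \<comment> \<open>\<open>k\<close> is the number of passes still to come: the counter runs from 1
    and the test fails when it is one more than the limit.\<close>
  have loop: "\<exists>t. t \<le> 1 + k * (cost N p + 2) \<and> exec m v W \<tau> t ((f ^^ k) \<tau>)"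
    if "nmem \<tau> ''n'' [] \<le> N" "nmem \<tau> ''m'' [] \<le> N" "nmem \<tau> x [] + k = Suc (nmem \<tau> b [])" for k \<tau>
    using that
  proof (induction k arbitrary: \<tau>)
    case 0
    then have "exec m v W \<tau> 1 \<tau>" unfolding W_def by (intro exec.WhileFalse) simp
    then show ?case by auto
  next
    case (Suc k)
    obtain t where t: "t \<le> cost N p" "exec m v (compile p) \<tau> t (run m v p \<tau>)"
      using For.IH[of \<tau>] For.prems Suc.prems by auto
    have fr: "nmem (run m v p \<tau>) x = nmem \<tau> x" "nmem (run m v p \<tau>) b = nmem \<tau> b"
      "nmem (run m v p \<tau>) ''n'' = nmem \<tau> ''n''" "nmem (run m v p \<tau>) ''m'' = nmem \<tau> ''m''"
      using b nm by (simp_all add: run_frame)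
    have "exec m v (NAssign x [] (NAdd (NVar x []) (NConst 1))) (run m v p \<tau>) 1 (f \<tau>)"
      using exec.NAssign[of m v x "[]" "NAdd (NVar x []) (NConst 1)" "run m v p \<tau>"]
      by (simp add: f_def Let_def One_nat_def)
    from exec.Seq[OF t(2) this] have body: "exec m v (Seq (compile p) (NAssign x [] (NAdd (NVar x []) (NConst 1)))) \<tau> (t + 1) (f \<tau>)" .
    have f: "nmem (f \<tau>) ''n'' [] = nmem \<tau> ''n'' []" "nmem (f \<tau>) ''m'' [] = nmem \<tau> ''m'' []"
      "nmem (f \<tau>) b [] = nmem \<tau> b []" "nmem (f \<tau>) x [] = Suc (nmem \<tau> x [])"
      using fr nm b by (simp_all add: f_def Let_def)
    obtain u where u: "u \<le> 1 + k * (cost N p + 2)" "exec m v W (f \<tau>) u ((f ^^ k) (f \<tau>))"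
      using Suc.IH[of "f \<tau>"] Suc.prems f by auto
    have "exec m v W \<tau> (Suc ((t + 1) + u)) ((f ^^ k) (f \<tau>))"
      unfolding W_def by (rule exec.WhileTrue[OF _ body u(2)[unfolded W_def]]) (use Suc.prems in simp)
    then show ?case using t u by (intro exI[of _ "Suc ((t + 1) + u)"]) (simp add: funpow_swap1)
  qed
  let ?\<sigma> = "nupd x [] 1 \<sigma>"
  have e1: "exec m v (NAssign x [] (NConst 1)) \<sigma> 1 ?\<sigma>"
    using exec.NAssign[of m v x "[]" "NConst 1" \<sigma>] by simp
  obtain t where t: "t \<le> 1 + nmem \<sigma> b [] * (cost N p + 2)" "exec m v W ?\<sigma> t ((f ^^ nmem \<sigma> b []) ?\<sigma>)"
    using loop[of ?\<sigma> "nmem \<sigma> b []"] For.prems b nm by auto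
  have "nmem \<sigma> b [] \<le> N" using b For.prems by auto
  then have "nmem \<sigma> b [] * (cost N p + 2) \<le> N * (cost N p + 2)" by (rule mult_le_mono1)
  then show ?case using exec.Seq[OF e1 t(2)] t(1)
    by (intro exI[of _ "1 + t"]) (simp add: W_def f_def)
qed (auto intro: exec.intros)

section \<open>Polynomial cost\<close>

lemma polynomially_bounded_add:
  fixes f g :: "nat \<Rightarrow> nat"
  assumes "\<exists>K d. \<forall>N. f N \<le> K * (N + 1) ^ d" "\<exists>K d. \<forall>N. g N \<le> K * (N + 1) ^ d"
  shows "\<exists>K d. \<forall>N. f N + g N \<le> K * (N + 1) ^ d"
proof -
  obtain K d K' d' where f: "\<And>N. f N \<le> K * (N + 1) ^ d" and g: "\<And>N. g N \<le> K' * (N + 1) ^ d'"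
    using assms by blast
  have "f N + g N \<le> (K + K') * (N + 1) ^ (d + d')" for N
  proof -
    have "K * (N + 1) ^ d \<le> K * (N + 1) ^ (d + d')" "K' * (N + 1) ^ d' \<le> K' * (N + 1) ^ (d + d')"
      by (intro mult_le_mono2 power_increasing; simp)+
    then show ?thesis using f[of N] g[of N] unfolding distrib_right by linarith
  qed
  then show ?thesis by blast
qed

lemma cost_polynomial: "\<exists>K d. \<forall>N. cost N p \<le> K * (N + 1) ^ d"
proof (induction p)
  case (Then p q)
  then show ?case by (simp add: polynomially_bounded_add)
next
  case (Test b p q)
  have "\<exists>K d. \<forall>N. (cost N p + cost N q) + 1 \<le> K * (N + 1) ^ d"
  proof (rule polynomially_bounded_add)
    show "\<exists>K d. \<forall>N. cost N p + cost N q \<le> K * (N + 1) ^ d" using Test by (rule polynomially_bounded_add)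
    show "\<exists>K d. \<forall>N. 1 \<le> K * (N + 1 :: nat) ^ d" by (intro exI[of _ 1]) simp
  qed
  then show ?case by (simp add: One_nat_def)
next
  case (For x b p)
  then obtain K d where K: "\<forall>N. cost N p \<le> K * (N + 1) ^ d" by blast
  \<comment> \<open>The 4 splits into 2 for the overhead of each pass, absorbed in
    \<open>K + 2\<close>, and 2 for the overhead outside the passes.\<close>
  have "cost N (For x b p) \<le> (K + 4) * (N + 1) ^ Suc d" for N
  proof -
    have 1: "1 \<le> (N + 1) ^ d" by simp
    have "N * (cost N p + 2) \<le> (N + 1) * ((K + 2) * (N + 1) ^ d)"
    proof (rule mult_le_mono)
      show "cost N p + 2 \<le> (K + 2) * (N + 1) ^ d"
        using K[rule_format, of N] 1 unfolding distrib_right by linarith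
    qed simp
    moreover have "2 \<le> 2 * (N + 1) ^ Suc d" by simp
    ultimately show ?thesis by (simp add: algebra_simps)
  qed
  then show ?case by blast
qed (auto intro: exI[of _ 1])

section \<open>Derived tests and loops that fill an array\<close>

definition NEq :: "nexp \<Rightarrow> nexp \<Rightarrow> bexp" where
  "NEq a b = BAnd (BNot (NLess a b)) (BNot (NLess b a))"

definition BOr :: "bexp \<Rightarrow> bexp \<Rightarrow> bexp" where
  "BOr a b = BNot (BAnd (BNot a) (BNot b))"

lemma bval_NEq [simp]: "bval \<sigma> (NEq a b) \<longleftrightarrow> nval \<sigma> a = nval \<sigma> b"
  by (auto simp: NEq_def)

lemma bval_BOr [simp]: "bval \<sigma> (BOr a b) \<longleftrightarrow> bval \<sigma> a \<or> bval \<sigma> b"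
  by (simp add: BOr_def)

lemma frame_run: "frame p \<sigma> (run m v p \<sigma>)"
  by (simp add: frame_def run_frame)

lemma frameD:
  assumes "frame p \<sigma> \<tau>"
  shows "y \<notin> nmods p \<Longrightarrow> nmem \<tau> y = nmem \<sigma> y" "z \<notin> rmods p \<Longrightarrow> rmem \<tau> z = rmem \<sigma> z"
  using assms by (simp_all add: frame_def)

text \<open>This serves loops that fill the row \<open>ps\<close> of \<open>y\<close> from 1 to
  \<open>N\<close>. Pass \<open>k\<close> writes only the entry \<open>ps @ [k]\<close>, so the body
  may rely on the initial value still being stored there; \<open>last ks\<close> reads the number of
  the pass back from the index.\<close>

lemma For_nset:
  assumes N: "nmem \<sigma> b [] = N" and x: "x \<notin> nmods p" "x \<noteq> y"
    and body: "\<And>k \<tau>. \<lbrakk>k \<in> {1..N}; nmem \<tau> x [] = k; frame (For x b p) \<sigma> \<tau>;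
        nmem \<tau> y (ps @ [k]) = nmem \<sigma> y (ps @ [k])\<rbrakk>
      \<Longrightarrow> nmem (run m v p \<tau>) y = (nmem \<tau> y)(ps @ [k] := f k)"
  shows "nmem (run m v (For x b p) \<sigma>) y =
    (\<lambda>ks. if \<exists>k\<in>{1..N}. ks = ps @ [k] then f (last ks) else nmem \<sigma> y ks)"
proof -
  let ?I = "\<lambda>j \<tau>. nmem \<tau> y = (\<lambda>ks. if \<exists>k\<in>{1..j}. ks = ps @ [k] then f (last ks) else nmem \<sigma> y ks)"
  show ?thesis
  proof (rule For_induct[where I = ?I, OF N x(1)])
    fix k \<tau> assume I: "?I k \<tau>" and k: "k < N" "nmem \<tau> x [] = Suc k" "frame (For x b p) \<sigma> \<tau>"
    have "nmem \<tau> y (ps @ [Suc k]) = nmem \<sigma> y (ps @ [Suc k])" using I by simp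
    then have "nmem (run m v p \<tau>) y = (nmem \<tau> y)(ps @ [Suc k] := f (Suc k))"
      using body[of "Suc k" \<tau>] k by simp
    moreover have "{1..Suc k} = insert (Suc k) {1..k}" by auto
    ultimately show "?I (Suc k) (run m v p \<tau>)" by (subst (asm) I) (simp add: fun_eq_iff)
  qed (use x(2) in simp_all)
qed

lemma For_rset:
  assumes N: "nmem \<sigma> b [] = N" and x: "x \<notin> nmods p"
    and body: "\<And>k \<tau>. \<lbrakk>k \<in> {1..N}; nmem \<tau> x [] = k; frame (For x b p) \<sigma> \<tau>;
        rmem \<tau> y (ps @ [k]) = rmem \<sigma> y (ps @ [k])\<rbrakk>
      \<Longrightarrow> rmem (run m v p \<tau>) y = (rmem \<tau> y)(ps @ [k] := f k)"
  shows "rmem (run m v (For x b p) \<sigma>) y =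
    (\<lambda>ks. if \<exists>k\<in>{1..N}. ks = ps @ [k] then f (last ks) else rmem \<sigma> y ks)"
proof -
  let ?I = "\<lambda>j \<tau>. rmem \<tau> y = (\<lambda>ks. if \<exists>k\<in>{1..j}. ks = ps @ [k] then f (last ks) else rmem \<sigma> y ks)"
  show ?thesis
  proof (rule For_induct[where I = ?I, OF N x])
    fix k \<tau> assume I: "?I k \<tau>" and k: "k < N" "nmem \<tau> x [] = Suc k" "frame (For x b p) \<sigma> \<tau>"
    have "rmem \<tau> y (ps @ [Suc k]) = rmem \<sigma> y (ps @ [Suc k])" using I by simp
    then have "rmem (run m v p \<tau>) y = (rmem \<tau> y)(ps @ [Suc k] := f (Suc k))"
      using body[of "Suc k" \<tau>] k by simp
    moreover have "{1..Suc k} = insert (Suc k) {1..k}" by auto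
    ultimately show "?I (Suc k) (run m v p \<tau>)" by (subst (asm) I) (simp add: fun_eq_iff)
  qed simp_all
qed

section \<open>The Hungarian method\<close>

locale assignment_problem =
  fixes n m :: nat and w :: "nat \<Rightarrow> nat \<Rightarrow> real"
  assumes n_le_m: "n \<le> m" and w_pos: "\<lbrakk>i \<in> {1..n}; g \<in> {1..m}\<rbrakk> \<Longrightarrow> 0 < w i g"
begin

text \<open>The logarithms of \<open>u\<close> and \<open>p\<close> are the dual variables of the
  additive assignment problem. Its goods may stay unmatched, hence nonnegative logarithms of prices,
  that is \<open>1 \<le> p g\<close>.\<close>

definition dual_feasible :: "(nat \<Rightarrow> real) \<Rightarrow> (nat \<Rightarrow> real) \<Rightarrow> bool" where
  "dual_feasible u p \<longleftrightarrow> (\<forall>i\<in>{1..n}. 0 < u i) \<and> (\<forall>g\<in>{1..m}. 1 \<le> p g) \<and>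
     (\<forall>i\<in>{1..n}. \<forall>g\<in>{1..m}. w i g \<le> u i * p g)"

definition tight_matching :: "nat set \<Rightarrow> (nat \<Rightarrow> nat) \<Rightarrow> (nat \<Rightarrow> real) \<Rightarrow> (nat \<Rightarrow> real) \<Rightarrow> bool" where
  "tight_matching D \<mu> u p \<longleftrightarrow> inj_on \<mu> D \<and> \<mu> ` D \<subseteq> {1..m} \<and> (\<forall>i\<in>D. w i (\<mu> i) = u i * p (\<mu> i))"

text \<open>Tightness and price 1 for unmatched goods are complementary slackness. Only the agents
  up to \<open>r\<close> are matched, whereas feasibility is kept for all agents from the
  start.\<close>

definition optimal_pair :: "nat \<Rightarrow> (nat \<Rightarrow> nat) \<Rightarrow> (nat \<Rightarrow> real) \<Rightarrow> (nat \<Rightarrow> real) \<Rightarrow> bool" where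
  "optimal_pair r \<mu> u p \<longleftrightarrow> dual_feasible u p \<and> tight_matching {1..r} \<mu> u p \<and>
     (\<forall>g\<in>{1..m} - \<mu> ` {1..r}. p g = 1)"

text \<open>Weak duality: the product of any matching is at most the product of all \<open>u\<close>
  times the product of all prices, since prices are at least 1. The pair attains this bound because
  its edges are tight and the goods outside its image contribute the factor 1.\<close>

lemma optimal_pair_max:
  assumes opt: "optimal_pair n \<mu> u p" and \<sigma>: "matching n m \<sigma>"
  shows "(\<Prod>i\<in>{1..n}. w i (\<sigma> i)) \<le> (\<Prod>i\<in>{1..n}. w i (\<mu> i))"
proof -
  have p: "\<And>g. g \<in> {1..m} \<Longrightarrow> 1 \<le> p g" and u: "\<And>i. i \<in> {1..n} \<Longrightarrow> 0 < u i"
    and le: "\<And>i g. \<lbrakk>i \<in> {1..n}; g \<in> {1..m}\<rbrakk> \<Longrightarrow> w i g \<le> u i * p g"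
    and \<mu>: "inj_on \<mu> {1..n}" "\<mu> ` {1..n} \<subseteq> {1..m}" "\<And>i. i \<in> {1..n} \<Longrightarrow> w i (\<mu> i) = u i * p (\<mu> i)"
    and p1: "\<And>g. g \<in> {1..m} - \<mu> ` {1..n} \<Longrightarrow> p g = 1"
    using opt unfolding optimal_pair_def dual_feasible_def tight_matching_def by blast+
  have \<sigma>i: "inj_on \<sigma> {1..n}" and \<sigma>m: "\<sigma> ` {1..n} \<subseteq> {1..m}" using \<sigma> by (auto simp: matching_def)
  have \<sigma>1: "\<sigma> i \<in> {1..m}" if "i \<in> {1..n}" for i using \<sigma>m that by blast
  have "(\<Prod>i\<in>{1..n}. w i (\<sigma> i)) \<le> (\<Prod>i\<in>{1..n}. u i * p (\<sigma> i))"
    using le \<sigma>1 w_pos by (intro prod_mono) (simp add: less_imp_le)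
  also have "\<dots> = (\<Prod>i\<in>{1..n}. u i) * (\<Prod>g\<in>\<sigma> ` {1..n}. p g)"
    using \<sigma>i by (simp add: prod.distrib prod.reindex)
  also have "\<dots> \<le> (\<Prod>i\<in>{1..n}. u i) * (\<Prod>g\<in>{1..m}. p g)"
  proof (rule mult_left_mono)
    show "(\<Prod>g\<in>\<sigma> ` {1..n}. p g) \<le> (\<Prod>g\<in>{1..m}. p g)"
    proof (rule prod_mono2)
      fix g assume "g \<in> \<sigma> ` {1..n}"
      then have "1 \<le> p g" using p \<sigma>m by blast
      then show "0 \<le> p g" by simp
    qed (use \<sigma>m p in auto)
    show "0 \<le> (\<Prod>i\<in>{1..n}. u i)" using u by (intro prod_nonneg) (auto intro: less_imp_le)
  qed
  also have "(\<Prod>g\<in>{1..m}. p g) = (\<Prod>g\<in>\<mu> ` {1..n}. p g)"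
    using \<mu>(2) p1 by (intro prod.mono_neutral_right) auto
  also have "(\<Prod>i\<in>{1..n}. u i) * (\<Prod>g\<in>\<mu> ` {1..n}. p g) = (\<Prod>i\<in>{1..n}. u i * p (\<mu> i))"
    using \<mu>(1) by (simp add: prod.distrib prod.reindex)
  also have "\<dots> = (\<Prod>i\<in>{1..n}. w i (\<mu> i))" using \<mu>(3) by (intro prod.cong) auto
  finally show ?thesis .
qed

section \<open>The search for an augmentation\<close>

text \<open>Each reached agent \<open>i\<close> carries a tight matching \<open>alt i\<close> that leaves \<open>i\<close> instead of \<open>r\<close> unmatched,
  so that no augmenting path has to be traced back.\<close>

definition search_inv ::
    "nat \<Rightarrow> (nat \<Rightarrow> nat) \<Rightarrow> nat set \<Rightarrow> (nat \<Rightarrow> nat \<Rightarrow> nat) \<Rightarrow> (nat \<Rightarrow> real) \<Rightarrow> (nat \<Rightarrow> real) \<Rightarrow> bool" where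
  "search_inv r \<mu> S alt u p \<longleftrightarrow> r \<in> {1..n} \<and> optimal_pair (r - 1) \<mu> u p \<and> r \<in> S \<and> S \<subseteq> {1..r} \<and>
     (\<forall>i\<in>S. tight_matching ({1..r} - {i}) (alt i) u p \<and>
            alt i ` ({1..r} - {i}) = \<mu> ` {1..r - 1} \<and> (\<forall>j\<in>{1..r} - S. alt i j = \<mu> j))"

definition reached_goods :: "nat \<Rightarrow> (nat \<Rightarrow> nat) \<Rightarrow> nat set \<Rightarrow> nat set" where
  "reached_goods r \<mu> S = \<mu> ` (S - {r})"

lemma search_inv_init:
  assumes "optimal_pair (r - 1) \<mu> u p" "r \<in> {1..n}" "\<And>k. k \<in> {1..r - 1} \<Longrightarrow> alt r k = \<mu> k"
  shows "search_inv r \<mu> {r} alt u p"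
proof -
  have e: "{1..r} - {r} = {1..r - 1}" by auto
  have im: "alt r ` {1..r - 1} = \<mu> ` {1..r - 1}" using assms(3) by (rule image_cong[OF refl])
  have "inj_on (alt r) {1..r - 1} = inj_on \<mu> {1..r - 1}" using assms(3) by (rule inj_on_cong)
  then have "tight_matching {1..r - 1} (alt r) u p"
    using assms im unfolding optimal_pair_def tight_matching_def by simp
  moreover have "alt r j = \<mu> j" if "j \<in> {1..r} - {r}" for j using assms(3) that unfolding e by blast
  ultimately show ?thesis using assms(1,2) im unfolding search_inv_def
    by (intro conjI ballI) (simp_all add: e)
qed

text \<open>At most \<open>r - 1 < m\<close> goods are held by reached agents. This makes the
  minimum of \<open>search_relabel\<close> a minimum over a nonempty set.\<close>

lemma unreached_good_exists:
  assumes "search_inv r \<mu> S alt u p"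
  shows "\<exists>g\<in>{1..m}. g \<notin> reached_goods r \<mu> S"
proof -
  have S: "S - {r} \<subseteq> {1..r - 1}" and r: "r \<in> {1..n}"
    using assms unfolding search_inv_def by fastforce+
  have f: "finite (S - {r})" using S finite_subset by blast
  have "card (reached_goods r \<mu> S) \<le> card (S - {r})"
    unfolding reached_goods_def by (rule card_image_le[OF f])
  also have "\<dots> \<le> card {1..r - 1}" using S by (intro card_mono) auto
  also have "\<dots> < card {1..m}" using r n_le_m by auto
  finally have c: "card (reached_goods r \<mu> S) < card {1..m}" .
  have "\<not> {1..m} \<subseteq> reached_goods r \<mu> S"
  proof
    assume "{1..m} \<subseteq> reached_goods r \<mu> S"
    then have "card {1..m} \<le> card (reached_goods r \<mu> S)"
      using f by (intro card_mono) (simp add: reached_goods_def)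
    then show False using c by simp
  qed
  then show ?thesis by blast
qed

text \<open>\<open>alt i\<close> agrees with \<open>\<mu>\<close> on unreached agents and uses the
  same goods, so by injectivity it sends reached agents to reached goods. Every edge of
  \<open>alt i\<close> therefore has both ends reached or none, which is what keeps it tight under
  relabelling.\<close>

lemma search_inv_alt_reached:
  assumes inv: "search_inv r \<mu> S alt u p" and i: "i \<in> S" and j: "j \<in> {1..r} - {i}"
  shows "alt i j \<in> reached_goods r \<mu> S \<longleftrightarrow> j \<in> S"
proof -
  have \<mu>i: "inj_on \<mu> {1..r - 1}" and r: "r \<in> S" "S \<subseteq> {1..r}"
    using inv unfolding search_inv_def optimal_pair_def tight_matching_def by blast+
  have ai: "inj_on (alt i) ({1..r} - {i})" and im: "alt i ` ({1..r} - {i}) = \<mu> ` {1..r - 1}"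
    and out: "\<And>j. j \<in> {1..r} - S \<Longrightarrow> alt i j = \<mu> j"
    using inv i unfolding search_inv_def tight_matching_def by blast+
  have S1: "S - {r} \<subseteq> {1..r - 1}" using r by fastforce
  have out1: "k \<in> {1..r - 1}" if "k \<in> {1..r} - S" for k using that r(1) by (cases "k = r") auto
  show ?thesis
  proof (cases "j \<in> S")
    case False
    then have "alt i j = \<mu> j" using out j by blast
    moreover have "\<mu> j \<notin> \<mu> ` (S - {r})"
    proof
      assume "\<mu> j \<in> \<mu> ` (S - {r})"
      then obtain k where k: "k \<in> S - {r}" "\<mu> k = \<mu> j" by (metis imageE)
      moreover have "j \<in> {1..r - 1}" using False j out1 by blast
      ultimately have "k = j" using \<mu>i S1 by (auto dest: inj_onD)
      then show False using k False by blast
    qed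
    ultimately show ?thesis using False by (simp add: reached_goods_def)
  next
    case True
    have "alt i j \<in> \<mu> ` {1..r - 1}" using im j by blast
    then obtain k where k: "k \<in> {1..r - 1}" "alt i j = \<mu> k" by auto
    have "k \<in> S"
    proof (rule ccontr)
      assume kS: "k \<notin> S"
      have k1: "k \<in> {1..r} - {i}" using k(1) kS i by auto
      then have "alt i k = \<mu> k" using out kS by blast
      then have "k = j" using inj_onD[OF ai _ k1 j] k(2) by simp
      then show False using True kS by blast
    qed
    moreover have "k \<noteq> r" using k(1) r by auto
    ultimately have "alt i j \<in> reached_goods r \<mu> S" using k(2) unfolding reached_goods_def by blast
    then show ?thesis using True by simp
  qed
qed

text \<open>Feasibility of the edge from \<open>a\<close> to \<open>b\<close> gives
  \<open>1 \<le> x\<close>. Dividing the duals of \<open>S\<close> and multiplying the reached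
  prices by \<open>x\<close> leaves edges with both or no end reached as they were and relaxes those
  with only the good reached. An edge with only the agent reached loses the factor \<open>x\<close>,
  which it can afford because \<open>x\<close> is the least ratio; the edge attaining it becomes
  tight. Unmatched goods are not reached and keep price 1.\<close>

lemma search_relabel:
  assumes inv: "search_inv r \<mu> S alt u p"
    and a: "a \<in> S" and b: "b \<in> {1..m}" "b \<notin> reached_goods r \<mu> S"
    and x: "x = u a * p b / w a b"
    and min: "\<And>i g. \<lbrakk>i \<in> S; g \<in> {1..m}; g \<notin> reached_goods r \<mu> S\<rbrakk> \<Longrightarrow> x \<le> u i * p g / w i g"
    and u': "\<And>i. u' i = (if i \<in> S then u i / x else u i)"
    and p': "\<And>g. p' g = (if g \<in> reached_goods r \<mu> S then p g * x else p g)"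
  shows "search_inv r \<mu> S alt u' p'" "w a b = u' a * p' b"
proof -
  let ?T = "reached_goods r \<mu> S"
  have r: "r \<in> {1..n}" "r \<in> S" "S \<subseteq> {1..r}" using inv unfolding search_inv_def by blast+
  have rn: "{1..r} \<subseteq> {1..n}" using r by auto
  have Sn: "S \<subseteq> {1..n}" using r(3) rn by blast
  have opt: "dual_feasible u p" "tight_matching {1..r - 1} \<mu> u p"
    and free: "\<And>g. g \<in> {1..m} - \<mu> ` {1..r - 1} \<Longrightarrow> p g = 1"
    using inv unfolding search_inv_def optimal_pair_def by blast+
  have pos: "\<And>i. i \<in> {1..n} \<Longrightarrow> 0 < u i" and p1: "\<And>g. g \<in> {1..m} \<Longrightarrow> 1 \<le> p g"
    and feas: "\<And>i g. \<lbrakk>i \<in> {1..n}; g \<in> {1..m}\<rbrakk> \<Longrightarrow> w i g \<le> u i * p g"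
    using opt(1) unfolding dual_feasible_def by blast+
  have \<mu>: "inj_on \<mu> {1..r - 1}" "\<mu> ` {1..r - 1} \<subseteq> {1..m}"
      "\<And>i. i \<in> {1..r - 1} \<Longrightarrow> w i (\<mu> i) = u i * p (\<mu> i)"
    using opt(2) unfolding tight_matching_def by blast+
  have wab: "0 < w a b" using w_pos a Sn b by blast
  have x1: "1 \<le> x" using feas[of a b] a Sn b wab unfolding x by (auto simp: field_simps)
  have S1: "S - {r} \<subseteq> {1..r - 1}" using r(3) by fastforce
  have T: "?T \<subseteq> \<mu> ` {1..r - 1}" unfolding reached_goods_def using S1 by blast
  show "w a b = u' a * p' b" using a b wab x1 pos[of a] p1[of b] Sn unfolding u' p' x by auto
  have tight: "w j g = u' j * p' g" if "w j g = u j * p g" "j \<in> S \<longleftrightarrow> g \<in> ?T" for j g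
    using that x1 by (auto simp: u' p')
  have \<mu>T: "\<mu> j \<in> ?T \<longleftrightarrow> j \<in> S" if "j \<in> {1..r - 1}" for j
  proof -
    have "j \<noteq> r" using that r(1) by auto
    moreover have "k = j" if "k \<in> S - {r}" "\<mu> k = \<mu> j" for k
      using inj_onD[OF \<mu>(1) that(2)] that(1) S1 \<open>j \<in> {1..r - 1}\<close> by blast
    ultimately show ?thesis unfolding reached_goods_def by (metis Diff_iff image_iff singletonD)
  qed
  have "dual_feasible u' p'"
    unfolding dual_feasible_def
  proof (intro conjI ballI)
    fix i assume "i \<in> {1..n}"
    then show "0 < u' i" using pos x1 by (auto simp: u')
  next
    fix g assume "g \<in> {1..m}"
    then have "1 \<le> p g" using p1 by blast
    moreover have "1 * 1 \<le> p g * x" using \<open>1 \<le> p g\<close> x1 by (intro mult_mono) auto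
    ultimately show "1 \<le> p' g" by (simp add: p')
  next
    fix i g assume i: "i \<in> {1..n}" and g: "g \<in> {1..m}"
    have ui: "0 < u i" and pg: "1 \<le> p g" using pos p1 i g by blast+
    show "w i g \<le> u' i * p' g"
    proof (cases "i \<in> S")
      case True
      show ?thesis
      proof (cases "g \<in> ?T")
        case True
        then show ?thesis using feas[OF i g] x1 \<open>i \<in> S\<close> by (simp add: u' p')
      next
        case False
        have "x \<le> u i * p g / w i g" using min \<open>i \<in> S\<close> g False by blast
        then have "w i g * x \<le> u i * p g" using w_pos[OF i g] by (simp add: field_simps)
        then show ?thesis using x1 True False by (simp add: u' p' field_simps)
      qed
    next
      case False
      have "u i * p g \<le> u i * p' g" using x1 ui pg by (auto simp: p' mult_left_le intro!: mult_left_mono)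
      then show ?thesis using feas[OF i g] False by (simp add: u')
    qed
  qed
  moreover have "tight_matching {1..r - 1} \<mu> u' p'"
    unfolding tight_matching_def using \<mu> \<mu>T tight by blast
  moreover have "p' g = 1" if "g \<in> {1..m} - \<mu> ` {1..r - 1}" for g
    using free[OF that] that T by (auto simp: p')
  ultimately have opt: "optimal_pair (r - 1) \<mu> u' p'" unfolding optimal_pair_def by blast
  have "tight_matching ({1..r} - {i}) (alt i) u' p'" if i: "i \<in> S" for i
  proof -
    have ti: "tight_matching ({1..r} - {i}) (alt i) u p" using inv i unfolding search_inv_def by blast
    moreover have "w j (alt i j) = u' j * p' (alt i j)" if j: "j \<in> {1..r} - {i}" for j
      using ti j tight search_inv_alt_reached[OF inv i j] unfolding tight_matching_def by blast
    ultimately show ?thesis unfolding tight_matching_def by blast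
  qed
  then show "search_inv r \<mu> S alt u' p'" using inv opt unfolding search_inv_def by blast
qed

text \<open>\<open>alt a\<close> already matches everybody up to \<open>r\<close> except
  \<open>a\<close>, using only the old goods, so giving the free good \<open>b\<close> to
  \<open>a\<close> completes it.\<close>

lemma search_augment:
  assumes inv: "search_inv r \<mu> S alt u p" and a: "a \<in> S" and b: "b \<in> {1..m}" "b \<notin> \<mu> ` {1..r - 1}"
    and tight: "w a b = u a * p b"
    and \<mu>': "\<And>k. k \<in> {1..r} \<Longrightarrow> \<mu>' k = (if k = a then b else alt a k)"
  shows "optimal_pair r \<mu>' u p"
proof -
  have aD: "a \<in> {1..r}" using inv a unfolding search_inv_def by blast
  have opt: "optimal_pair (r - 1) \<mu> u p" and ta: "tight_matching ({1..r} - {a}) (alt a) u p"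
    and im: "alt a ` ({1..r} - {a}) = \<mu> ` {1..r - 1}"
    using inv a unfolding search_inv_def by blast+
  have ra: "{1..r} = insert a ({1..r} - {a})" using aD by blast
  have im': "\<mu>' ` ({1..r} - {a}) = \<mu> ` {1..r - 1}"
    unfolding im[symmetric] by (rule image_cong) (auto simp: \<mu>')
  have \<mu>'a: "\<mu>' a = b" using \<mu>' aD by simp
  have img: "\<mu>' ` {1..r} = insert b (\<mu> ` {1..r - 1})"
    unfolding im'[symmetric] \<mu>'a[symmetric] using ra by (metis image_insert)
  have "inj_on \<mu>' ({1..r} - {a}) = inj_on (alt a) ({1..r} - {a})"
    by (rule inj_on_cong) (auto simp: \<mu>')
  then have "inj_on \<mu>' ({1..r} - {a})" using ta unfolding tight_matching_def by blast
  moreover have "\<mu>' a \<notin> \<mu>' ` ({1..r} - {a})" unfolding im' \<mu>'a using b by blast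
  ultimately have "inj_on \<mu>' {1..r}" using inj_on_insert[of \<mu>' a "{1..r} - {a}"] ra by simp
  moreover have "\<mu>' ` {1..r} \<subseteq> {1..m}"
    unfolding img using b opt unfolding optimal_pair_def tight_matching_def by blast
  moreover have "w k (\<mu>' k) = u k * p (\<mu>' k)" if "k \<in> {1..r}" for k
    using that tight ta \<mu>' unfolding tight_matching_def by (cases "k = a") auto
  ultimately have "tight_matching {1..r} \<mu>' u p" unfolding tight_matching_def by blast
  then show ?thesis using opt img unfolding optimal_pair_def by auto
qed

text \<open>As \<open>j\<close> is unreached, \<open>alt a\<close> gives \<open>\<mu> j\<close> to
  \<open>j\<close>. Moving this good to \<open>a\<close> along the tight edge leaves
  \<open>j\<close> as the only unmatched agent, and the result becomes the matching stored for
  \<open>j\<close>.\<close>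

lemma search_extend:
  assumes inv: "search_inv r \<mu> S alt u p" and a: "a \<in> S"
    and j: "j \<in> {1..r - 1}" "\<mu> j \<notin> reached_goods r \<mu> S"
    and tight: "w a (\<mu> j) = u a * p (\<mu> j)"
    and old: "\<And>i k. \<lbrakk>i \<in> S; k \<in> {1..r}\<rbrakk> \<Longrightarrow> alt' i k = alt i k"
    and new: "\<And>k. k \<in> {1..r} \<Longrightarrow> alt' j k = (if k = a then \<mu> j else alt a k)"
  shows "search_inv r \<mu> (insert j S) alt' u p" "j \<notin> S"
    "reached_goods r \<mu> (insert j S) = insert (\<mu> j) (reached_goods r \<mu> S)"
proof -
  have r: "r \<in> {1..n}" "r \<in> S" "S \<subseteq> {1..r}" using inv unfolding search_inv_def by blast+
  have aD: "a \<in> {1..r}" using inv a unfolding search_inv_def by blast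
  have opt: "optimal_pair (r - 1) \<mu> u p" and ta: "tight_matching ({1..r} - {a}) (alt a) u p"
    and im: "alt a ` ({1..r} - {a}) = \<mu> ` {1..r - 1}" and out: "\<And>j. j \<in> {1..r} - S \<Longrightarrow> alt a j = \<mu> j"
    using inv a unfolding search_inv_def by blast+
  have jr: "j \<noteq> r" "j \<in> {1..r}" using j(1) r(1) by auto
  show jS: "j \<notin> S" using j(2) jr unfolding reached_goods_def by blast
  show "reached_goods r \<mu> (insert j S) = insert (\<mu> j) (reached_goods r \<mu> S)"
    unfolding reached_goods_def using jr by auto
  have ja: "j \<noteq> a" using jS a by blast
  have aj: "alt a j = \<mu> j" using out jr jS by blast
  have ai: "inj_on (alt a) ({1..r} - {a})" using ta unfolding tight_matching_def by blast
  define E where "E = {1..r} - {a, j}"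
  have D1: "{1..r} - {a} = insert j E" and D2: "{1..r} - {j} = insert a E"
    using ja jr aD by (auto simp: E_def)
  have E: "a \<notin> E" "j \<notin> E" "E \<subseteq> {1..r}" by (auto simp: E_def)
  have e: "alt' j k = alt a k" if "k \<in> E" for k using that new E by auto
  have alta: "alt' j a = \<mu> j" using new aD by simp
  have imE: "alt' j ` E = alt a ` E" using e by (rule image_cong[OF refl])
  have im1: "\<mu> ` {1..r - 1} = insert (\<mu> j) (alt a ` E)" using im unfolding D1 by (simp add: aj)
  have im2: "alt' j ` ({1..r} - {j}) = \<mu> ` {1..r - 1}" unfolding D2 im1 by (simp add: imE alta)
  have "inj_on (alt' j) E = inj_on (alt a) E" using e by (rule inj_on_cong)
  moreover have "inj_on (alt a) E" "alt a j \<notin> alt a ` E" using ai E unfolding D1 by auto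
  ultimately have "inj_on (alt' j) ({1..r} - {j})" unfolding D2 using aj alta imE E by auto
  moreover have "w k (alt' j k) = u k * p (alt' j k)" if k: "k \<in> {1..r} - {j}" for k
  proof (cases "k = a")
    case True
    then show ?thesis using tight alta by simp
  next
    case False
    then have "k \<in> E" using k unfolding D2 by blast
    then have "k \<in> {1..r} - {a}" unfolding D1 by blast
    then show ?thesis using ta e[OF \<open>k \<in> E\<close>] unfolding tight_matching_def by simp
  qed
  moreover have "\<mu> ` {1..r - 1} \<subseteq> {1..m}" using opt unfolding optimal_pair_def tight_matching_def by blast
  ultimately have tj: "tight_matching ({1..r} - {j}) (alt' j) u p"
    unfolding tight_matching_def im2 by blast
  have outj: "alt' j k = \<mu> k" if "k \<in> {1..r} - insert j S" for k
  proof -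
    have "k \<in> {1..r} - S" "k \<noteq> a" using that a by auto
    then show ?thesis using new out by simp
  qed
  have rest: "tight_matching ({1..r} - {i}) (alt' i) u p \<and>
            alt' i ` ({1..r} - {i}) = \<mu> ` {1..r - 1} \<and> (\<forall>k\<in>{1..r} - insert j S. alt' i k = \<mu> k)"
    if i: "i \<in> S" for i
  proof -
    have t: "tight_matching ({1..r} - {i}) (alt i) u p" "alt i ` ({1..r} - {i}) = \<mu> ` {1..r - 1}"
      "\<And>k. k \<in> {1..r} - S \<Longrightarrow> alt i k = \<mu> k" using inv i unfolding search_inv_def by blast+
    have eq: "alt' i k = alt i k" if "k \<in> {1..r} - {i}" for k using old i that by blast
    have "alt' i ` ({1..r} - {i}) = alt i ` ({1..r} - {i})" using eq by (rule image_cong[OF refl])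
    moreover have "inj_on (alt' i) ({1..r} - {i}) = inj_on (alt i) ({1..r} - {i})" using eq by (rule inj_on_cong)
    ultimately show ?thesis using t old[OF i] eq unfolding tight_matching_def by auto
  qed
  show "search_inv r \<mu> (insert j S) alt' u p"
    unfolding search_inv_def
  proof (intro conjI ballI[of "insert j S"])
    show "r \<in> {1..n}" "optimal_pair (r - 1) \<mu> u p" "r \<in> insert j S" using r opt by blast+
    show "insert j S \<subseteq> {1..r}" using r jr by blast
    fix i assume "i \<in> insert j S"
    then show "tight_matching ({1..r} - {i}) (alt' i) u p" "alt' i ` ({1..r} - {i}) = \<mu> ` {1..r - 1}"
      "\<forall>k\<in>{1..r} - insert j S. alt' i k = \<mu> k" using rest tj im2 outj by blast+
  qed
qed

end

text \<open>A matching that uses an edge of original weight 0 has product at most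
  \<open>c ^ (2 * n) * (1 / c) ^ (n - 1) = c ^ (n + 1)\<close>, whereas \<open>c ^ n\<close> is a
  lower bound for those without such an edge. If a matching of finite weight exists, the maximal one
  is therefore finite too; otherwise all weights are minus infinity.\<close>

lemma max_weight_matching_if_prod_max:
  assumes \<mu>: "matching n m \<mu>" and c: "0 < c" "c < 1"
    and W: "\<And>i g. \<lbrakk>i \<in> {1..n}; g \<in> {1..m}; 0 < v i {g} + \<gamma> i\<rbrakk> \<Longrightarrow> c \<le> v i {g} + \<gamma> i \<and> v i {g} + \<gamma> i \<le> 1 / c"
    and w: "\<And>i g. \<lbrakk>i \<in> {1..n}; g \<in> {1..m}\<rbrakk> \<Longrightarrow> w i g = (if 0 < v i {g} + \<gamma> i then v i {g} + \<gamma> i else c ^ (2 * n))"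
    and max: "\<And>\<sigma>. matching n m \<sigma> \<Longrightarrow> (\<Prod>i\<in>{1..n}. w i (\<sigma> i)) \<le> (\<Prod>i\<in>{1..n}. w i (\<mu> i))"
  shows "max_weight_matching n m v \<gamma> \<mu>"
  unfolding max_weight_matching_def
proof (intro conjI allI impI)
  show "matching n m \<mu>" by fact
  fix \<sigma> assume \<sigma>: "matching n m \<sigma>"
  have \<mu>m: "\<mu> i \<in> {1..m}" and \<sigma>m: "\<sigma> i \<in> {1..m}" if "i \<in> {1..n}" for i
    using \<mu> \<sigma> that unfolding matching_def by blast+
  show "matching_weight n v \<gamma> \<sigma> \<le> matching_weight n v \<gamma> \<mu>"
  proof (cases "\<forall>i\<in>{1..n}. 0 < v i {\<sigma> i} + \<gamma> i")
    case False
    then obtain i where i: "i \<in> {1..n}" "\<not> 0 < v i {\<sigma> i} + \<gamma> i" by blast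
    then show ?thesis using matching_weight_eq_minus_infinity[of i n v \<sigma> \<gamma>] by simp
  next
    case True
    have w\<sigma>: "w i (\<sigma> i) = v i {\<sigma> i} + \<gamma> i" "c \<le> w i (\<sigma> i)" if "i \<in> {1..n}" for i
      using True W w that \<sigma>m by auto
    have "c ^ n = (\<Prod>i\<in>{1..n}. c)" by simp
    also have "\<dots> \<le> (\<Prod>i\<in>{1..n}. w i (\<sigma> i))" using w\<sigma> c by (intro prod_mono) auto
    also have "\<dots> \<le> (\<Prod>i\<in>{1..n}. w i (\<mu> i))" using max \<sigma> by blast
    finally have large: "c ^ n \<le> (\<Prod>i\<in>{1..n}. w i (\<mu> i))" .
    have w0: "0 < w i g" "w i g \<le> 1 / c" if "i \<in> {1..n}" "g \<in> {1..m}" for i g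
    proof -
      have "c ^ (2 * n) \<le> 1" using c by (intro power_le_one) auto
      also have "1 \<le> 1 / c" using c by simp
      finally have "c ^ (2 * n) \<le> 1 / c" .
      then show "0 < w i g" "w i g \<le> 1 / c" using w[OF that] W[OF that] c by auto
    qed
    have pos: "0 < v i {\<mu> i} + \<gamma> i" if i: "i \<in> {1..n}" for i
    proof (rule ccontr)
      assume "\<not> 0 < v i {\<mu> i} + \<gamma> i"
      then have wi: "w i (\<mu> i) = c ^ (2 * n)" using w i \<mu>m by simp
      have "(\<Prod>j\<in>{1..n}. w j (\<mu> j)) = c ^ (2 * n) * (\<Prod>j\<in>{1..n} - {i}. w j (\<mu> j))"
        using i wi by (simp add: prod.remove)
      also have "(\<Prod>j\<in>{1..n} - {i}. w j (\<mu> j)) \<le> (\<Prod>j\<in>{1..n} - {i}. 1 / c)"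
        using w0 \<mu>m by (intro prod_mono) (auto intro: less_imp_le)
      also have "(\<Prod>j\<in>{1..n} - {i}. 1 / c) = (1 / c) ^ (n - 1)" using i by simp
      finally have "(\<Prod>j\<in>{1..n}. w j (\<mu> j)) \<le> c ^ (2 * n) * (1 / c) ^ (n - 1)" using c by simp
      also have "\<dots> = c ^ (n + 1)"
      proof -
        have "2 * n = (n + 1) + (n - 1)" using i by auto
        then have "c ^ (2 * n) = c ^ (n + 1) * c ^ (n - 1)" by (metis power_add)
        then show ?thesis using c by (simp add: power_one_over)
      qed
      also have "\<dots> < c ^ n" using c by simp
      finally show False using large by linarith
    qed
    have ww: "(\<Sum>i\<in>{1..n}. ln (w i (\<sigma> i))) \<le> (\<Sum>i\<in>{1..n}. ln (w i (\<mu> i)))"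
    proof -
      have p: "0 < w i (\<sigma> i)" "0 < w i (\<mu> i)" if "i \<in> {1..n}" for i using w0 that \<sigma>m \<mu>m by blast+
      have "(\<Prod>i\<in>{1..n}. w i (\<sigma> i)) \<le> (\<Prod>i\<in>{1..n}. w i (\<mu> i))" using max \<sigma> by blast
      moreover have "0 < (\<Prod>i\<in>{1..n}. w i (\<sigma> i))" "0 < (\<Prod>i\<in>{1..n}. w i (\<mu> i))"
        using p by (intro prod_pos; blast)+
      ultimately have "ln (\<Prod>i\<in>{1..n}. w i (\<sigma> i)) \<le> ln (\<Prod>i\<in>{1..n}. w i (\<mu> i))" by simp
      then show ?thesis using p by (subst (asm) (1 2) ln_prod) (force intro: less_imp_neq[symmetric])+
    qed
    have "elog (v i {\<sigma> i} + \<gamma> i) = ereal (ln (w i (\<sigma> i)))"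
      "elog (v i {\<mu> i} + \<gamma> i) = ereal (ln (w i (\<mu> i)))" if "i \<in> {1..n}" for i
      using that True pos w \<sigma>m \<mu>m by (auto simp: elog_def)
    then have "matching_weight n v \<gamma> \<sigma> = ereal (\<Sum>i\<in>{1..n}. ln (w i (\<sigma> i)))"
      "matching_weight n v \<gamma> \<mu> = ereal (\<Sum>i\<in>{1..n}. ln (w i (\<mu> i)))"
      unfolding matching_weight_def by simp_all
    then show ?thesis using ww by simp
  qed
qed

section \<open>The program\<close>

abbreviation NV :: "string \<Rightarrow> nexp" where "NV x \<equiv> NVar x []"
abbreviation RV :: "string \<Rightarrow> rexp" where "RV x \<equiv> RVar x []"
abbreviation NZ :: "nexp \<Rightarrow> bexp" where "NZ a \<equiv> NLess (NConst 0) a"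
abbreviation SetV :: "string \<Rightarrow> nexp \<Rightarrow> prog" where "SetV x a \<equiv> SetN x [] a"
abbreviation When :: "bexp \<Rightarrow> prog \<Rightarrow> prog" where "When b p \<equiv> Test b p Nop"

section \<open>Singleton values and initial thresholds\<close>

definition "ask_singles =
  For ''g'' ''m'' (SetN ''unit'' [NV ''g'', NV ''g''] (NConst 1)) ;;
  For ''i'' ''n'' (For ''g'' ''m'' (Ask ''single'' [NV ''i'', NV ''g''] (NV ''i'') ''unit'' [NV ''g'']))"

definition "fill_rest = For ''g'' ''m'' (SetN ''rest'' [NV ''g''] (NConst 1))"

text \<open>Agents and goods are numbered from 1, so 0 stands for "none yet" here and in the later
  searches.\<close>

definition "find_best = SetV ''best'' (NConst 0) ;;
  For ''g'' ''m'' (When (BAnd (NZ (NVar ''rest'' [NV ''g'']))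
      (BOr (NEq (NV ''best'') (NConst 0))
        (RLess (RVar ''single'' [NV ''i'', NV ''best'']) (RVar ''single'' [NV ''i'', NV ''g'']))))
    (SetV ''best'' (NV ''g'')))"

text \<open>A loop limit has to be \<open>n\<close> or \<open>m\<close>, so the loop makes
  \<open>m\<close> passes and acts only in the first \<open>2 * n\<close>. The threshold depends on
  the set of the top goods alone, so their order is not recorded.\<close>

definition "drop_top =
  For ''k'' ''m'' (When (NLess (NV ''k'') (NAdd (NAdd (NV ''n'') (NV ''n'')) (NConst 1)))
    (find_best ;; SetN ''rest'' [NV ''best''] (NConst 0)))"

definition "init_agent = fill_rest ;; drop_top ;; Ask ''val'' [] (NV ''i'') ''rest'' [] ;;
  Test (RLess (RNat (NConst 0)) (RV ''val''))
    (fill_rest ;; Ask ''thr'' [NV ''i''] (NV ''i'') ''rest'' [])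
    (SetR ''thr'' [NV ''i''] (RNat (NConst 0)))"

definition "initialize = ask_singles ;; For ''i'' ''n'' init_agent ;; SetV ''flag'' (NConst 1)"

section \<open>The matching of a round\<close>

definition "set_weights = SetR ''low'' [] (RDiv (RNat (NConst 1)) (RNat (NConst 2))) ;;
  For ''i'' ''n'' (For ''g'' ''m''
    (SetR ''wt'' [NV ''i'', NV ''g''] (RAdd (RVar ''single'' [NV ''i'', NV ''g'']) (RVar ''thr'' [NV ''i''])) ;;
     When (RLess (RNat (NConst 0)) (RVar ''wt'' [NV ''i'', NV ''g'']))
      (When (RLess (RVar ''wt'' [NV ''i'', NV ''g'']) (RV ''low''))
         (SetR ''low'' [] (RVar ''wt'' [NV ''i'', NV ''g''])) ;;
       When (RLess (RDiv (RNat (NConst 1)) (RVar ''wt'' [NV ''i'', NV ''g''])) (RV ''low''))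
         (SetR ''low'' [] (RDiv (RNat (NConst 1)) (RVar ''wt'' [NV ''i'', NV ''g'']))))))"

text \<open>All positive weights lie between \<open>low\<close> and \<open>1 / low\<close> with \<open>low \<le> 1 / 2\<close>. Replacing weight zero by
  \<open>low ^ (2 * n)\<close> therefore keeps every matching with such an edge below every matching without.\<close>

definition "replace_zero_weights = SetR ''eps'' [] (RNat (NConst 1)) ;;
  For ''i'' ''n'' (SetR ''eps'' [] (RMul (RV ''eps'') (RMul (RV ''low'') (RV ''low'')))) ;;
  For ''i'' ''n'' (For ''g'' ''m'' (Test (RLess (RNat (NConst 0)) (RVar ''wt'' [NV ''i'', NV ''g'']))
    Nop (SetR ''wt'' [NV ''i'', NV ''g''] (RV ''eps''))))"

text \<open>All weights are at most \<open>1 / low\<close>, so these values are feasible with all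
  prices equal to 1, as required while nothing is matched.\<close>

definition "init_duals =
  For ''i'' ''n'' (SetR ''dual'' [NV ''i''] (RDiv (RNat (NConst 1)) (RV ''low''))) ;;
  For ''g'' ''m'' (SetR ''price'' [NV ''g''] (RNat (NConst 1)))"

definition "init_search =
  For ''i'' ''n'' (SetN ''reach'' [NV ''i''] (NConst 0)) ;;
  For ''g'' ''m'' (SetN ''tree'' [NV ''g''] (NConst 0)) ;;
  For ''i'' ''n'' (SetN ''alt'' [NV ''r'', NV ''i''] (NVar ''mate'' [NV ''i''])) ;;
  SetN ''reach'' [NV ''r''] (NConst 1) ;; SetV ''done'' (NConst 0)"

abbreviation "ratio_exp \<equiv>
  RDiv (RMul (RVar ''dual'' [NV ''i'']) (RVar ''price'' [NV ''g''])) (RVar ''wt'' [NV ''i'', NV ''g''])"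

definition "find_edge = SetV ''agent'' (NConst 0) ;;
  For ''i'' ''n'' (For ''g'' ''m''
    (When (BAnd (NZ (NVar ''reach'' [NV ''i''])) (BAnd (NEq (NVar ''tree'' [NV ''g'']) (NConst 0))
        (BOr (NEq (NV ''agent'') (NConst 0)) (RLess ratio_exp (RV ''ratio'')))))
      (SetV ''agent'' (NV ''i'') ;; SetV ''good'' (NV ''g'') ;; SetR ''ratio'' [] ratio_exp)))"

text \<open>The minimal ratio makes the edge just found tight, so there is no search for tight edges.\<close>

definition "relabel =
  For ''i'' ''n'' (When (NZ (NVar ''reach'' [NV ''i'']))
    (SetR ''dual'' [NV ''i''] (RDiv (RVar ''dual'' [NV ''i'']) (RV ''ratio'')))) ;;
  For ''g'' ''m'' (When (NZ (NVar ''tree'' [NV ''g'']))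
    (SetR ''price'' [NV ''g''] (RMul (RVar ''price'' [NV ''g'']) (RV ''ratio''))))"

text \<open>Entries of \<open>mate\<close> from \<open>r\<close> on are stale, hence the test
  \<open>i < r\<close>.\<close>

definition "find_mate = SetV ''own'' (NConst 0) ;;
  For ''i'' ''n'' (When (BAnd (NLess (NV ''i'') (NV ''r'')) (NEq (NVar ''mate'' [NV ''i'']) (NV ''good'')))
    (SetV ''own'' (NV ''i'')))"

definition "augment =
  For ''i'' ''n'' (SetN ''mate'' [NV ''i''] (NVar ''alt'' [NV ''agent'', NV ''i''])) ;;
  SetN ''mate'' [NV ''agent''] (NV ''good'') ;; SetV ''done'' (NConst 1)"

definition "extend_search =
  For ''i'' ''n'' (SetN ''alt'' [NV ''own'', NV ''i''] (NVar ''alt'' [NV ''agent'', NV ''i''])) ;;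
  SetN ''alt'' [NV ''own'', NV ''agent''] (NV ''good'') ;;
  SetN ''reach'' [NV ''own''] (NConst 1) ;; SetN ''tree'' [NV ''good''] (NConst 1)"

text \<open>A step either augments or reaches a new agent, so \<open>n\<close> steps suffice. The
  flag \<open>done\<close> makes the steps after the augmentation idle, since a counted loop cannot
  be left early.\<close>

definition "search_step = When (NEq (NV ''done'') (NConst 0))
  (find_edge ;; relabel ;; find_mate ;; Test (NEq (NV ''own'') (NConst 0)) augment extend_search)"

definition "find_matching = set_weights ;; replace_zero_weights ;; init_duals ;;
  For ''r'' ''n'' (init_search ;; For ''k'' ''n'' search_step)"

section \<open>The bundles and the thresholds of a round\<close>

definition "init_bundles =
  For ''g'' ''m'' (SetN ''goods'' [NV ''g''] (NConst 1)) ;;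
  For ''g'' ''m'' (SetN ''owner'' [NV ''g''] (NConst 0)) ;;
  For ''i'' ''n'' (SetN ''goods'' [NVar ''mate'' [NV ''i'']] (NConst 0)) ;;
  For ''i'' ''n'' (SetN ''act'' [NV ''i''] (NConst 1))"

abbreviation "share_exp \<equiv> RDiv (RNat (NConst 1)) (RMul (RNat (NConst 2)) (RNat (NV ''n'')))"

definition "try_single = Ask ''val'' [] (NV ''i'') ''goods'' [] ;;
  When (BAnd (NZ (NVar ''act'' [NV ''i''])) (BAnd (NZ (NVar ''goods'' [NV ''g'']))
      (BNot (RLess (RVar ''single'' [NV ''i'', NV ''g'']) (RMul share_exp (RV ''val''))))))
    (SetN ''owner'' [NV ''g''] (NV ''i'') ;; SetN ''act'' [NV ''i''] (NConst 0) ;;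
     SetN ''goods'' [NV ''g''] (NConst 0))"

text \<open>A pass over all pairs either serves an agent or shows that no step is possible, so
  \<open>n\<close> passes exhaust the loop.\<close>

definition "singles = init_bundles ;; For ''k'' ''n'' (For ''i'' ''n'' (For ''g'' ''m'' try_single))"

text \<open>The last write wins, which yields the largest active index. The result serves as the
  last-indexed agent and also as a test whether any agent is active.\<close>

definition "find_active x = SetV x (NConst 0) ;;
  For ''i'' ''n'' (When (NZ (NVar ''act'' [NV ''i''])) (SetV x (NV ''i'')))"

text \<open>\<open>full\<close> preserves the values of the goods at the call, to which all shares
  of the subroutine refer. If no agent is active, agent 1 takes the remaining goods, which is one of
  the choices that \<open>round_bundles\<close> leaves open.\<close>

definition "init_knife =
  For ''i'' ''n'' (Ask ''full'' [NV ''i''] (NV ''i'') ''goods'' []) ;;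
  For ''g'' ''m'' (SetN ''piece'' [NV ''g''] (NConst 0)) ;;
  For ''g'' ''m'' (SetN ''left'' [NV ''g''] (NVar ''goods'' [NV ''g''])) ;;
  find_active ''last'' ;; When (NEq (NV ''last'') (NConst 0)) (SetV ''last'' (NConst 1))"

definition "find_claim = SetV ''claim'' (NConst 0) ;;
  For ''i'' ''n'' (Ask ''val'' [] (NV ''i'') ''piece'' [] ;;
    When (BAnd (NZ (NVar ''act'' [NV ''i'']))
        (BNot (RLess (RV ''val'') (RMul share_exp (RVar ''full'' [NV ''i''])))))
      (SetV ''claim'' (NV ''i'')))"

text \<open>The counter is \<open>h\<close> because \<open>g\<close> counts the enclosing loop in
  \<open>knife\<close>.\<close>

definition "give_piece = SetN ''act'' [NV ''claim''] (NConst 0) ;;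
  For ''h'' ''m'' (When (NZ (NVar ''piece'' [NV ''h''])) (SetN ''owner'' [NV ''h''] (NV ''claim''))) ;;
  For ''h'' ''m'' (SetN ''piece'' [NV ''h''] (NConst 0))"

definition "cut_good = find_active ''own'' ;;
  When (BAnd (NZ (NVar ''left'' [NV ''g''])) (NZ (NV ''own'')))
    (SetN ''piece'' [NV ''g''] (NConst 1) ;; SetN ''left'' [NV ''g''] (NConst 0) ;;
     find_claim ;; When (NZ (NV ''claim'')) give_piece)"

definition "knife = init_knife ;; For ''g'' ''m'' cut_good ;;
  For ''g'' ''m'' (When (NZ (NVar ''left'' [NV ''g''])) (SetN ''owner'' [NV ''g''] (NV ''last'')))"

definition "update_agent =
  For ''g'' ''m'' (Test (NEq (NVar ''owner'' [NV ''g'']) (NV ''i''))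
    (SetN ''piece'' [NV ''g''] (NConst 1)) (SetN ''piece'' [NV ''g''] (NConst 0))) ;;
  Ask ''val'' [] (NV ''i'') ''piece'' [] ;;
  When (RLess (RV ''val'') (RVar ''thr'' [NV ''i'']))
    (SetR ''thr'' [NV ''i''] (RMul (RSub (RNat (NConst 1)) (RDiv (RNat (NConst 1)) (RNat (NV ''m''))))
        (RVar ''thr'' [NV ''i''])) ;;
     SetV ''flag'' (NConst 1))"

text \<open>Satisfaction is tested on the bundles without the matched goods, which therefore get
  their owners only afterwards.\<close>

definition "update_thresholds = SetV ''flag'' (NConst 0) ;; For ''i'' ''n'' update_agent ;;
  For ''i'' ''n'' (SetN ''owner'' [NVar ''mate'' [NV ''i'']] (NV ''i''))"

definition "alg_round = find_matching ;; singles ;; knife ;; update_thresholds"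

definition "give_all = For ''g'' ''m'' (SetN ''owner'' [NV ''g''] (NConst 1))"

definition "alg_com = Cond (NLess (NV ''m'') (NV ''n'')) (compile give_all)
  (Seq (compile initialize) (While (NZ (NV ''flag'')) (compile alg_round)))"

lemmas init_defs = ask_singles_def fill_rest_def find_best_def drop_top_def init_agent_def initialize_def
lemmas matching_defs = set_weights_def replace_zero_weights_def init_duals_def init_search_def find_edge_def
  relabel_def find_mate_def augment_def extend_search_def search_step_def find_matching_def
lemmas bundle_defs = init_bundles_def try_single_def singles_def find_active_def init_knife_def
  find_claim_def give_piece_def cut_good_def knife_def update_agent_def update_thresholds_def

lemma well_formed_programs: "well_formed give_all" "well_formed initialize" "well_formed alg_round"
  by (simp_all add: give_all_def alg_round_def init_defs matching_defs bundle_defs)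

lemma bounds_unmodified:
  "''n'' \<notin> nmods give_all" "''m'' \<notin> nmods give_all" "''n'' \<notin> nmods initialize" "''m'' \<notin> nmods initialize"
  "''n'' \<notin> nmods alg_round" "''m'' \<notin> nmods alg_round"
  by (simp_all add: give_all_def alg_round_def init_defs matching_defs bundle_defs)

section \<open>Correctness of the program\<close>

text \<open>The program finds the set of the top goods, while the algorithm speaks of a sorted list;
  this supplies a list with that set in front. The second alternative of \<open>k\<close> covers the
  case that there are fewer than \<open>k\<close> goods.\<close>

lemma sorted_list_with_top:
  fixes f :: "nat \<Rightarrow> real"
  assumes "finite X" "finite Y" "X \<inter> Y = {}" "\<And>x y. \<lbrakk>x \<in> X; y \<in> Y\<rbrakk> \<Longrightarrow> f y \<le> f x"
    and k: "card X = k \<or> (card X \<le> k \<and> Y = {})"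
  shows "\<exists>gs. distinct gs \<and> set gs = X \<union> Y \<and> sorted_wrt (\<lambda>g h. f g \<ge> f h) gs \<and> set (take k gs) = X"
proof -
  define srt where "srt = (\<lambda>A. sort_key (\<lambda>g. - f g) (sorted_list_of_set A))"
  have s: "set (srt A) = A" "distinct (srt A)" "length (srt A) = card A" "sorted_wrt (\<lambda>g h. f g \<ge> f h) (srt A)"
    if "finite A" for A
  proof -
    have "sorted (map (\<lambda>g. - f g) (srt A))" by (simp add: srt_def)
    then show "sorted_wrt (\<lambda>g h. f g \<ge> f h) (srt A)" by (simp add: sorted_map)
  qed (use that in \<open>simp_all add: srt_def\<close>)
  note X = s[OF assms(1)] and Y = s[OF assms(2)]
  have "take k (srt X @ srt Y) = srt X"
    using k
  proof
    assume "card X \<le> k \<and> Y = {}"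
    then have "srt Y = []" "length (srt X) \<le> k" using X(3) Y(1) by simp_all
    then show ?thesis by simp
  qed (simp add: X(3))
  then show ?thesis using assms(3,4) X(1,2,4) Y(1,2,4)
    by (intro exI[of _ "srt X @ srt Y"]) (simp add: sorted_wrt_append)
qed

context fair_instance
begin

abbreviation "R \<equiv> run m v"

section \<open>Correctness of the initialization\<close>

definition ready :: "mem \<Rightarrow> bool" where
  "ready \<sigma> \<longleftrightarrow> nmem \<sigma> ''n'' [] = n \<and> nmem \<sigma> ''m'' [] = m \<and>
     (\<forall>i\<in>{1..n}. \<forall>g\<in>{1..m}. rmem \<sigma> ''single'' [i, g] = v i {g})"

lemma readyD:
  assumes "ready \<sigma>"
  shows "nmem \<sigma> ''n'' [] = n" "nmem \<sigma> ''m'' [] = m"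
    "\<lbrakk>i \<in> {1..n}; g \<in> {1..m}\<rbrakk> \<Longrightarrow> rmem \<sigma> ''single'' [i, g] = v i {g}"
  using assms by (simp_all add: ready_def)

lemma ready_frame:
  assumes "ready \<sigma>" "frame p \<sigma> \<tau>" "''n'' \<notin> nmods p" "''m'' \<notin> nmods p" "''single'' \<notin> rmods p"
  shows "ready \<tau>"
  using assms frameD[OF assms(2)] by (simp add: ready_def)

lemma ready_run:
  assumes "ready \<sigma>" "''n'' \<notin> nmods p" "''m'' \<notin> nmods p" "''single'' \<notin> rmods p"
  shows "ready (R p \<sigma>)"
  using ready_frame[OF assms(1) frame_run assms(2-4)] .

text \<open>An oracle query takes a row of an array. Row \<open>g\<close> of \<open>unit\<close> is
  the characteristic vector of \<open>{g}\<close>, which needs the array to be 0 elsewhere.\<close>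

lemma run_ask_singles:
  assumes "nmem \<sigma> ''n'' [] = n" "nmem \<sigma> ''m'' [] = m" "\<And>ks. nmem \<sigma> ''unit'' ks = 0"
  shows "ready (R ask_singles \<sigma>)"
proof -
  let ?unit = "For ''g'' ''m'' (SetN ''unit'' [NV ''g'', NV ''g''] (NConst 1))"
  let ?ask = "For ''g'' ''m'' (Ask ''single'' [NV ''i'', NV ''g''] (NV ''i'') ''unit'' [NV ''g''])"
  define \<sigma>1 where "\<sigma>1 = R ?unit \<sigma>"
  have nm: "nmem \<sigma>1 ''n'' [] = n" "nmem \<sigma>1 ''m'' [] = m" using assms by (simp_all add: \<sigma>1_def run_frame del: run.simps)
  let ?U = "\<lambda>k (\<tau>::mem). \<forall>g h. nmem \<tau> ''unit'' [g, h] = (if g = h \<and> g \<in> {1..k} then 1 else 0)"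
  have U: "?U m \<sigma>1"
    unfolding \<sigma>1_def
  proof (rule For_induct[where I = ?U])
    fix k \<tau> assume "?U k \<tau>" "nmem \<tau> ''g'' [] = Suc k"
    then show "?U (Suc k) (R (SetN ''unit'' [NV ''g'', NV ''g''] (NConst 1)) \<tau>)" by (auto simp: le_Suc_eq)
  qed (use assms in simp_all)
  let ?I = "\<lambda>k (\<tau>::mem). \<forall>i\<in>{1..k}. \<forall>g\<in>{1..m}. rmem \<tau> ''single'' [i, g] = v i {g}"
  have "?I n (R (For ''i'' ''n'' ?ask) \<sigma>1)"
  proof (rule For_induct[where I = ?I])
    fix k \<tau> assume I: "?I k \<tau>" and k: "k < n" "nmem \<tau> ''i'' [] = Suc k"
      and fr: "frame (For ''i'' ''n'' ?ask) \<sigma>1 \<tau>"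
    have t: "nmem \<tau> ''m'' [] = m" "nmem \<tau> ''unit'' = nmem \<sigma>1 ''unit''"
      using frameD[OF fr] nm by simp_all
    have s: "rmem (R ?ask \<tau>) ''single'' = (\<lambda>ks. if \<exists>g\<in>{1..m}. ks = [Suc k] @ [g] then v (Suc k) {last ks} else rmem \<tau> ''single'' ks)"
    proof (rule For_rset)
      fix g \<tau>' assume g: "g \<in> {1..m}" "nmem \<tau>' ''g'' [] = g" and fr': "frame ?ask \<tau> \<tau>'"
      have t': "nmem \<tau>' ''unit'' = nmem \<sigma>1 ''unit''" "nmem \<tau>' ''i'' [] = Suc k"
        using frameD[OF fr'] t k by simp_all
      have "row_set m \<tau>' ''unit'' [g] = {g}"
        unfolding row_set_def t' using U g(1) by auto
      then show "rmem (R (Ask ''single'' [NV ''i'', NV ''g''] (NV ''i'') ''unit'' [NV ''g'']) \<tau>') ''single''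
          = (rmem \<tau>' ''single'')([Suc k] @ [g] := v (Suc k) {g})"
        using g t' by simp
    qed (use t in simp_all)
    show "?I (Suc k) (R ?ask \<tau>)" unfolding s using I by (auto simp: le_Suc_eq)
  qed (use nm in simp_all)
  moreover have "nmem (R (For ''i'' ''n'' ?ask) \<sigma>1) ''n'' [] = n" "nmem (R (For ''i'' ''n'' ?ask) \<sigma>1) ''m'' [] = m"
    using nm by (simp_all add: run_frame del: run.simps)
  ultimately show ?thesis by (simp add: ask_singles_def ready_def \<sigma>1_def del: run.simps(7))
qed

lemma run_fill_rest:
  assumes "ready \<sigma>"
  shows "row_set m (R fill_rest \<sigma>) ''rest'' [] = {1..m}"
proof -
  have "nmem (R fill_rest \<sigma>) ''rest'' = (\<lambda>ks. if \<exists>g\<in>{1..m}. ks = [] @ [g] then 1 else nmem \<sigma> ''rest'' ks)"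
    unfolding fill_rest_def by (rule For_nset) (use readyD[OF assms] in simp_all)
  then show ?thesis by (auto simp: row_set_def)
qed

lemma run_find_best:
  assumes rd: "ready \<sigma>" and i: "nmem \<sigma> ''i'' [] = i" "i \<in> {1..n}"
    and ne: "row_set m \<sigma> ''rest'' [] \<noteq> {}" (is "?X \<noteq> {}")
  shows "nmem (R find_best \<sigma>) ''best'' [] \<in> ?X"
    "g \<in> ?X \<Longrightarrow> v i {g} \<le> v i {nmem (R find_best \<sigma>) ''best'' []}"
proof -
  let ?p = "When (BAnd (NZ (NVar ''rest'' [NV ''g'']))
      (BOr (NEq (NV ''best'') (NConst 0))
        (RLess (RVar ''single'' [NV ''i'', NV ''best'']) (RVar ''single'' [NV ''i'', NV ''g'']))))
    (SetV ''best'' (NV ''g''))"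
  define \<sigma>1 where "\<sigma>1 = R (SetV ''best'' (NConst 0)) \<sigma>"
  have rd1: "ready \<sigma>1" unfolding \<sigma>1_def using rd by (rule ready_run) simp_all
  have s1: "nmem \<sigma>1 ''rest'' = nmem \<sigma> ''rest''" "nmem \<sigma>1 ''i'' [] = i" using i by (simp_all add: \<sigma>1_def)
  let ?I = "\<lambda>k (\<tau>::mem). let b = nmem \<tau> ''best'' [] in (b = 0 \<and> ?X \<inter> {1..k} = {}) \<or>
     (b \<in> ?X \<and> (\<forall>g\<in>?X \<inter> {1..k}. v i {g} \<le> v i {b}))"
  have "?I m (R (For ''g'' ''m'' ?p) \<sigma>1)"
  proof (rule For_induct[where I = ?I])
    fix k \<tau> assume I: "?I k \<tau>" and k: "k < m" "nmem \<tau> ''g'' [] = Suc k"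
      and fr: "frame (For ''g'' ''m'' ?p) \<sigma>1 \<tau>"
    have rdt: "ready \<tau>" using rd1 fr by (rule ready_frame) simp_all
    have t: "nmem \<tau> ''rest'' = nmem \<sigma> ''rest''" "nmem \<tau> ''i'' [] = i"
      using frameD[OF fr] s1 by simp_all
    have X: "nmem \<tau> ''rest'' [Suc k] \<noteq> 0 \<longleftrightarrow> Suc k \<in> ?X" unfolding t using k by (simp add: row_set_def)
    have Xm: "?X \<subseteq> {1..m}" by (auto simp: row_set_def)
    have sg: "g \<in> ?X \<Longrightarrow> rmem \<tau> ''single'' [i, g] = v i {g}" for g
      using readyD(3)[OF rdt i(2)] Xm by blast
    have ins: "{1..Suc k} = insert (Suc k) {1..k}" by auto
    show "?I (Suc k) (R ?p \<tau>)"
    proof (cases "Suc k \<in> ?X")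
      case False
      then have "nmem \<tau> ''rest'' [Suc k] = 0" using X by simp
      then have "R ?p \<tau> = \<tau>" using k by simp
      then show ?thesis using I False unfolding ins by (simp add: Let_def)
    next
      case True
      then have rk: "nmem \<tau> ''rest'' [Suc k] \<noteq> 0" using X by simp
      show ?thesis
      proof (cases "nmem \<tau> ''best'' [] = 0 \<or> rmem \<tau> ''single'' [i, nmem \<tau> ''best'' []] < rmem \<tau> ''single'' [i, Suc k]")
        case c: True
        then have e: "nmem (R ?p \<tau>) ''best'' [] = Suc k" using rk k t by auto
        have "v i {g} \<le> v i {Suc k}" if g: "g \<in> ?X \<inter> {1..Suc k}" for g
        proof (cases "g = Suc k")
          case False
          then have g': "g \<in> ?X \<inter> {1..k}" using g by auto
          then have b: "nmem \<tau> ''best'' [] \<in> ?X" "v i {g} \<le> v i {nmem \<tau> ''best'' []}"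
            using I unfolding Let_def by blast+
          have "nmem \<tau> ''best'' [] \<noteq> 0" using b(1) by (auto simp: row_set_def)
          then show ?thesis using c b sg[OF b(1)] sg[OF True] by simp
        qed simp
        then show ?thesis using True unfolding Let_def e by blast
      next
        case c: False
        then have e: "R ?p \<tau> = \<tau>" using k t by simp
        have b: "nmem \<tau> ''best'' [] \<in> ?X" using I c unfolding Let_def by blast
        then show ?thesis using I c True sg[OF b] sg[OF True] unfolding e ins by (auto simp: Let_def)
      qed
    qed
  qed (use readyD[OF rd1] in \<open>simp_all add: \<sigma>1_def Let_def\<close>)
  moreover have "?X \<inter> {1..m} = ?X" by (auto simp: row_set_def)
  moreover have "R (For ''g'' ''m'' ?p) \<sigma>1 = R find_best \<sigma>" by (simp add: find_best_def \<sigma>1_def)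
  ultimately have "nmem (R find_best \<sigma>) ''best'' [] \<in> ?X \<and> (\<forall>g\<in>?X. v i {g} \<le> v i {nmem (R find_best \<sigma>) ''best'' []})"
    using ne by (simp add: Let_def)
  then show "nmem (R find_best \<sigma>) ''best'' [] \<in> ?X"
    "g \<in> ?X \<Longrightarrow> v i {g} \<le> v i {nmem (R find_best \<sigma>) ''best'' []}" by blast+
qed

text \<open>Each pass removes a best good of the rest, so all removed goods stay at least as
  valuable as all remaining ones.\<close>

lemma run_drop_top:
  assumes rd: "ready \<sigma>" and i: "nmem \<sigma> ''i'' [] = i" "i \<in> {1..n}"
    and full: "row_set m \<sigma> ''rest'' [] = {1..m}"
  defines "Y \<equiv> row_set m (R drop_top \<sigma>) ''rest'' []"
  shows "card ({1..m} - Y) = min m (2 * n)"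
    "\<lbrakk>x \<in> {1..m} - Y; y \<in> Y\<rbrakk> \<Longrightarrow> v i {y} \<le> v i {x}"
proof -
  let ?q = "find_best ;; SetN ''rest'' [NV ''best''] (NConst 0)"
  let ?p = "When (NLess (NV ''k'') (NAdd (NAdd (NV ''n'') (NV ''n'')) (NConst 1))) ?q"
  let ?Y = "\<lambda>\<tau>::mem. row_set m \<tau> ''rest'' []"
  let ?I = "\<lambda>k (\<tau>::mem). card ({1..m} - ?Y \<tau>) = min k (2 * n) \<and> (\<forall>x\<in>{1..m} - ?Y \<tau>. \<forall>y\<in>?Y \<tau>. v i {y} \<le> v i {x})"
  have "?I m (R (For ''k'' ''m'' ?p) \<sigma>)"
  proof (rule For_induct[where I = ?I])
    fix k \<tau> assume I: "?I k \<tau>" and k: "k < m" "nmem \<tau> ''k'' [] = Suc k"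
      and fr: "frame (For ''k'' ''m'' ?p) \<sigma> \<tau>"
    have rdt: "ready \<tau>" using rd fr by (rule ready_frame) (simp_all add: init_defs)
    have t: "nmem \<tau> ''i'' [] = i" using frameD[OF fr] i by (simp add: init_defs)
    show "?I (Suc k) (R ?p \<tau>)"
    proof (cases "k < 2 * n")
      case False
      then have "R ?p \<tau> = \<tau>" using k readyD[OF rdt] by simp
      then show ?thesis using I False by simp
    next
      case True
      then have Rp: "R ?p \<tau> = R ?q \<tau>" using k readyD[OF rdt] by (simp del: run.simps(5))
      define b where "b = nmem (R find_best \<tau>) ''best'' []"
      have "card ({1..m} - ?Y \<tau>) < card {1..m}" using I k by simp
      then have ne: "?Y \<tau> \<noteq> {}" by (metis Diff_empty less_irrefl)
      have b: "b \<in> ?Y \<tau>" "\<And>g. g \<in> ?Y \<tau> \<Longrightarrow> v i {g} \<le> v i {b}"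
        unfolding b_def using run_find_best[OF rdt t i(2) ne] by blast+
      have rest: "nmem (R find_best \<tau>) ''rest'' = nmem \<tau> ''rest''" by (simp add: run_frame init_defs del: run.simps)
      have Y: "?Y (R ?q \<tau>) = ?Y \<tau> - {b}"
        unfolding row_set_def by (auto simp: b_def[symmetric] rest)
      have bm: "b \<in> {1..m}" using b(1) by (simp add: row_set_def)
      have D: "{1..m} - (?Y \<tau> - {b}) = insert b ({1..m} - ?Y \<tau>)" using bm by blast
      have "card ({1..m} - ?Y (R ?q \<tau>)) = Suc k" unfolding Y D using I b(1) True by simp
      moreover have "v i {y} \<le> v i {x}" if "x \<in> {1..m} - ?Y (R ?q \<tau>)" "y \<in> ?Y (R ?q \<tau>)" for x y
        using that I b unfolding Y D by auto
      ultimately show ?thesis unfolding Rp using True by simp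
    qed
  qed (use readyD[OF rd] full in \<open>simp_all add: init_defs row_set_def\<close>)
  then show "card ({1..m} - Y) = min m (2 * n)" 
    "\<lbrakk>x \<in> {1..m} - Y; y \<in> Y\<rbrakk> \<Longrightarrow> v i {y} \<le> v i {x}"
    unfolding Y_def drop_top_def by blast+
qed

definition initial_threshold :: "nat \<Rightarrow> real \<Rightarrow> bool" where
  "initial_threshold i c \<longleftrightarrow> (\<exists>gs. distinct gs \<and> set gs = {1..m} \<and>
     sorted_wrt (\<lambda>g h. v i {g} \<ge> v i {h}) gs \<and>
     c = (if v i ({1..m} - set (take (2 * n) gs)) = 0 then 0 else v i {1..m}))"

lemma run_init_agent:
  assumes rd: "ready \<sigma>" and i: "nmem \<sigma> ''i'' [] = i" "i \<in> {1..n}"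
  shows "\<exists>c. initial_threshold i c \<and> rmem (R init_agent \<sigma>) ''thr'' = (rmem \<sigma> ''thr'')([i] := c)"
proof -
  define \<sigma>1 where "\<sigma>1 = R fill_rest \<sigma>"
  define \<sigma>2 where "\<sigma>2 = R drop_top \<sigma>1"
  define \<sigma>3 where "\<sigma>3 = R (Ask ''val'' [] (NV ''i'') ''rest'' []) \<sigma>2"
  define Y where "Y = row_set m \<sigma>2 ''rest'' []"
  have rd1: "ready \<sigma>1" unfolding \<sigma>1_def using rd by (rule ready_run) (simp_all add: init_defs)
  have rd2: "ready \<sigma>2" unfolding \<sigma>2_def using rd1 by (rule ready_run) (simp_all add: init_defs)
  have rd3: "ready \<sigma>3" unfolding \<sigma>3_def using rd2 by (rule ready_run) simp_all
  have i1: "nmem \<sigma>1 ''i'' [] = i" unfolding \<sigma>1_def using i by (simp add: run_frame init_defs del: run.simps)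
  have i2: "nmem \<sigma>2 ''i'' [] = i" unfolding \<sigma>2_def using i1 by (simp add: run_frame init_defs del: run.simps)
  have thr3: "rmem \<sigma>3 ''thr'' = rmem \<sigma> ''thr''"
    unfolding \<sigma>1_def \<sigma>2_def \<sigma>3_def by (simp add: run_frame init_defs del: run.simps)
  have val: "rmem \<sigma>3 ''val'' [] = v i Y" "nmem \<sigma>3 ''i'' [] = i" by (simp_all add: \<sigma>3_def Y_def i2)
  have Ym: "Y \<subseteq> {1..m}" by (auto simp: Y_def row_set_def)
  note top = run_drop_top[OF rd1 i1 i(2) run_fill_rest[OF rd, folded \<sigma>1_def], folded \<sigma>2_def, folded Y_def]
  \<comment> \<open>For \<open>m < 2 * n\<close> all goods are removed and the second alternative
    holds.\<close>
  have k: "card ({1..m} - Y) = 2 * n \<or> (card ({1..m} - Y) \<le> 2 * n \<and> Y = {})"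
  proof (cases "2 * n \<le> m")
    case False
    then have "card ({1..m} - Y) = card {1..m}" using top(1) by simp
    then have "{1..m} - Y = {1..m}" by (intro card_subset_eq) auto
    then show ?thesis using Ym False top(1) by auto
  qed (use top(1) in simp)
  have "\<exists>gs. distinct gs \<and> set gs = ({1..m} - Y) \<union> Y \<and> sorted_wrt (\<lambda>g h. v i {g} \<ge> v i {h}) gs \<and>
      set (take (2 * n) gs) = {1..m} - Y"
    by (rule sorted_list_with_top) (use top(2) k finite_subset[OF Ym] in auto)
  moreover have "({1..m} - Y) \<union> Y = {1..m}" "{1..m} - ({1..m} - Y) = Y" using Ym by auto
  ultimately have init: "initial_threshold i (if v i Y = 0 then 0 else v i {1..m})"
    unfolding initial_threshold_def by metis
  have R: "R init_agent \<sigma> = (if 0 < v i Y then R (fill_rest ;; Ask ''thr'' [NV ''i''] (NV ''i'') ''rest'' []) \<sigma>3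
      else R (SetR ''thr'' [NV ''i''] (RNat (NConst 0))) \<sigma>3)"
    unfolding init_agent_def using val by (simp add: \<sigma>1_def[symmetric] \<sigma>2_def[symmetric] \<sigma>3_def[symmetric] 
        del: run.simps(2-4))
  show ?thesis
  proof (cases "0 < v i Y")
    case False
    then have "v i Y = 0" using val_nonneg[OF i(2) Ym] by simp
    then show ?thesis using init R val thr3 by (intro exI[of _ 0]) simp
  next
    case True
    have "nmem (R fill_rest \<sigma>3) ''i'' [] = i" "rmem (R fill_rest \<sigma>3) ''thr'' = rmem \<sigma> ''thr''"
      using val thr3 by (simp_all add: run_frame init_defs del: run.simps)
    then have "rmem (R init_agent \<sigma>) ''thr'' = (rmem \<sigma> ''thr'')([i] := v i {1..m})"
      using R True run_fill_rest[OF rd3] by simp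
    then show ?thesis using init True by auto
  qed
qed

lemma run_initialize:
  assumes "nmem \<sigma> ''n'' [] = n" "nmem \<sigma> ''m'' [] = m" "\<And>ks. nmem \<sigma> ''unit'' ks = 0"
  shows "ready (R initialize \<sigma>)" "nmem (R initialize \<sigma>) ''flag'' [] = 1"
    "i \<in> {1..n} \<Longrightarrow> initial_threshold i (rmem (R initialize \<sigma>) ''thr'' [i])"
proof -
  define \<sigma>1 where "\<sigma>1 = R ask_singles \<sigma>"
  have rd1: "ready \<sigma>1" unfolding \<sigma>1_def by (rule run_ask_singles[OF assms])
  define \<sigma>2 where "\<sigma>2 = R (For ''i'' ''n'' init_agent) \<sigma>1"
  have rd2: "ready \<sigma>2" unfolding \<sigma>2_def using rd1 by (rule ready_run) (simp_all add: init_defs)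
  have R: "R initialize \<sigma> = R (SetV ''flag'' (NConst 1)) \<sigma>2"
    by (simp add: initialize_def \<sigma>1_def \<sigma>2_def)
  show "ready (R initialize \<sigma>)" unfolding R using rd2 by (rule ready_run) simp_all
  show "nmem (R initialize \<sigma>) ''flag'' [] = 1" unfolding R by simp
  let ?I = "\<lambda>k (\<tau>::mem). \<forall>i\<in>{1..k}. initial_threshold i (rmem \<tau> ''thr'' [i])"
  have "?I n \<sigma>2"
    unfolding \<sigma>2_def
  proof (rule For_induct[where I = ?I])
    fix k \<tau> assume I: "?I k \<tau>" and k: "k < n" "nmem \<tau> ''i'' [] = Suc k"
      and fr: "frame (For ''i'' ''n'' init_agent) \<sigma>1 \<tau>"
    have rdt: "ready \<tau>" using rd1 fr by (rule ready_frame) (simp_all add: init_defs)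
    obtain c where c: "initial_threshold (Suc k) c" "rmem (R init_agent \<tau>) ''thr'' = (rmem \<tau> ''thr'')([Suc k] := c)"
      using run_init_agent[OF rdt k(2)] k(1) by auto
    show "?I (Suc k) (R init_agent \<tau>)"
    proof
      fix i assume "i \<in> {1..Suc k}"
      then show "initial_threshold i (rmem (R init_agent \<tau>) ''thr'' [i])"
        using c I by (cases "i = Suc k") auto
    qed
  qed (use readyD[OF rd1] in \<open>simp_all add: init_defs\<close>)
  then show "i \<in> {1..n} \<Longrightarrow> initial_threshold i (rmem (R initialize \<sigma>) ''thr'' [i])"
    unfolding R by simp
qed

section \<open>Correctness of the weights\<close>

definition weight :: "mem \<Rightarrow> nat \<Rightarrow> nat \<Rightarrow> real" where
  "weight \<sigma> i g = rmem \<sigma> ''wt'' [i, g]"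

definition gamma :: "mem \<Rightarrow> nat \<Rightarrow> real" where
  "gamma \<sigma> i = rmem \<sigma> ''thr'' [i]"

text \<open>\<open>low\<close> is lowered to every positive weight and to its reciprocal, which
  gives both bounds. Its initial value 1/2 keeps it strictly below 1 even if no weight is
  positive.\<close>

lemma run_set_weights:
  assumes rd: "ready \<sigma>"
  defines "c \<equiv> rmem (R set_weights \<sigma>) ''low'' []"
  shows "0 < c" "c \<le> 1 / 2"
    "\<lbrakk>i \<in> {1..n}; g \<in> {1..m}\<rbrakk> \<Longrightarrow> weight (R set_weights \<sigma>) i g = v i {g} + gamma \<sigma> i"
    "\<lbrakk>i \<in> {1..n}; g \<in> {1..m}; 0 < v i {g} + gamma \<sigma> i\<rbrakk> \<Longrightarrow> c \<le> v i {g} + gamma \<sigma> i \<and> v i {g} + gamma \<sigma> i \<le> 1 / c"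
proof -
  let ?w = "\<lambda>i g. v i {g} + gamma \<sigma> i"
  let ?low = "\<lambda>\<tau>::mem. rmem \<tau> ''low'' []"
  define good where "good = (\<lambda>\<tau>::mem. \<lambda>i g. weight \<tau> i g = ?w i g \<and> (0 < ?w i g \<longrightarrow> ?low \<tau> \<le> ?w i g \<and> ?low \<tau> \<le> 1 / ?w i g))"
  define \<sigma>1 where "\<sigma>1 = R (SetR ''low'' [] (RDiv (RNat (NConst 1)) (RNat (NConst 2)))) \<sigma>"
  let ?p = "SetR ''wt'' [NV ''i'', NV ''g''] (RAdd (RVar ''single'' [NV ''i'', NV ''g'']) (RVar ''thr'' [NV ''i''])) ;;
     When (RLess (RNat (NConst 0)) (RVar ''wt'' [NV ''i'', NV ''g'']))
      (When (RLess (RVar ''wt'' [NV ''i'', NV ''g'']) (RV ''low''))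
         (SetR ''low'' [] (RVar ''wt'' [NV ''i'', NV ''g''])) ;;
       When (RLess (RDiv (RNat (NConst 1)) (RVar ''wt'' [NV ''i'', NV ''g''])) (RV ''low''))
         (SetR ''low'' [] (RDiv (RNat (NConst 1)) (RVar ''wt'' [NV ''i'', NV ''g'']))))"
  let ?inner = "For ''g'' ''m'' ?p"
  have rd1: "ready \<sigma>1" unfolding \<sigma>1_def using rd by (rule ready_run) simp_all
  have thr1: "rmem \<sigma>1 ''thr'' = rmem \<sigma> ''thr''" by (simp add: \<sigma>1_def)
  let ?L = "\<lambda>\<tau>::mem. 0 < ?low \<tau> \<and> ?low \<tau> \<le> 1 / 2"
  let ?I = "\<lambda>k (\<tau>::mem). ?L \<tau> \<and> (\<forall>i\<in>{1..k}. \<forall>g\<in>{1..m}. good \<tau> i g)"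
  have "?I n (R (For ''i'' ''n'' ?inner) \<sigma>1)"
  proof (rule For_induct[where I = ?I])
    fix k \<tau> assume I: "?I k \<tau>" and k: "k < n" "nmem \<tau> ''i'' [] = Suc k"
      and fr: "frame (For ''i'' ''n'' ?inner) \<sigma>1 \<tau>"
    have rdt: "ready \<tau>" using rd1 fr by (rule ready_frame) simp_all
    have thrt: "rmem \<tau> ''thr'' = rmem \<sigma> ''thr''" using frameD[OF fr] thr1 by simp
    let ?J = "\<lambda>j (\<tau>'::mem). ?I k \<tau>' \<and> (\<forall>g\<in>{1..j}. good \<tau>' (Suc k) g)"
    have "?J m (R ?inner \<tau>)"
    proof (rule For_induct[where I = ?J])
      fix j \<tau>' assume J: "?J j \<tau>'" and j: "j < m" "nmem \<tau>' ''g'' [] = Suc j" and fr': "frame ?inner \<tau> \<tau>'"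
      have rdt': "ready \<tau>'" using rdt fr' by (rule ready_frame) simp_all
      have t': "rmem \<tau>' ''thr'' = rmem \<sigma> ''thr''" "nmem \<tau>' ''i'' [] = Suc k"
        using frameD[OF fr'] thrt k by simp_all
      let ?W = "?w (Suc k) (Suc j)"
      have W: "rmem \<tau>' ''single'' [Suc k, Suc j] + rmem \<tau>' ''thr'' [Suc k] = ?W"
        using readyD(3)[OF rdt', of "Suc k" "Suc j"] k j by (simp add: t' gamma_def)
      have wt: "rmem (R ?p \<tau>') ''wt'' = (rmem \<tau>' ''wt'')([Suc k, Suc j] := ?W)"
        using W t' j by simp
      have low: "?low (R ?p \<tau>') = (if 0 < ?W then min (min (?low \<tau>') ?W) (1 / ?W) else ?low \<tau>')"
        using W t' j by (simp add: min_def)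
      have le: "?low (R ?p \<tau>') \<le> ?low \<tau>'" unfolding low by (simp add: min_le_iff_disj)
      have "0 < ?low (R ?p \<tau>')" unfolding low using J by simp
      then have L: "?L (R ?p \<tau>')" using le J by linarith
      have new: "good (R ?p \<tau>') (Suc k) (Suc j)" unfolding good_def low weight_def wt by (simp add: min_le_iff_disj)
      have old: "good (R ?p \<tau>') i g" if "good \<tau>' i g" for i g
      proof (cases "[i, g] = [Suc k, Suc j]")
        case True
        then show ?thesis using new by simp
      next
        case False
        then have "weight (R ?p \<tau>') i g = weight \<tau>' i g" unfolding weight_def wt by auto
        then show ?thesis using that le unfolding good_def by (auto intro: order_trans)
      qed
      have "{1..Suc j} = insert (Suc j) {1..j}" by auto
      then show "?J (Suc j) (R ?p \<tau>')" using L new old J by auto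
    qed (use I readyD[OF rdt] in \<open>simp_all add: good_def weight_def\<close>)
    moreover have "{1..Suc k} = insert (Suc k) {1..k}" by auto
    ultimately show "?I (Suc k) (R ?inner \<tau>)" by simp
  qed (use readyD[OF rd1] in \<open>simp_all add: good_def weight_def \<sigma>1_def\<close>)
  moreover have "R (For ''i'' ''n'' ?inner) \<sigma>1 = R set_weights \<sigma>" by (simp add: set_weights_def \<sigma>1_def)
  ultimately have fin: "0 < c" "c \<le> 1 / 2" "\<forall>i\<in>{1..n}. \<forall>g\<in>{1..m}. good (R set_weights \<sigma>) i g"
    unfolding c_def by simp_all
  show "0 < c" "c \<le> 1 / 2" by (fact fin)+
  show "weight (R set_weights \<sigma>) i g = ?w i g" if "i \<in> {1..n}" "g \<in> {1..m}"
    using fin(3) that unfolding good_def by blast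
  show "c \<le> ?w i g \<and> ?w i g \<le> 1 / c" if "i \<in> {1..n}" "g \<in> {1..m}" "0 < ?w i g"
  proof -
    have "c \<le> ?w i g" "c \<le> 1 / ?w i g" using fin(3) that unfolding good_def c_def by blast+
    then show ?thesis using fin(1) that(3) by (simp add: field_simps)
  qed
qed

lemma run_replace_zero_weights:
  assumes rd: "ready \<sigma>" and i: "i \<in> {1..n}" and g: "g \<in> {1..m}"
  shows "weight (R replace_zero_weights \<sigma>) i g =
    (if 0 < weight \<sigma> i g then weight \<sigma> i g else rmem \<sigma> ''low'' [] ^ (2 * n))"
proof -
  let ?low = "rmem \<sigma> ''low'' []"
  define \<sigma>1 where "\<sigma>1 = R (SetR ''eps'' [] (RNat (NConst 1))) \<sigma>"
  let ?e = "SetR ''eps'' [] (RMul (RV ''eps'') (RMul (RV ''low'') (RV ''low'')))"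
  define \<sigma>2 where "\<sigma>2 = R (For ''i'' ''n'' ?e) \<sigma>1"
  have rd1: "ready \<sigma>1" unfolding \<sigma>1_def using rd by (rule ready_run) simp_all
  have rd2: "ready \<sigma>2" unfolding \<sigma>2_def using rd1 by (rule ready_run) simp_all
  let ?E = "\<lambda>k (\<tau>::mem). rmem \<tau> ''eps'' [] = ?low ^ (2 * k)"
  have E: "?E n \<sigma>2"
    unfolding \<sigma>2_def
  proof (rule For_induct[where I = ?E])
    fix k \<tau> assume "?E k \<tau>" "frame (For ''i'' ''n'' ?e) \<sigma>1 \<tau>"
    then show "?E (Suc k) (R ?e \<tau>)" using frameD[of _ \<sigma>1 \<tau>] by (simp add: \<sigma>1_def power2_eq_square)
  qed (use readyD[OF rd1] in \<open>simp_all add: \<sigma>1_def\<close>)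
  have wt2: "rmem \<sigma>2 ''wt'' = rmem \<sigma> ''wt''" by (simp add: \<sigma>2_def \<sigma>1_def run_frame del: run.simps)
  let ?p = "Test (RLess (RNat (NConst 0)) (RVar ''wt'' [NV ''i'', NV ''g''])) Nop
     (SetR ''wt'' [NV ''i'', NV ''g''] (RV ''eps''))"
  let ?inner = "For ''g'' ''m'' ?p"
  let ?f = "\<lambda>ks. if 0 < rmem \<sigma> ''wt'' ks then rmem \<sigma> ''wt'' ks else ?low ^ (2 * n)"
  let ?I = "\<lambda>k (\<tau>::mem). rmem \<tau> ''wt'' = (\<lambda>ks. if \<exists>i\<in>{1..k}. \<exists>g\<in>{1..m}. ks = [i, g] then ?f ks else rmem \<sigma> ''wt'' ks)"
  have "?I n (R (For ''i'' ''n'' ?inner) \<sigma>2)"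
  proof (rule For_induct[where I = ?I])
    fix k \<tau> assume I: "?I k \<tau>" and k: "k < n" "nmem \<tau> ''i'' [] = Suc k"
      and fr: "frame (For ''i'' ''n'' ?inner) \<sigma>2 \<tau>"
    have rdt: "ready \<tau>" using rd2 fr by (rule ready_frame) simp_all
    have e: "rmem \<tau> ''eps'' = rmem \<sigma>2 ''eps''" using frameD[OF fr] by simp
    have s: "rmem (R ?inner \<tau>) ''wt'' = (\<lambda>ks. if \<exists>g\<in>{1..m}. ks = [Suc k] @ [g] then ?f [Suc k, last ks] else rmem \<tau> ''wt'' ks)"
    proof (rule For_rset)
      fix g \<tau>' assume g: "g \<in> {1..m}" "nmem \<tau>' ''g'' [] = g" and fr': "frame ?inner \<tau> \<tau>'"
        and old: "rmem \<tau>' ''wt'' ([Suc k] @ [g]) = rmem \<tau> ''wt'' ([Suc k] @ [g])"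
      have t': "rmem \<tau>' ''eps'' = rmem \<sigma>2 ''eps''" "nmem \<tau>' ''i'' [] = Suc k"
        using frameD[OF fr'] e k by simp_all
      have "rmem \<tau>' ''wt'' [Suc k, g] = rmem \<sigma> ''wt'' [Suc k, g]" using old unfolding I by simp
      then show "rmem (R ?p \<tau>') ''wt'' = (rmem \<tau>' ''wt'')([Suc k] @ [g] := ?f [Suc k, g])"
        using t' g E by auto
    qed (use readyD[OF rdt] in simp_all)
    have "{1..Suc k} = insert (Suc k) {1..k}" by auto
    then show "?I (Suc k) (R ?inner \<tau>)" unfolding s I by (auto simp: fun_eq_iff)
  qed (use readyD[OF rd2] wt2 in simp_all)
  moreover have "R (For ''i'' ''n'' ?inner) \<sigma>2 = R replace_zero_weights \<sigma>"
    by (simp add: replace_zero_weights_def \<sigma>1_def \<sigma>2_def)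
  ultimately have W: "rmem (R replace_zero_weights \<sigma>) ''wt'' = (\<lambda>ks. if \<exists>i\<in>{1..n}. \<exists>g\<in>{1..m}. ks = [i, g] then ?f ks else rmem \<sigma> ''wt'' ks)"
    by simp
  show ?thesis unfolding weight_def W using i g by simp
qed

section \<open>Correctness of the matching\<close>

abbreviation dual :: "mem \<Rightarrow> nat \<Rightarrow> real" where "dual \<sigma> i \<equiv> rmem \<sigma> ''dual'' [i]"
abbreviation price :: "mem \<Rightarrow> nat \<Rightarrow> real" where "price \<sigma> g \<equiv> rmem \<sigma> ''price'' [g]"
abbreviation mate :: "mem \<Rightarrow> nat \<Rightarrow> nat" where "mate \<sigma> i \<equiv> nmem \<sigma> ''mate'' [i]"
abbreviation alt :: "mem \<Rightarrow> nat \<Rightarrow> nat \<Rightarrow> nat" where "alt \<sigma> i k \<equiv> nmem \<sigma> ''alt'' [i, k]"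

definition reached :: "mem \<Rightarrow> nat set" where
  "reached \<sigma> = {i\<in>{1..n}. nmem \<sigma> ''reach'' [i] \<noteq> 0}"

definition tree :: "mem \<Rightarrow> nat set" where
  "tree \<sigma> = {g\<in>{1..m}. nmem \<sigma> ''tree'' [g] \<noteq> 0}"

lemma run_init_duals:
  assumes rd: "ready \<sigma>"
  shows "i \<in> {1..n} \<Longrightarrow> dual (R init_duals \<sigma>) i = 1 / rmem \<sigma> ''low'' []"
    "g \<in> {1..m} \<Longrightarrow> price (R init_duals \<sigma>) g = 1"
proof -
  let ?d = "For ''i'' ''n'' (SetR ''dual'' [NV ''i''] (RDiv (RNat (NConst 1)) (RV ''low'')))"
  let ?p = "For ''g'' ''m'' (SetR ''price'' [NV ''g''] (RNat (NConst 1)))"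
  have rd1: "ready (R ?d \<sigma>)" using rd by (rule ready_run) simp_all
  have d: "rmem (R ?d \<sigma>) ''dual'' = (\<lambda>ks. if \<exists>i\<in>{1..n}. ks = [] @ [i] then 1 / rmem \<sigma> ''low'' [] else rmem \<sigma> ''dual'' ks)"
  proof (rule For_rset)
    fix k \<tau> assume "nmem \<tau> ''i'' [] = k" "frame ?d \<sigma> \<tau>"
    then show "rmem (R (SetR ''dual'' [NV ''i''] (RDiv (RNat (NConst 1)) (RV ''low''))) \<tau>) ''dual''
        = (rmem \<tau> ''dual'')([] @ [k] := 1 / rmem \<sigma> ''low'' [])" using frameD[of ?d \<sigma> \<tau>] by simp
  qed (use readyD[OF rd] in simp_all)
  have p: "rmem (R ?p \<tau>) ''price'' = (\<lambda>ks. if \<exists>i\<in>{1..m}. ks = [] @ [i] then 1 else rmem \<tau> ''price'' ks)"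
    if "ready \<tau>" for \<tau> by (rule For_rset) (use readyD[OF that] in simp_all)
  show "i \<in> {1..n} \<Longrightarrow> dual (R init_duals \<sigma>) i = 1 / rmem \<sigma> ''low'' []"
    using d by (simp add: init_duals_def run_frame del: run.simps(7))
  show "g \<in> {1..m} \<Longrightarrow> price (R init_duals \<sigma>) g = 1"
    using p[OF rd1] by (simp add: init_duals_def del: run.simps(7))
qed

lemma run_init_search:
  assumes rd: "ready \<sigma>" and r: "nmem \<sigma> ''r'' [] = r" "r \<in> {1..n}"
  defines "\<tau> \<equiv> R init_search \<sigma>"
  shows "reached \<tau> = {r}" "tree \<tau> = {}" "nmem \<tau> ''done'' [] = 0" "k \<in> {1..n} \<Longrightarrow> alt \<tau> r k = mate \<sigma> k"
proof -
  let ?a = "For ''i'' ''n'' (SetN ''reach'' [NV ''i''] (NConst 0))"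
  let ?b = "For ''g'' ''m'' (SetN ''tree'' [NV ''g''] (NConst 0))"
  let ?c = "For ''i'' ''n'' (SetN ''alt'' [NV ''r'', NV ''i''] (NVar ''mate'' [NV ''i'']))"
  define \<sigma>1 where "\<sigma>1 = R ?a \<sigma>"
  define \<sigma>2 where "\<sigma>2 = R ?b \<sigma>1"
  define \<sigma>3 where "\<sigma>3 = R ?c \<sigma>2"
  have rd1: "ready \<sigma>1" unfolding \<sigma>1_def using rd by (rule ready_run) simp_all
  have rd2: "ready \<sigma>2" unfolding \<sigma>2_def using rd1 by (rule ready_run) simp_all
  have \<tau>: "\<tau> = R (SetN ''reach'' [NV ''r''] (NConst 1) ;; SetV ''done'' (NConst 0)) \<sigma>3"
    by (simp add: \<tau>_def init_search_def \<sigma>1_def \<sigma>2_def \<sigma>3_def)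
  have a: "nmem \<sigma>1 ''reach'' = (\<lambda>ks. if \<exists>i\<in>{1..n}. ks = [] @ [i] then 0 else nmem \<sigma> ''reach'' ks)"
    unfolding \<sigma>1_def by (rule For_nset) (use readyD[OF rd] in simp_all)
  have b: "nmem \<sigma>2 ''tree'' = (\<lambda>ks. if \<exists>i\<in>{1..m}. ks = [] @ [i] then 0 else nmem \<sigma>1 ''tree'' ks)"
    unfolding \<sigma>2_def by (rule For_nset) (use readyD[OF rd1] in simp_all)
  have s2: "nmem \<sigma>2 ''r'' [] = r" "nmem \<sigma>2 ''mate'' = nmem \<sigma> ''mate''" "nmem \<sigma>2 ''reach'' = nmem \<sigma>1 ''reach''"
    using r by (simp_all add: \<sigma>2_def \<sigma>1_def run_frame del: run.simps)
  have c: "nmem \<sigma>3 ''alt'' = (\<lambda>ks. if \<exists>i\<in>{1..n}. ks = [r] @ [i] then mate \<sigma> (last ks) else nmem \<sigma>2 ''alt'' ks)"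
    unfolding \<sigma>3_def
  proof (rule For_nset)
    fix k \<tau> assume "nmem \<tau> ''i'' [] = k" "frame ?c \<sigma>2 \<tau>"
    then show "nmem (R (SetN ''alt'' [NV ''r'', NV ''i''] (NVar ''mate'' [NV ''i''])) \<tau>) ''alt''
        = (nmem \<tau> ''alt'')([r] @ [k] := mate \<sigma> k)" using frameD[of ?c \<sigma>2 \<tau>] s2 by simp
  qed (use readyD[OF rd2] in simp_all)
  have s3: "nmem \<sigma>3 ''r'' [] = r" "nmem \<sigma>3 ''tree'' = nmem \<sigma>2 ''tree''" "nmem \<sigma>3 ''reach'' = nmem \<sigma>1 ''reach''"
    using s2 by (simp_all add: \<sigma>3_def run_frame del: run.simps)
  show "reached \<tau> = {r}" using r s3 a by (auto simp: \<tau> reached_def)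
  show "tree \<tau> = {}" using s3 b by (simp add: \<tau> tree_def)
  show "nmem \<tau> ''done'' [] = 0" by (simp add: \<tau>)
  show "k \<in> {1..n} \<Longrightarrow> alt \<tau> r k = mate \<sigma> k" using c by (simp add: \<tau>)
qed

lemma run_find_edge:
  assumes rd: "ready \<sigma>" and ne: "reached \<sigma> \<noteq> {}" "\<exists>g\<in>{1..m}. g \<notin> tree \<sigma>"
  defines "\<tau> \<equiv> R find_edge \<sigma>"
  defines "a \<equiv> nmem \<tau> ''agent'' []" and "b \<equiv> nmem \<tau> ''good'' []"
  shows "a \<in> reached \<sigma>" "b \<in> {1..m}" "b \<notin> tree \<sigma>"
    "rmem \<tau> ''ratio'' [] = dual \<sigma> a * price \<sigma> b / weight \<sigma> a b"
    "\<lbrakk>i \<in> reached \<sigma>; g \<in> {1..m}; g \<notin> tree \<sigma>\<rbrakk> \<Longrightarrow> rmem \<tau> ''ratio'' [] \<le> dual \<sigma> i * price \<sigma> g / weight \<sigma> i g"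
proof -
  let ?p = "When (BAnd (NZ (NVar ''reach'' [NV ''i''])) (BAnd (NEq (NVar ''tree'' [NV ''g'']) (NConst 0))
        (BOr (NEq (NV ''agent'') (NConst 0)) (RLess ratio_exp (RV ''ratio'')))))
      (SetV ''agent'' (NV ''i'') ;; SetV ''good'' (NV ''g'') ;; SetR ''ratio'' [] ratio_exp)"
  let ?inner = "For ''g'' ''m'' ?p"
  let ?q = "\<lambda>i g. dual \<sigma> i * price \<sigma> g / weight \<sigma> i g"
  define E where "E = reached \<sigma> \<times> ({1..m} - tree \<sigma>)"
  \<comment> \<open>\<open>V\<close> is the set of pairs scanned so far: full rows in the outer
    invariant, and a part of the current row in addition in the inner one.\<close>
  define best where "best = (\<lambda>V (\<tau>::mem). let a = nmem \<tau> ''agent'' []; b = nmem \<tau> ''good'' []; x = rmem \<tau> ''ratio'' [] in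
     (a = 0 \<and> E \<inter> V = {}) \<or> ((a, b) \<in> E \<and> x = ?q a b \<and> (\<forall>i g. (i, g) \<in> E \<inter> V \<longrightarrow> x \<le> ?q i g)))"
  define \<sigma>1 where "\<sigma>1 = R (SetV ''agent'' (NConst 0)) \<sigma>"
  have rd1: "ready \<sigma>1" unfolding \<sigma>1_def using rd by (rule ready_run) simp_all
  have s1: "nmem \<sigma>1 ''reach'' = nmem \<sigma> ''reach''" "nmem \<sigma>1 ''tree'' = nmem \<sigma> ''tree''"
    "rmem \<sigma>1 = rmem \<sigma>" by (simp_all add: \<sigma>1_def)
  let ?I = "\<lambda>k (\<tau>::mem). best ({1..k} \<times> {1..m}) \<tau>"
  have "?I n (R (For ''i'' ''n'' ?inner) \<sigma>1)"
  proof (rule For_induct[where I = ?I])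
    fix k \<tau> assume I: "?I k \<tau>" and k: "k < n" "nmem \<tau> ''i'' [] = Suc k"
      and fr: "frame (For ''i'' ''n'' ?inner) \<sigma>1 \<tau>"
    have rdt: "ready \<tau>" using rd1 fr by (rule ready_frame) simp_all
    let ?J = "\<lambda>j (\<tau>'::mem). best ({1..k} \<times> {1..m} \<union> {Suc k} \<times> {1..j}) \<tau>'"
    have "?J m (R ?inner \<tau>)"
    proof (rule For_induct[where I = ?J])
      fix j \<tau>' assume J: "?J j \<tau>'" and j: "j < m" "nmem \<tau>' ''g'' [] = Suc j" and fr': "frame ?inner \<tau> \<tau>'"
      have t': "nmem \<tau>' ''reach'' = nmem \<sigma> ''reach''" "nmem \<tau>' ''tree'' = nmem \<sigma> ''tree''"
        "rmem \<tau>' ''dual'' = rmem \<sigma> ''dual''" "rmem \<tau>' ''price'' = rmem \<sigma> ''price''"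
        "rmem \<tau>' ''wt'' = rmem \<sigma> ''wt''" "nmem \<tau>' ''i'' [] = Suc k"
        using frameD[OF fr'] frameD[OF fr] k s1 by simp_all
      define V where "V = {1..k} \<times> {1..m} \<union> {Suc k} \<times> {1..j}"
      have V: "{1..k} \<times> {1..m} \<union> {Suc k} \<times> {1..Suc j} = insert (Suc k, Suc j) V"
        unfolding V_def by auto
      have Ekj: "(Suc k, Suc j) \<in> E \<longleftrightarrow> nmem \<tau>' ''reach'' [Suc k] \<noteq> 0 \<and> nmem \<tau>' ''tree'' [Suc j] = 0"
        using k j unfolding E_def reached_def tree_def t' by auto
      have q: "rval \<tau>' ratio_exp = ?q (Suc k) (Suc j)" using t' j by (simp add: weight_def)
      have J': "best V \<tau>'" using J unfolding V_def .
      have "best (insert (Suc k, Suc j) V) (R ?p \<tau>')"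
      proof (cases "(Suc k, Suc j) \<in> E")
        case False
        then have e: "R ?p \<tau>' = \<tau>'" using Ekj t' j by (auto simp del: rval.simps)
        have "E \<inter> insert (Suc k, Suc j) V = E \<inter> V" using False by blast
        then show ?thesis using J' unfolding e best_def by simp
      next
        case True
        show ?thesis
        proof (cases "nmem \<tau>' ''agent'' [] = 0 \<or> rval \<tau>' ratio_exp < rmem \<tau>' ''ratio'' []")
          case c: True
          then have "nmem (R ?p \<tau>') ''agent'' [] = Suc k" "nmem (R ?p \<tau>') ''good'' [] = Suc j"
            "rmem (R ?p \<tau>') ''ratio'' [] = ?q (Suc k) (Suc j)"
            using True Ekj t' j q by simp_all
          moreover have "\<forall>i g. (i, g) \<in> E \<inter> V \<longrightarrow> ?q (Suc k) (Suc j) \<le> ?q i g"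
          proof (cases "nmem \<tau>' ''agent'' [] = 0")
            case True
            then have "E \<inter> V = {}" using J' unfolding best_def Let_def E_def reached_def by auto
            then show ?thesis by blast
          next
            case False
            then have lt: "?q (Suc k) (Suc j) < rmem \<tau>' ''ratio'' []" using c unfolding q by simp
            have le: "\<forall>i g. (i, g) \<in> E \<inter> V \<longrightarrow> rmem \<tau>' ''ratio'' [] \<le> ?q i g"
              using J' False unfolding best_def Let_def by blast
            show ?thesis using le lt by (meson less_imp_le order_trans)
          qed
          ultimately show ?thesis using True unfolding best_def Let_def by auto
        next
          case c: False
          then have e: "R ?p \<tau>' = \<tau>'" using t' j by simp
          have "rmem \<tau>' ''ratio'' [] \<le> ?q (Suc k) (Suc j)" using c unfolding q by simp
          then show ?thesis using J' c unfolding e best_def Let_def by auto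
        qed
      qed
      then show "?J (Suc j) (R ?p \<tau>')" unfolding V .
    qed (use I readyD[OF rdt] in \<open>simp_all add: best_def\<close>)
    moreover have "{1..k} \<times> {1..m} \<union> {Suc k} \<times> {1..m} = {1..Suc k} \<times> {1..m}" by auto
    ultimately show "?I (Suc k) (R ?inner \<tau>)" by simp
  qed (use readyD[OF rd1] in \<open>simp_all add: best_def \<sigma>1_def\<close>)
  moreover have "R (For ''i'' ''n'' ?inner) \<sigma>1 = \<tau>" by (simp add: \<tau>_def find_edge_def \<sigma>1_def)
  ultimately have "best ({1..n} \<times> {1..m}) \<tau>" by simp
  moreover have "E \<inter> {1..n} \<times> {1..m} = E" "E \<noteq> {}" using ne by (auto simp: E_def reached_def)
  ultimately have "(a, b) \<in> E \<and> rmem \<tau> ''ratio'' [] = ?q a b \<and> (\<forall>i g. (i, g) \<in> E \<longrightarrow> rmem \<tau> ''ratio'' [] \<le> ?q i g)"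
    unfolding best_def Let_def a_def b_def by metis
  then show "a \<in> reached \<sigma>" "b \<in> {1..m}" "b \<notin> tree \<sigma>" "rmem \<tau> ''ratio'' [] = ?q a b"
    "\<lbrakk>i \<in> reached \<sigma>; g \<in> {1..m}; g \<notin> tree \<sigma>\<rbrakk> \<Longrightarrow> rmem \<tau> ''ratio'' [] \<le> ?q i g"
    unfolding E_def by auto
qed

lemma run_relabel:
  assumes rd: "ready \<sigma>"
  shows "dual (R relabel \<sigma>) i = (if i \<in> reached \<sigma> then dual \<sigma> i / rmem \<sigma> ''ratio'' [] else dual \<sigma> i)"
    "price (R relabel \<sigma>) g = (if g \<in> tree \<sigma> then price \<sigma> g * rmem \<sigma> ''ratio'' [] else price \<sigma> g)"
proof -
  let ?d1 = "When (NZ (NVar ''reach'' [NV ''i'']))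
    (SetR ''dual'' [NV ''i''] (RDiv (RVar ''dual'' [NV ''i'']) (RV ''ratio'')))"
  let ?p1 = "When (NZ (NVar ''tree'' [NV ''g'']))
    (SetR ''price'' [NV ''g''] (RMul (RVar ''price'' [NV ''g'']) (RV ''ratio'')))"
  let ?d = "For ''i'' ''n'' ?d1" and ?p = "For ''g'' ''m'' ?p1"
  let ?x = "rmem \<sigma> ''ratio'' []"
  let ?f = "\<lambda>k. if nmem \<sigma> ''reach'' [k] \<noteq> 0 then dual \<sigma> k / ?x else dual \<sigma> k"
  have d: "rmem (R ?d \<sigma>) ''dual'' = (\<lambda>ks. if \<exists>i\<in>{1..n}. ks = [] @ [i] then ?f (last ks) else rmem \<sigma> ''dual'' ks)"
  proof (rule For_rset)
    fix k \<tau> assume k: "nmem \<tau> ''i'' [] = k" and fr: "frame ?d \<sigma> \<tau>"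
      and old: "rmem \<tau> ''dual'' ([] @ [k]) = rmem \<sigma> ''dual'' ([] @ [k])"
    have "nmem \<tau> ''reach'' = nmem \<sigma> ''reach''" "rmem \<tau> ''ratio'' = rmem \<sigma> ''ratio''"
      using frameD[OF fr] by simp_all
    then show "rmem (R ?d1 \<tau>) ''dual'' = (rmem \<tau> ''dual'')([] @ [k] := ?f k)" using k old by auto
  qed (use readyD[OF rd] in simp_all)
  have rd1: "ready (R ?d \<sigma>)" using rd by (rule ready_run) simp_all
  have s: "nmem (R ?d \<sigma>) ''tree'' = nmem \<sigma> ''tree''" "rmem (R ?d \<sigma>) ''ratio'' = rmem \<sigma> ''ratio''"
    "rmem (R ?d \<sigma>) ''price'' = rmem \<sigma> ''price''" by (simp_all add: run_frame del: run.simps)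
  let ?h = "\<lambda>k. if nmem \<sigma> ''tree'' [k] \<noteq> 0 then price \<sigma> k * ?x else price \<sigma> k"
  have p: "rmem (R ?p (R ?d \<sigma>)) ''price'' = (\<lambda>ks. if \<exists>g\<in>{1..m}. ks = [] @ [g] then ?h (last ks) else rmem (R ?d \<sigma>) ''price'' ks)"
  proof (rule For_rset)
    fix k \<tau> assume k: "nmem \<tau> ''g'' [] = k" and fr: "frame ?p (R ?d \<sigma>) \<tau>"
      and old: "rmem \<tau> ''price'' ([] @ [k]) = rmem (R ?d \<sigma>) ''price'' ([] @ [k])"
    have "nmem \<tau> ''tree'' = nmem \<sigma> ''tree''" "rmem \<tau> ''ratio'' = rmem \<sigma> ''ratio''"
      using frameD[OF fr] s by simp_all
    then show "rmem (R ?p1 \<tau>) ''price'' = (rmem \<tau> ''price'')([] @ [k] := ?h k)" using k old s by auto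
  qed (use readyD[OF rd1] in simp_all)
  have RR: "R relabel \<sigma> = R ?p (R ?d \<sigma>)" by (simp add: relabel_def)
  have "rmem (R relabel \<sigma>) ''dual'' = rmem (R ?d \<sigma>) ''dual''" unfolding RR by (simp add: run_frame del: run.simps)
  then show "dual (R relabel \<sigma>) i = (if i \<in> reached \<sigma> then dual \<sigma> i / ?x else dual \<sigma> i)"
    using d by (simp add: reached_def del: run.simps)
  show "price (R relabel \<sigma>) g = (if g \<in> tree \<sigma> then price \<sigma> g * ?x else price \<sigma> g)"
    unfolding RR using p s(3) by (simp add: tree_def del: run.simps)
qed

lemma run_find_mate:
  assumes rd: "ready \<sigma>" and r: "nmem \<sigma> ''r'' [] = r" "r \<in> {1..n}"
  defines "j \<equiv> nmem (R find_mate \<sigma>) ''own'' []"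
  shows "(j = 0 \<and> nmem \<sigma> ''good'' [] \<notin> mate \<sigma> ` {1..r - 1}) \<or>
    (j \<in> {1..r - 1} \<and> mate \<sigma> j = nmem \<sigma> ''good'' [])"
proof -
  let ?p = "When (BAnd (NLess (NV ''i'') (NV ''r'')) (NEq (NVar ''mate'' [NV ''i'']) (NV ''good'')))
    (SetV ''own'' (NV ''i''))"
  let ?b = "nmem \<sigma> ''good'' []"
  define \<sigma>1 where "\<sigma>1 = R (SetV ''own'' (NConst 0)) \<sigma>"
  have rd1: "ready \<sigma>1" unfolding \<sigma>1_def using rd by (rule ready_run) simp_all
  have s1: "nmem \<sigma>1 ''mate'' = nmem \<sigma> ''mate''" "nmem \<sigma>1 ''good'' [] = ?b" "nmem \<sigma>1 ''r'' [] = r"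
    using r by (simp_all add: \<sigma>1_def)
  let ?I = "\<lambda>k (\<tau>::mem). let j = nmem \<tau> ''own'' [] in
     (j = 0 \<and> (\<forall>i\<in>{1..k}. i < r \<longrightarrow> mate \<sigma> i \<noteq> ?b)) \<or> (1 \<le> j \<and> j < r \<and> mate \<sigma> j = ?b)"
  have "?I n (R (For ''i'' ''n'' ?p) \<sigma>1)"
  proof (rule For_induct[where I = ?I])
    fix k \<tau> assume I: "?I k \<tau>" and k: "k < n" "nmem \<tau> ''i'' [] = Suc k"
      and fr: "frame (For ''i'' ''n'' ?p) \<sigma>1 \<tau>"
    have t: "nmem \<tau> ''mate'' = nmem \<sigma> ''mate''" "nmem \<tau> ''good'' [] = ?b" "nmem \<tau> ''r'' [] = r"
      using frameD[OF fr] s1 by simp_all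
    have ins: "{1..Suc k} = insert (Suc k) {1..k}" by auto
    show "?I (Suc k) (R ?p \<tau>)"
    proof (cases "Suc k < r \<and> mate \<sigma> (Suc k) = ?b")
      case True
      then have "nmem (R ?p \<tau>) ''own'' [] = Suc k" using t k by simp
      then show ?thesis using True by simp
    next
      case False
      then have "R ?p \<tau> = \<tau>" using t k by auto
      then show ?thesis using I False unfolding ins by (auto simp: Let_def)
    qed
  qed (use readyD[OF rd1] in \<open>simp_all add: \<sigma>1_def Let_def\<close>)
  moreover have "R (For ''i'' ''n'' ?p) \<sigma>1 = R find_mate \<sigma>" by (simp add: find_mate_def \<sigma>1_def)
  ultimately have "(j = 0 \<and> (\<forall>i\<in>{1..n}. i < r \<longrightarrow> mate \<sigma> i \<noteq> ?b)) \<or> (1 \<le> j \<and> j < r \<and> mate \<sigma> j = ?b)"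
    unfolding j_def by (simp add: Let_def)
  moreover have "i \<in> {1..r - 1} \<longleftrightarrow> i \<in> {1..n} \<and> i < r" for i using r(2) by auto
  moreover have "1 \<le> j \<and> j < r \<longleftrightarrow> j \<in> {1..r - 1}" by auto
  ultimately have "(j = 0 \<and> (\<forall>i\<in>{1..r - 1}. mate \<sigma> i \<noteq> ?b)) \<or> (j \<in> {1..r - 1} \<and> mate \<sigma> j = ?b)" by blast
  then show ?thesis unfolding image_iff by metis
qed

lemma run_augment:
  assumes rd: "ready \<sigma>" and a: "nmem \<sigma> ''agent'' [] = a"
  shows "k \<in> {1..n} \<Longrightarrow> mate (R augment \<sigma>) k = (if k = a then nmem \<sigma> ''good'' [] else alt \<sigma> a k)"
    "nmem (R augment \<sigma>) ''done'' [] = 1"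
proof -
  let ?c1 = "SetN ''mate'' [NV ''i''] (NVar ''alt'' [NV ''agent'', NV ''i''])"
  let ?c = "For ''i'' ''n'' ?c1"
  have c: "nmem (R ?c \<sigma>) ''mate'' = (\<lambda>ks. if \<exists>i\<in>{1..n}. ks = [] @ [i] then alt \<sigma> a (last ks) else nmem \<sigma> ''mate'' ks)"
  proof (rule For_nset)
    fix k \<tau> assume "nmem \<tau> ''i'' [] = k" "frame ?c \<sigma> \<tau>"
    then show "nmem (R ?c1 \<tau>) ''mate'' = (nmem \<tau> ''mate'')([] @ [k] := alt \<sigma> a k)"
      using frameD[of ?c \<sigma> \<tau>] a by simp
  qed (use readyD[OF rd] in simp_all)
  have s: "nmem (R ?c \<sigma>) ''agent'' [] = a" "nmem (R ?c \<sigma>) ''good'' [] = nmem \<sigma> ''good'' []"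
    using a by (simp_all add: run_frame del: run.simps)
  show "k \<in> {1..n} \<Longrightarrow> mate (R augment \<sigma>) k = (if k = a then nmem \<sigma> ''good'' [] else alt \<sigma> a k)"
    using s c by (auto simp: augment_def simp del: run.simps(7))
  show "nmem (R augment \<sigma>) ''done'' [] = 1" by (simp add: augment_def)
qed

lemma run_extend_search:
  assumes rd: "ready \<sigma>" and a: "nmem \<sigma> ''agent'' [] = a" and j: "nmem \<sigma> ''own'' [] = j" "j \<in> {1..n}" "j \<noteq> a"
    and b: "nmem \<sigma> ''good'' [] = b" "b \<in> {1..m}"
  defines "\<tau> \<equiv> R extend_search \<sigma>"
  shows "k \<in> {1..n} \<Longrightarrow> alt \<tau> j k = (if k = a then b else alt \<sigma> a k)"
    "i \<noteq> j \<Longrightarrow> alt \<tau> i k = alt \<sigma> i k"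
    "reached \<tau> = insert j (reached \<sigma>)" "tree \<tau> = insert b (tree \<sigma>)"
proof -
  let ?c1 = "SetN ''alt'' [NV ''own'', NV ''i''] (NVar ''alt'' [NV ''agent'', NV ''i''])"
  let ?c = "For ''i'' ''n'' ?c1"
  let ?I = "\<lambda>k (\<tau>::mem). nmem \<tau> ''alt'' = (\<lambda>ks. if \<exists>i\<in>{1..k}. ks = [j] @ [i] then alt \<sigma> a (last ks) else nmem \<sigma> ''alt'' ks)"
  have c: "?I n (R ?c \<sigma>)"
  proof (rule For_induct[where I = ?I])
    fix k \<tau> assume I: "?I k \<tau>" and k: "nmem \<tau> ''i'' [] = Suc k" and fr: "frame ?c \<sigma> \<tau>"
    have t: "nmem \<tau> ''agent'' [] = a" "nmem \<tau> ''own'' [] = j" using frameD[OF fr] a j by simp_all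
    \<comment> \<open>Row \<open>a\<close> is read while row \<open>j\<close> of the same array is
      overwritten, so \<open>j \<noteq> a\<close> is needed.\<close>
    have "alt \<tau> a (Suc k) = alt \<sigma> a (Suc k)" using I j(3) by simp
    then have "nmem (R ?c1 \<tau>) ''alt'' = (nmem \<tau> ''alt'')([j, Suc k] := alt \<sigma> a (Suc k))" using t k by simp
    moreover have "{1..Suc k} = insert (Suc k) {1..k}" by auto
    ultimately show "?I (Suc k) (R ?c1 \<tau>)" by (subst (asm) I) (simp add: fun_eq_iff)
  qed (use readyD[OF rd] in simp_all)
  have s: "nmem (R ?c \<sigma>) ''agent'' [] = a" "nmem (R ?c \<sigma>) ''good'' [] = b" "nmem (R ?c \<sigma>) ''own'' [] = j"
    "nmem (R ?c \<sigma>) ''reach'' = nmem \<sigma> ''reach''" "nmem (R ?c \<sigma>) ''tree'' = nmem \<sigma> ''tree''"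
    using a b j by (simp_all add: run_frame del: run.simps)
  have \<tau>: "\<tau> = R (SetN ''alt'' [NV ''own'', NV ''agent''] (NV ''good'') ;;
    SetN ''reach'' [NV ''own''] (NConst 1) ;; SetN ''tree'' [NV ''good''] (NConst 1)) (R ?c \<sigma>)"
    by (simp add: \<tau>_def extend_search_def)
  have al: "nmem \<tau> ''alt'' = (nmem (R ?c \<sigma>) ''alt'')([j, a] := b)"
    unfolding \<tau> using s by (simp del: run.simps(7))
  show "k \<in> {1..n} \<Longrightarrow> alt \<tau> j k = (if k = a then b else alt \<sigma> a k)" unfolding al c by simp
  show "i \<noteq> j \<Longrightarrow> alt \<tau> i k = alt \<sigma> i k" unfolding al c by simp
  have "nmem \<tau> ''reach'' = (nmem \<sigma> ''reach'')([j] := 1)" "nmem \<tau> ''tree'' = (nmem \<sigma> ''tree'')([b] := 1)"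
    unfolding \<tau> using s by (simp_all del: run.simps(7))
  then show "reached \<tau> = insert j (reached \<sigma>)" "tree \<tau> = insert b (tree \<sigma>)"
    using j(2) b(2) by (auto simp: reached_def tree_def)
qed

text \<open>\<open>k\<close> counts the steps made. The cardinality records that every step without
  augmentation reaches exactly one new agent, starting from \<open>r\<close> alone.\<close>

definition search_state :: "(nat \<Rightarrow> nat \<Rightarrow> real) \<Rightarrow> nat \<Rightarrow> nat \<Rightarrow> mem \<Rightarrow> bool" where
  "search_state w r k \<sigma> \<longleftrightarrow>
     (if nmem \<sigma> ''done'' [] = 0
      then assignment_problem.search_inv n m w r (mate \<sigma>) (reached \<sigma>) (alt \<sigma>) (dual \<sigma>) (price \<sigma>) \<and>
        card (reached \<sigma>) = Suc k \<and>
        tree \<sigma> = assignment_problem.reached_goods r (mate \<sigma>) (reached \<sigma>)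
      else assignment_problem.optimal_pair n m w r (mate \<sigma>) (dual \<sigma>) (price \<sigma>))"

text \<open>After relabelling, the edge of least ratio is tight. If its good is free, the step
  augments; otherwise the holder of the good is a new agent and joins the reached ones.\<close>

lemma run_search_step:
  assumes w: "\<And>i g. \<lbrakk>i \<in> {1..n}; g \<in> {1..m}\<rbrakk> \<Longrightarrow> 0 < weight \<sigma> i g"
    and rd: "ready \<sigma>" and r: "nmem \<sigma> ''r'' [] = r" "r \<in> {1..n}"
    and st: "search_state (weight \<sigma>) r k \<sigma>"
  shows "search_state (weight \<sigma>) r (Suc k) (R search_step \<sigma>)"
proof (cases "nmem \<sigma> ''done'' [] = 0")
  case False
  then have "R search_step \<sigma> = \<sigma>" by (simp add: search_step_def)
  then show ?thesis using st False by (simp add: search_state_def)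
next
  case True
  interpret A: assignment_problem n m "weight \<sigma>" by standard (use n_le_m w in auto)
  have inv: "A.search_inv r (mate \<sigma>) (reached \<sigma>) (alt \<sigma>) (dual \<sigma>) (price \<sigma>)"
    and cd: "card (reached \<sigma>) = Suc k" and tr: "tree \<sigma> = A.reached_goods r (mate \<sigma>) (reached \<sigma>)"
    using st True unfolding search_state_def by simp_all
  define \<sigma>1 where "\<sigma>1 = R find_edge \<sigma>"
  define \<sigma>2 where "\<sigma>2 = R relabel \<sigma>1"
  define \<sigma>3 where "\<sigma>3 = R find_mate \<sigma>2"
  have rd1: "ready \<sigma>1" unfolding \<sigma>1_def using rd by (rule ready_run) (simp_all add: matching_defs)
  have rd2: "ready \<sigma>2" unfolding \<sigma>2_def using rd1 by (rule ready_run) (simp_all add: matching_defs)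
  have rd3: "ready \<sigma>3" unfolding \<sigma>3_def using rd2 by (rule ready_run) (simp_all add: matching_defs)
  have R: "R search_step \<sigma> = (if nmem \<sigma>3 ''own'' [] = 0 then R augment \<sigma>3 else R extend_search \<sigma>3)"
    using True by (simp add: search_step_def \<sigma>1_def \<sigma>2_def \<sigma>3_def)
  have s1: "nmem \<sigma>1 ''reach'' = nmem \<sigma> ''reach''" "nmem \<sigma>1 ''tree'' = nmem \<sigma> ''tree''"
    "rmem \<sigma>1 ''dual'' = rmem \<sigma> ''dual''" "rmem \<sigma>1 ''price'' = rmem \<sigma> ''price''"
    by (simp_all add: \<sigma>1_def run_frame find_edge_def del: run.simps)
  have s3: "nmem \<sigma>3 ''reach'' = nmem \<sigma> ''reach''" "nmem \<sigma>3 ''tree'' = nmem \<sigma> ''tree''"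
    "nmem \<sigma>3 ''mate'' = nmem \<sigma> ''mate''" "nmem \<sigma>3 ''alt'' = nmem \<sigma> ''alt''" "nmem \<sigma>3 ''r'' = nmem \<sigma> ''r''"
    "nmem \<sigma>3 ''done'' = nmem \<sigma> ''done''" "nmem \<sigma>3 ''agent'' = nmem \<sigma>1 ''agent''" "nmem \<sigma>3 ''good'' = nmem \<sigma>1 ''good''"
    "rmem \<sigma>3 ''dual'' = rmem \<sigma>2 ''dual''" "rmem \<sigma>3 ''price'' = rmem \<sigma>2 ''price''"
    by (simp_all add: \<sigma>3_def \<sigma>2_def \<sigma>1_def run_frame find_edge_def relabel_def find_mate_def del: run.simps)
  have s2: "nmem \<sigma>2 ''mate'' = nmem \<sigma> ''mate''" "nmem \<sigma>2 ''good'' = nmem \<sigma>1 ''good''" "nmem \<sigma>2 ''r'' = nmem \<sigma> ''r''"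
    by (simp_all add: \<sigma>2_def \<sigma>1_def run_frame find_edge_def relabel_def del: run.simps)
  define a where "a = nmem \<sigma>1 ''agent'' []"
  define b where "b = nmem \<sigma>1 ''good'' []"
  define x where "x = rmem \<sigma>1 ''ratio'' []"
  have "reached \<sigma> \<noteq> {}" using cd by auto
  moreover have "\<exists>g\<in>{1..m}. g \<notin> tree \<sigma>" using A.unreached_good_exists[OF inv] tr by simp
  ultimately have e: "a \<in> reached \<sigma>" "b \<in> {1..m}" "b \<notin> tree \<sigma>" "x = dual \<sigma> a * price \<sigma> b / weight \<sigma> a b"
    "\<And>i g. \<lbrakk>i \<in> reached \<sigma>; g \<in> {1..m}; g \<notin> tree \<sigma>\<rbrakk> \<Longrightarrow> x \<le> dual \<sigma> i * price \<sigma> g / weight \<sigma> i g"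
    unfolding a_def b_def x_def \<sigma>1_def using run_find_edge[OF rd] by blast+
  have r1: "reached \<sigma>1 = reached \<sigma>" "tree \<sigma>1 = tree \<sigma>" by (simp_all add: reached_def tree_def s1)
  have d2: "dual \<sigma>2 i = (if i \<in> reached \<sigma> then dual \<sigma> i / x else dual \<sigma> i)"
    and p2: "price \<sigma>2 g = (if g \<in> A.reached_goods r (mate \<sigma>) (reached \<sigma>) then price \<sigma> g * x else price \<sigma> g)" for i g
    unfolding \<sigma>2_def run_relabel[OF rd1] r1 tr s1 x_def by simp_all
  note rl = A.search_relabel[OF inv e(1,2) e(3)[unfolded tr] e(4) e(5)[unfolded tr], of "dual \<sigma>2" "price \<sigma>2", OF _ _ _ d2 p2]
  have inv2: "A.search_inv r (mate \<sigma>) (reached \<sigma>) (alt \<sigma>) (dual \<sigma>2) (price \<sigma>2)"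
    and tight: "weight \<sigma> a b = dual \<sigma>2 a * price \<sigma>2 b" using rl by blast+
  have "nmem \<sigma>2 ''r'' [] = r" using s2 r by simp
  note fm = run_find_mate[OF rd2 this r(2), folded \<sigma>3_def, unfolded s2, folded b_def]
  have ab3: "nmem \<sigma>3 ''agent'' [] = a" "nmem \<sigma>3 ''good'' [] = b" by (simp_all add: s3 a_def b_def)
  have rn: "{1..r} \<subseteq> {1..n}" using r(2) by auto
  show ?thesis
  proof (cases "nmem \<sigma>3 ''own'' [] = 0")
    case own: True
    then have nb: "b \<notin> mate \<sigma> ` {1..r - 1}" using fm by auto
    have R: "R search_step \<sigma> = R augment \<sigma>3" using R own by simp
    have du: "rmem (R augment \<sigma>3) ''dual'' = rmem \<sigma>2 ''dual''" "rmem (R augment \<sigma>3) ''price'' = rmem \<sigma>2 ''price''"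
      by (simp_all add: run_frame augment_def s3 del: run.simps)
    note au = run_augment[OF rd3 ab3(1)]
    have "mate (R augment \<sigma>3) k = (if k = a then b else alt \<sigma> a k)" if "k \<in> {1..r}" for k
      using au(1)[of k] that rn ab3(2) s3(4) by auto
    then have "A.optimal_pair r (mate (R augment \<sigma>3)) (dual \<sigma>2) (price \<sigma>2)"
      by (rule A.search_augment[OF inv2 e(1,2) nb tight])
    then show ?thesis using au(2) unfolding R search_state_def by (simp add: du)
  next
    case own: False
    define j where "j = nmem \<sigma>3 ''own'' []"
    have j: "j \<in> {1..r - 1}" "mate \<sigma> j = b" using fm own unfolding j_def by auto
    have R: "R search_step \<sigma> = R extend_search \<sigma>3" using R own by simp
    have "b \<notin> A.reached_goods r (mate \<sigma>) (reached \<sigma>)" using e(3) tr by simp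
    moreover have "j \<noteq> r" using j(1) r(2) by auto
    ultimately have jS: "j \<notin> reached \<sigma>" unfolding A.reached_goods_def using j(2) by blast
    have jn: "j \<in> {1..n}" using j(1) r(2) by auto
    have ja: "j \<noteq> a" using jS e(1) by blast
    note ex = run_extend_search[OF rd3 ab3(1) j_def[symmetric] jn ja ab3(2) e(2)]
    let ?\<tau> = "R extend_search \<sigma>3"
    have fr: "rmem ?\<tau> ''dual'' = rmem \<sigma>2 ''dual''" "rmem ?\<tau> ''price'' = rmem \<sigma>2 ''price''"
       "nmem ?\<tau> ''mate'' = nmem \<sigma> ''mate''" "nmem ?\<tau> ''done'' = nmem \<sigma> ''done''"
      by (simp_all add: run_frame extend_search_def s3 del: run.simps)
    have r3: "reached \<sigma>3 = reached \<sigma>" "tree \<sigma>3 = tree \<sigma>" by (simp_all add: reached_def tree_def s3)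
    have jT: "mate \<sigma> j \<notin> A.reached_goods r (mate \<sigma>) (reached \<sigma>)" using e(3) tr j(2) by simp
    have tj: "weight \<sigma> a (mate \<sigma> j) = dual \<sigma>2 a * price \<sigma>2 (mate \<sigma> j)" using tight j(2) by simp
    have old: "alt ?\<tau> i k = alt \<sigma> i k" if "i \<in> reached \<sigma>" for i k
      using ex(2)[of i k] that jS s3(4) by auto
    have new: "alt ?\<tau> j k = (if k = a then mate \<sigma> j else alt \<sigma> a k)" if "k \<in> {1..r}" for k
      using ex(1)[of k] that rn j(2) s3(4) by auto
    note se = A.search_extend[OF inv2 e(1) j(1) jT tj, of "alt ?\<tau>", OF old new]
    have "finite (reached \<sigma>)" by (simp add: reached_def)
    then have "card (insert j (reached \<sigma>)) = Suc (Suc k)" using jS cd by simp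
    then show ?thesis using se True unfolding R search_state_def
      by (simp add: fr ex(3,4) r3 tr j(2))
  qed
qed

lemma run_matching_stage:
  assumes w: "\<And>i g. \<lbrakk>i \<in> {1..n}; g \<in> {1..m}\<rbrakk> \<Longrightarrow> 0 < weight \<sigma> i g"
    and rd: "ready \<sigma>" and r: "nmem \<sigma> ''r'' [] = r" "r \<in> {1..n}"
    and opt: "assignment_problem.optimal_pair n m (weight \<sigma>) (r - 1) (mate \<sigma>) (dual \<sigma>) (price \<sigma>)"
  defines "\<tau> \<equiv> R (init_search ;; For ''k'' ''n'' search_step) \<sigma>"
  shows "assignment_problem.optimal_pair n m (weight \<sigma>) r (mate \<tau>) (dual \<tau>) (price \<tau>)"
proof -
  interpret A: assignment_problem n m "weight \<sigma>" by standard (use n_le_m w in auto)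
  define \<sigma>1 where "\<sigma>1 = R init_search \<sigma>"
  have rd1: "ready \<sigma>1" unfolding \<sigma>1_def using rd by (rule ready_run) (simp_all add: matching_defs)
  note i = run_init_search[OF rd r, folded \<sigma>1_def]
  have s1: "nmem \<sigma>1 ''mate'' = nmem \<sigma> ''mate''" "rmem \<sigma>1 ''dual'' = rmem \<sigma> ''dual''"
    "rmem \<sigma>1 ''price'' = rmem \<sigma> ''price''" "nmem \<sigma>1 ''r'' = nmem \<sigma> ''r''"
    "rmem \<sigma>1 ''wt'' = rmem \<sigma> ''wt''"
    by (simp_all add: \<sigma>1_def run_frame init_search_def del: run.simps)
  have al: "alt \<sigma>1 r k = mate \<sigma> k" if "k \<in> {1..r - 1}" for k using i(4)[of k] that r(2) by auto
  have "A.search_inv r (mate \<sigma>) {r} (alt \<sigma>1) (dual \<sigma>) (price \<sigma>)"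
    by (rule A.search_inv_init[where alt = "alt \<sigma>1"]) (fact opt r(2) al)+
  then have st0: "search_state (weight \<sigma>) r 0 \<sigma>1"
    by (simp add: search_state_def i s1 A.reached_goods_def)
  have "search_state (weight \<sigma>) r n (R (For ''k'' ''n'' search_step) \<sigma>1)"
  proof (rule For_induct[where I = "search_state (weight \<sigma>) r"])
    fix k \<tau> assume I: "search_state (weight \<sigma>) r k \<tau>" and fr: "frame (For ''k'' ''n'' search_step) \<sigma>1 \<tau>"
    have "weight \<tau> = weight \<sigma>" "nmem \<tau> ''r'' [] = r"
      using frameD[OF fr] s1 r by (simp_all add: weight_def fun_eq_iff matching_defs)
    moreover have "ready \<tau>" using rd1 fr by (rule ready_frame) (simp_all add: matching_defs)
    ultimately show "search_state (weight \<sigma>) r (Suc k) (R search_step \<tau>)"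
      using run_search_step[of \<tau> r k] w r(2) I by simp
  qed (use readyD[OF rd1] st0 in \<open>simp_all add: search_state_def matching_defs reached_def tree_def\<close>)
  then have fin: "search_state (weight \<sigma>) r n \<tau>" by (simp add: \<tau>_def \<sigma>1_def)
  \<comment> \<open>Without an augmentation \<open>n + 1\<close> agents would be reached after
    \<open>n\<close> steps.\<close>
  have "card (reached \<tau>) \<le> card {1..n}" by (rule card_mono) (auto simp: reached_def)
  then have "nmem \<tau> ''done'' [] \<noteq> 0" using fin by (auto simp: search_state_def split: if_splits)
  then show ?thesis using fin by (simp add: search_state_def)
qed

lemma run_find_matching:
  assumes rd: "ready \<sigma>"
  shows "max_weight_matching n m v (gamma \<sigma>) (mate (R find_matching \<sigma>))"
proof -
  define \<sigma>1 where "\<sigma>1 = R set_weights \<sigma>"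
  define \<sigma>2 where "\<sigma>2 = R replace_zero_weights \<sigma>1"
  define \<sigma>3 where "\<sigma>3 = R init_duals \<sigma>2"
  let ?stage = "init_search ;; For ''k'' ''n'' search_step"
  define \<sigma>4 where "\<sigma>4 = R (For ''r'' ''n'' ?stage) \<sigma>3"
  have rd1: "ready \<sigma>1" unfolding \<sigma>1_def using rd by (rule ready_run) (simp_all add: matching_defs)
  have rd2: "ready \<sigma>2" unfolding \<sigma>2_def using rd1 by (rule ready_run) (simp_all add: matching_defs)
  have rd3: "ready \<sigma>3" unfolding \<sigma>3_def using rd2 by (rule ready_run) (simp_all add: matching_defs)
  define c where "c = rmem \<sigma>1 ''low'' []"
  note sw = run_set_weights[OF rd, folded \<sigma>1_def, folded c_def]
  have c: "0 < c" "c < 1" using sw(1,2) by simp_all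
  have low2: "rmem \<sigma>2 ''low'' [] = c"
    by (simp add: \<sigma>2_def c_def run_frame replace_zero_weights_def del: run.simps)
  define w where "w = weight \<sigma>3"
  have w32: "weight \<sigma>3 = weight \<sigma>2"
    by (simp add: \<sigma>3_def weight_def fun_eq_iff run_frame init_duals_def del: run.simps)
  have w: "w i g = (if 0 < v i {g} + gamma \<sigma> i then v i {g} + gamma \<sigma> i else c ^ (2 * n))"
    if "i \<in> {1..n}" "g \<in> {1..m}" for i g
    using run_replace_zero_weights[OF rd1 that, folded \<sigma>2_def] sw(3)[OF that] by (simp add: w_def w32 c_def)
  have wpos: "0 < w i g" and wle: "w i g \<le> 1 / c" if "i \<in> {1..n}" "g \<in> {1..m}" for i g
  proof -
    have "c ^ (2 * n) \<le> 1" using c by (intro power_le_one) auto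
    also have "1 \<le> 1 / c" using c by simp
    finally have "c ^ (2 * n) \<le> 1 / c" .
    then show "0 < w i g" "w i g \<le> 1 / c" using w[OF that] sw(4)[OF that] c by auto
  qed
  interpret A: assignment_problem n m w by standard (use n_le_m wpos in auto)
  note du = run_init_duals[OF rd2, folded \<sigma>3_def, unfolded low2]
  have opt0: "A.optimal_pair 0 (mate \<sigma>3) (dual \<sigma>3) (price \<sigma>3)"
    unfolding A.optimal_pair_def A.dual_feasible_def A.tight_matching_def
    using c wle du by simp
  have "A.optimal_pair n (mate \<sigma>4) (dual \<sigma>4) (price \<sigma>4)"
    unfolding \<sigma>4_def
  proof (rule For_induct[where I = "\<lambda>k \<tau>. A.optimal_pair k (mate \<tau>) (dual \<tau>) (price \<tau>)"])
    fix k \<tau> assume I: "A.optimal_pair k (mate \<tau>) (dual \<tau>) (price \<tau>)" and k: "k < n" "nmem \<tau> ''r'' [] = Suc k"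
      and fr: "frame (For ''r'' ''n'' ?stage) \<sigma>3 \<tau>"
    have wt: "weight \<tau> = w"
      using frameD[OF fr] by (simp add: w_def weight_def fun_eq_iff matching_defs)
    have "ready \<tau>" using rd3 fr by (rule ready_frame) (simp_all add: matching_defs)
    then show "A.optimal_pair (Suc k) (mate (R ?stage \<tau>)) (dual (R ?stage \<tau>)) (price (R ?stage \<tau>))"
      using run_matching_stage[of \<tau> "Suc k"] wpos k I unfolding wt by simp
  qed (use readyD[OF rd3] opt0 in \<open>simp_all add: matching_defs\<close>)
  then have fin: "A.optimal_pair n (mate (R find_matching \<sigma>)) (dual \<sigma>4) (price \<sigma>4)"
    by (simp add: find_matching_def \<sigma>1_def \<sigma>2_def \<sigma>3_def \<sigma>4_def)
  then have mt: "matching n m (mate (R find_matching \<sigma>))"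
    unfolding A.optimal_pair_def A.tight_matching_def matching_def by blast
  show ?thesis
    by (rule max_weight_matching_if_prod_max[where w = w and c = c, OF mt c])
      (fact sw(4) w A.optimal_pair_max[OF fin])+
qed

section \<open>Correctness of the goods handed out singly\<close>

definition active :: "mem \<Rightarrow> nat set" where
  "active \<sigma> = {i\<in>{1..n}. nmem \<sigma> ''act'' [i] \<noteq> 0}"

text \<open>Unassigned goods have owner \<open>0\<close>.\<close>

definition bundle_of :: "mem \<Rightarrow> nat \<Rightarrow> nat set" where
  "bundle_of \<sigma> i = (if i = 0 then {} else {g\<in>{1..m}. nmem \<sigma> ''owner'' [g] = i})"

abbreviation goods :: "mem \<Rightarrow> nat set" where "goods \<sigma> \<equiv> row_set m \<sigma> ''goods'' []"
abbreviation piece :: "mem \<Rightarrow> nat set" where "piece \<sigma> \<equiv> row_set m \<sigma> ''piece'' []"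
abbreviation left :: "mem \<Rightarrow> nat set" where "left \<sigma> \<equiv> row_set m \<sigma> ''left'' []"

lemma finite_active: "finite (active \<sigma>)"
  by (simp add: active_def)

lemma active_cong: "nmem \<tau> ''act'' = nmem \<sigma> ''act'' \<Longrightarrow> active \<tau> = active \<sigma>"
  by (simp add: active_def)

lemma bundle_of_cong: "nmem \<tau> ''owner'' = nmem \<sigma> ''owner'' \<Longrightarrow> bundle_of \<tau> = bundle_of \<sigma>"
  by (simp add: bundle_of_def fun_eq_iff)

definition single_state :: "mem \<Rightarrow> nat set \<times> nat set \<times> (nat \<Rightarrow> nat set)" where
  "single_state \<sigma> = (goods \<sigma>, active \<sigma>, bundle_of \<sigma>)"

text \<open>The relations replace the bundle of an agent, while the program enters an owner for
  single goods. Both have the same effect if waiting agents hold nothing and the goods in question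
  have no owner yet.\<close>

definition unassigned :: "mem \<Rightarrow> nat set \<Rightarrow> bool" where
  "unassigned \<sigma> X \<longleftrightarrow> (\<forall>i\<in>active \<sigma>. bundle_of \<sigma> i = {}) \<and> (\<forall>g\<in>X. nmem \<sigma> ''owner'' [g] = 0)"

lemma nupd_irrelevant [simp]:
  "x \<noteq> y \<Longrightarrow> row_set m (nupd x ks a \<sigma>) y ls = row_set m \<sigma> y ls"
  "x \<noteq> ''act'' \<Longrightarrow> active (nupd x ks a \<sigma>) = active \<sigma>"
  "x \<noteq> ''owner'' \<Longrightarrow> bundle_of (nupd x ks a \<sigma>) = bundle_of \<sigma>"
  "x \<notin> {''act'', ''owner''} \<Longrightarrow> unassigned (nupd x ks a \<sigma>) X = unassigned \<sigma> X"
  "x \<notin> {''act'', ''owner'', ''goods''} \<Longrightarrow> single_state (nupd x ks a \<sigma>) = single_state \<sigma>"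
  by (simp_all add: row_set_def active_def bundle_of_def unassigned_def single_state_def fun_eq_iff)

lemma run_init_bundles:
  assumes rd: "ready \<sigma>"
  shows "single_state (R init_bundles \<sigma>) = ({1..m} - mate \<sigma> ` {1..n}, {1..n}, \<lambda>_. {})"
    "unassigned (R init_bundles \<sigma>) (goods (R init_bundles \<sigma>))"
proof -
  let ?a = "For ''g'' ''m'' (SetN ''goods'' [NV ''g''] (NConst 1))"
  let ?b = "For ''g'' ''m'' (SetN ''owner'' [NV ''g''] (NConst 0))"
  let ?c1 = "SetN ''goods'' [NVar ''mate'' [NV ''i'']] (NConst 0)"
  let ?c = "For ''i'' ''n'' ?c1"
  let ?d = "For ''i'' ''n'' (SetN ''act'' [NV ''i''] (NConst 1))"
  define \<sigma>1 where "\<sigma>1 = R ?a \<sigma>"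
  define \<sigma>2 where "\<sigma>2 = R ?b \<sigma>1"
  define \<sigma>3 where "\<sigma>3 = R ?c \<sigma>2"
  define \<sigma>4 where "\<sigma>4 = R ?d \<sigma>3"
  have rd1: "ready \<sigma>1" unfolding \<sigma>1_def using rd by (rule ready_run) simp_all
  have rd2: "ready \<sigma>2" unfolding \<sigma>2_def using rd1 by (rule ready_run) simp_all
  have rd3: "ready \<sigma>3" unfolding \<sigma>3_def using rd2 by (rule ready_run) simp_all
  have R: "R init_bundles \<sigma> = \<sigma>4" by (simp add: init_bundles_def \<sigma>1_def \<sigma>2_def \<sigma>3_def \<sigma>4_def)
  have a: "nmem \<sigma>1 ''goods'' = (\<lambda>ks. if \<exists>g\<in>{1..m}. ks = [] @ [g] then 1 else nmem \<sigma> ''goods'' ks)"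
    unfolding \<sigma>1_def by (rule For_nset) (use readyD[OF rd] in simp_all)
  have b: "nmem \<sigma>2 ''owner'' = (\<lambda>ks. if \<exists>g\<in>{1..m}. ks = [] @ [g] then 0 else nmem \<sigma>1 ''owner'' ks)"
    unfolding \<sigma>2_def by (rule For_nset) (use readyD[OF rd1] in simp_all)
  have s2: "nmem \<sigma>2 ''mate'' = nmem \<sigma> ''mate''" "nmem \<sigma>2 ''goods'' = nmem \<sigma>1 ''goods''"
    by (simp_all add: \<sigma>2_def \<sigma>1_def run_frame del: run.simps)
  let ?I = "\<lambda>k (\<tau>::mem). nmem \<tau> ''goods'' = (\<lambda>ks. if \<exists>i\<in>{1..k}. ks = [mate \<sigma> i] then 0 else nmem \<sigma>2 ''goods'' ks)"
  have c: "?I n \<sigma>3"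
    unfolding \<sigma>3_def
  proof (rule For_induct[where I = ?I])
    fix k \<tau> assume I: "?I k \<tau>" and k: "nmem \<tau> ''i'' [] = Suc k" and fr: "frame ?c \<sigma>2 \<tau>"
    have "nmem \<tau> ''mate'' = nmem \<sigma> ''mate''" using frameD[OF fr] s2 by simp
    then have "nmem (R ?c1 \<tau>) ''goods'' = (nmem \<tau> ''goods'')([mate \<sigma> (Suc k)] := 0)" using k by simp
    moreover have "{1..Suc k} = insert (Suc k) {1..k}" by auto
    ultimately show "?I (Suc k) (R ?c1 \<tau>)" by (subst (asm) I) (simp add: fun_eq_iff)
  qed (use readyD[OF rd2] in simp_all)
  have d: "nmem \<sigma>4 ''act'' = (\<lambda>ks. if \<exists>i\<in>{1..n}. ks = [] @ [i] then 1 else nmem \<sigma>3 ''act'' ks)"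
    unfolding \<sigma>4_def by (rule For_nset) (use readyD[OF rd3] in simp_all)
  have s4: "nmem \<sigma>4 ''goods'' = nmem \<sigma>3 ''goods''" "nmem \<sigma>4 ''owner'' = nmem \<sigma>2 ''owner''"
    by (simp_all add: \<sigma>4_def \<sigma>3_def run_frame del: run.simps)
  have G: "goods \<sigma>4 = {1..m} - mate \<sigma> ` {1..n}"
    unfolding row_set_def s4 c s2 a by (auto simp: image_iff)
  have O: "nmem \<sigma>4 ''owner'' [g] = 0" if "g \<in> {1..m}" for g using that by (simp add: s4 b)
  have B: "bundle_of \<sigma>4 = (\<lambda>_. {})" using O by (auto simp: bundle_of_def fun_eq_iff)
  have A: "active \<sigma>4 = {1..n}" by (auto simp: active_def d)
  show "single_state (R init_bundles \<sigma>) = ({1..m} - mate \<sigma> ` {1..n}, {1..n}, \<lambda>_. {})"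
    unfolding R single_state_def G B A by (rule refl)
  show "unassigned (R init_bundles \<sigma>) (goods (R init_bundles \<sigma>))"
    unfolding R unassigned_def B G using O by blast
qed

lemma run_try_single:
  assumes rd: "ready \<sigma>" and i: "nmem \<sigma> ''i'' [] = i" "i \<in> {1..n}" and g: "nmem \<sigma> ''g'' [] = g" "g \<in> {1..m}"
    and un: "unassigned \<sigma> (goods \<sigma>)"
  defines "\<tau> \<equiv> R try_single \<sigma>"
  shows "unassigned \<tau> (goods \<tau>)"
    "if i \<in> active \<sigma> \<and> g \<in> goods \<sigma> \<and> share i (goods \<sigma>) \<le> v i {g}
     then single_good_step n v (single_state \<sigma>) (single_state \<tau>) \<and> card (active \<tau>) < card (active \<sigma>)
     else single_state \<tau> = single_state \<sigma>"
proof -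
  define \<sigma>1 where "\<sigma>1 = R (Ask ''val'' [] (NV ''i'') ''goods'' []) \<sigma>"
  let ?set = "SetN ''owner'' [NV ''g''] (NV ''i'') ;; SetN ''act'' [NV ''i''] (NConst 0) ;;
     SetN ''goods'' [NV ''g''] (NConst 0)"
  have n1: "nmem \<sigma>1 = nmem \<sigma>" and val: "rmem \<sigma>1 ''val'' [] = v i (goods \<sigma>)" using i by (simp_all add: \<sigma>1_def)
  have rd1: "ready \<sigma>1" unfolding \<sigma>1_def using rd by (rule ready_run) simp_all
  have sg: "rmem \<sigma>1 ''single'' [i, g] = v i {g}" using readyD(3)[OF rd1 i(2) g(2)] .
  have st1: "single_state \<sigma>1 = single_state \<sigma>"
    using n1 by (simp add: single_state_def row_set_def active_def bundle_of_def fun_eq_iff)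
  let ?en = "i \<in> active \<sigma> \<and> g \<in> goods \<sigma> \<and> share i (goods \<sigma>) \<le> v i {g}"
  have \<tau>: "\<tau> = (if ?en then R ?set \<sigma>1 else \<sigma>1)"
    unfolding \<tau>_def try_single_def
    using i g readyD(1)[OF rd] n1 val sg
    by (auto simp: \<sigma>1_def[symmetric] share_def active_def row_set_def not_less simp del: run.simps(4))
  have "unassigned \<tau> (goods \<tau>) \<and> (if ?en
     then single_good_step n v (single_state \<sigma>) (single_state \<tau>) \<and> card (active \<tau>) < card (active \<sigma>)
     else single_state \<tau> = single_state \<sigma>)"
  proof (cases ?en)
    case False
    then have "\<tau> = \<sigma>1" using \<tau> by auto
    then show ?thesis using False un st1 n1 by (auto simp: unassigned_def single_state_def)
  next
    case True
    then have \<tau>: "\<tau> = R ?set \<sigma>1" using \<tau> by auto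
    have ow: "nmem \<tau> ''owner'' = (nmem \<sigma> ''owner'')([g] := i)"
      and ac: "nmem \<tau> ''act'' = (nmem \<sigma> ''act'')([i] := 0)"
      and go: "nmem \<tau> ''goods'' = (nmem \<sigma> ''goods'')([g] := 0)"
      unfolding \<tau> using n1 i g by simp_all
    have A: "active \<tau> = active \<sigma> - {i}" unfolding active_def ac by auto
    have G: "goods \<tau> = goods \<sigma> - {g}" unfolding row_set_def go by auto
    have o: "nmem \<sigma> ''owner'' [g] = 0" "bundle_of \<sigma> i = {}" using un True unfolding unassigned_def by blast+
    have B: "bundle_of \<tau> = (bundle_of \<sigma>)(i := {g})"
    proof
      fix j
      have "bundle_of \<tau> j = (if j = i then insert g (bundle_of \<sigma> i) else bundle_of \<sigma> j)"
        using i(2) g(2) o(1) unfolding bundle_of_def ow by auto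
      then show "bundle_of \<tau> j = ((bundle_of \<sigma>)(i := {g})) j" using o(2) by simp
    qed
    have "single_good_step n v (single_state \<sigma>) (single_state \<tau>)"
      unfolding single_state_def A G B
      by (rule single_good_step.intros) (use True in \<open>auto simp: share_def\<close>)
    moreover have "card (active \<tau>) < card (active \<sigma>)"
      unfolding A using True finite_active by (intro card_Diff1_less) auto
    moreover have "unassigned \<tau> (goods \<tau>)"
      using un unfolding unassigned_def A G B ow by simp
    ultimately show ?thesis using True by simp
  qed
  then show "unassigned \<tau> (goods \<tau>)" "if ?en
     then single_good_step n v (single_state \<sigma>) (single_state \<tau>) \<and> card (active \<tau>) < card (active \<sigma>)
     else single_state \<tau> = single_state \<sigma>" by blast+
qed

text \<open>As long as a pass has assigned nothing, all its pairs are tested against one and the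
  same state; a pass without assignment hence shows that this state is final. \<open>V\<close> in
  \<open>PI\<close> collects the pairs tested so far.\<close>

lemma run_single_pass:
  fixes \<sigma> :: mem
  assumes rd: "ready \<sigma>" and un: "unassigned \<sigma> (goods \<sigma>)"
  defines "\<tau> \<equiv> R (For ''i'' ''n'' (For ''g'' ''m'' try_single)) \<sigma>"
  shows "unassigned \<tau> (goods \<tau>)" "(single_good_step n v)\<^sup>*\<^sup>* (single_state \<sigma>) (single_state \<tau>)"
    "card (active \<tau>) < card (active \<sigma>) \<or> (\<nexists>s'. single_good_step n v (single_state \<tau>) s')"
proof -
  let ?inner = "For ''g'' ''m'' try_single"
  let ?en = "\<lambda>(i, g). i \<in> active \<sigma> \<and> g \<in> goods \<sigma> \<and> share i (goods \<sigma>) \<le> v i {g}"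
  define PI where "PI = (\<lambda>V (\<tau>::mem). unassigned \<tau> (goods \<tau>) \<and>
     (single_good_step n v)\<^sup>*\<^sup>* (single_state \<sigma>) (single_state \<tau>) \<and>
     (card (active \<tau>) < card (active \<sigma>) \<or> (single_state \<tau> = single_state \<sigma> \<and> (\<forall>e\<in>V. \<not> ?en e))))"
  have ins: "PI V (nupd ''i'' [] a \<tau>) = PI V \<tau>" "PI V (nupd ''g'' [] a \<tau>) = PI V \<tau>" for V a \<tau>
    by (simp_all add: PI_def)
  let ?I = "\<lambda>k (\<tau>::mem). PI ({1..k} \<times> {1..m}) \<tau>"
  have "?I n \<tau>"
    unfolding \<tau>_def
  proof (rule For_induct[where I = ?I])
    fix k \<tau> assume I: "?I k \<tau>" and k: "k < n" "nmem \<tau> ''i'' [] = Suc k"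
      and fr: "frame (For ''i'' ''n'' ?inner) \<sigma> \<tau>"
    have rdt: "ready \<tau>" using rd fr by (rule ready_frame) (simp_all add: try_single_def)
    let ?J = "\<lambda>j (\<tau>'::mem). PI ({1..k} \<times> {1..m} \<union> {Suc k} \<times> {1..j}) \<tau>'"
    have "?J m (R ?inner \<tau>)"
    proof (rule For_induct[where I = ?J])
      fix j \<tau>' assume J: "?J j \<tau>'" and j: "j < m" "nmem \<tau>' ''g'' [] = Suc j" and fr': "frame ?inner \<tau> \<tau>'"
      have rdt': "ready \<tau>'" using rdt fr' by (rule ready_frame) (simp_all add: try_single_def)
      have i': "nmem \<tau>' ''i'' [] = Suc k" using frameD[OF fr'] k by (simp add: try_single_def)
      define V where "V = {1..k} \<times> {1..m} \<union> {Suc k} \<times> {1..j}"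
      have V: "{1..k} \<times> {1..m} \<union> {Suc k} \<times> {1..Suc j} = insert (Suc k, Suc j) V"
        unfolding V_def by auto
      have J': "PI V \<tau>'" using J unfolding V_def .
      have rng: "Suc k \<in> {1..n}" "Suc j \<in> {1..m}" using k j by auto
      have un': "unassigned \<tau>' (goods \<tau>')" using J' unfolding PI_def by blast
      note ts = run_try_single[OF rdt' i' rng(1) j(2) rng(2) un']
      show "?J (Suc j) (R try_single \<tau>')"
        unfolding V
      proof (cases "Suc k \<in> active \<tau>' \<and> Suc j \<in> goods \<tau>' \<and> share (Suc k) (goods \<tau>') \<le> v (Suc k) {Suc j}")
        case True
        then have st: "single_good_step n v (single_state \<tau>') (single_state (R try_single \<tau>'))"
          "card (active (R try_single \<tau>')) < card (active \<tau>')" using ts(2) by simp_all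
        have "card (active \<tau>') \<le> card (active \<sigma>)" using J' unfolding PI_def single_state_def by auto
        then show "PI (insert (Suc k, Suc j) V) (R try_single \<tau>')"
          using J' st ts(1) unfolding PI_def by (auto intro: rtranclp.rtrancl_into_rtrancl)
      next
        case False
        then have st: "single_state (R try_single \<tau>') = single_state \<tau>'" using ts(2) by auto
        then have A: "active (R try_single \<tau>') = active \<tau>'" by (simp add: single_state_def)
        have "\<not> ?en (Suc k, Suc j)" if "single_state \<tau>' = single_state \<sigma>"
          using False that by (simp add: single_state_def)
        then show "PI (insert (Suc k, Suc j) V) (R try_single \<tau>')"
          using J' ts(1) unfolding PI_def st A by blast
      qed
    qed (use I readyD[OF rdt] in \<open>simp_all add: ins try_single_def\<close>)
    moreover have "{1..k} \<times> {1..m} \<union> {Suc k} \<times> {1..m} = {1..Suc k} \<times> {1..m}" by auto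
    ultimately show "?I (Suc k) (R ?inner \<tau>)" by simp
  qed (use readyD[OF rd] un in \<open>simp_all add: ins try_single_def\<close>, simp add: PI_def)
  then have fin: "unassigned \<tau> (goods \<tau>)" "(single_good_step n v)\<^sup>*\<^sup>* (single_state \<sigma>) (single_state \<tau>)"
    "card (active \<tau>) < card (active \<sigma>) \<or>
       (single_state \<tau> = single_state \<sigma> \<and> (\<forall>e\<in>{1..n} \<times> {1..m}. \<not> ?en e))" unfolding PI_def by blast+
  show "unassigned \<tau> (goods \<tau>)" "(single_good_step n v)\<^sup>*\<^sup>* (single_state \<sigma>) (single_state \<tau>)"
    by (fact fin)+
  have "\<nexists>s'. single_good_step n v (single_state \<sigma>) s'" if "\<forall>e\<in>{1..n} \<times> {1..m}. \<not> ?en e"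
    unfolding single_state_def single_final
  proof (intro ballI)
    fix i g assume ig: "i \<in> active \<sigma>" "g \<in> goods \<sigma>"
    then have "(i, g) \<in> {1..n} \<times> {1..m}" by (simp add: active_def row_set_def)
    then show "v i {g} < share i (goods \<sigma>)" using that ig by force
  qed
  then show "card (active \<tau>) < card (active \<sigma>) \<or> (\<nexists>s'. single_good_step n v (single_state \<tau>) s')"
    using fin(3) by auto
qed

lemma run_singles:
  assumes rd: "ready \<sigma>"
  defines "\<tau> \<equiv> R singles \<sigma>"
  shows "loop_result (single_good_step n v) ({1..m} - mate \<sigma> ` {1..n}, {1..n}, \<lambda>_. {}) (single_state \<tau>)"
    "unassigned \<tau> (goods \<tau>)"
proof -
  let ?pass = "For ''i'' ''n'' (For ''g'' ''m'' try_single)"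
  define \<sigma>1 where "\<sigma>1 = R init_bundles \<sigma>"
  have rd1: "ready \<sigma>1" unfolding \<sigma>1_def using rd by (rule ready_run) (simp_all add: init_bundles_def)
  note init = run_init_bundles[OF rd, folded \<sigma>1_def]
  let ?I = "\<lambda>k (\<tau>::mem). unassigned \<tau> (goods \<tau>) \<and> (single_good_step n v)\<^sup>*\<^sup>* (single_state \<sigma>1) (single_state \<tau>) \<and>
     (card (active \<tau>) + k \<le> n \<or> (\<nexists>s'. single_good_step n v (single_state \<tau>) s'))"
  have \<tau>: "\<tau> = R (For ''k'' ''n'' ?pass) \<sigma>1" by (simp add: \<tau>_def singles_def \<sigma>1_def)
  have "?I n \<tau>"
    unfolding \<tau>
  proof (rule For_induct[where I = ?I])
    fix k \<tau> assume I: "?I k \<tau>" and k: "k < n" and fr: "frame (For ''k'' ''n'' ?pass) \<sigma>1 \<tau>"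
    have rdt: "ready \<tau>" using rd1 fr by (rule ready_frame) (simp_all add: try_single_def)
    note sp = run_single_pass[OF rdt I[THEN conjunct1]]
    have "card (active (R ?pass \<tau>)) + Suc k \<le> n \<or> (\<nexists>s'. single_good_step n v (single_state (R ?pass \<tau>)) s')"
    proof (cases "\<nexists>s'. single_good_step n v (single_state \<tau>) s'")
      case True
      then have "single_state (R ?pass \<tau>) = single_state \<tau>" using sp(2) by (metis converse_rtranclpE)
      then show ?thesis using True by simp
    next
      case False
      then show ?thesis using I sp(3) by auto
    qed
    then show "?I (Suc k) (R ?pass \<tau>)" using I sp(1,2) by (auto intro: rtranclp_trans)
  next
    have "card (active \<sigma>1) \<le> card {1..n}" by (rule card_mono) (auto simp: active_def)
    then show "?I 0 \<sigma>1" using init by simp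
  qed (use readyD[OF rd1] in \<open>simp_all add: try_single_def\<close>)
  moreover have "\<nexists>s'. single_good_step n v (single_state \<tau>) s'" if "card (active \<tau>) + n \<le> n"
  proof -
    have "active \<tau> = {}" using that finite_active by simp
    then show ?thesis unfolding single_state_def single_final by simp
  qed
  ultimately have "unassigned \<tau> (goods \<tau>) \<and> loop_result (single_good_step n v) (single_state \<sigma>1) (single_state \<tau>)"
    unfolding loop_result_def by blast
  then show "loop_result (single_good_step n v) ({1..m} - mate \<sigma> ` {1..n}, {1..n}, \<lambda>_. {}) (single_state \<tau>)"
    "unassigned \<tau> (goods \<tau>)" unfolding init by blast+
qed

section \<open>Correctness of the moving knife\<close>

lemma run_find_active:
  assumes rd: "ready \<sigma>" and x: "x \<noteq> ''i''" "x \<noteq> ''act''" "x \<noteq> ''n''" "x \<noteq> ''m''"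
  shows "nmem (R (find_active x) \<sigma>) x [] = (if active \<sigma> = {} then 0 else Max (active \<sigma>))"
proof -
  let ?p = "When (NZ (NVar ''act'' [NV ''i''])) (SetV x (NV ''i''))"
  define \<sigma>1 where "\<sigma>1 = R (SetV x (NConst 0)) \<sigma>"
  have rd1: "ready \<sigma>1" unfolding \<sigma>1_def using rd by (rule ready_run) (use x in simp_all)
  have s1: "nmem \<sigma>1 ''act'' = nmem \<sigma> ''act''" using x by (simp add: \<sigma>1_def)
  let ?A = "active \<sigma>"
  let ?I = "\<lambda>k (\<tau>::mem). (nmem \<tau> x [] = 0 \<and> ?A \<inter> {1..k} = {}) \<or>
      (nmem \<tau> x [] \<in> ?A \<and> (\<forall>i\<in>?A \<inter> {1..k}. i \<le> nmem \<tau> x []) \<and> nmem \<tau> x [] \<le> k)"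
  have "?I n (R (For ''i'' ''n'' ?p) \<sigma>1)"
  proof (rule For_induct[where I = ?I])
    fix k \<tau> assume I: "?I k \<tau>" and k: "k < n" "nmem \<tau> ''i'' [] = Suc k"
      and fr: "frame (For ''i'' ''n'' ?p) \<sigma>1 \<tau>"
    have t: "nmem \<tau> ''act'' = nmem \<sigma> ''act''" using frameD[OF fr] s1 x by simp
    have ins: "{1..Suc k} = insert (Suc k) {1..k}" by auto
    show "?I (Suc k) (R ?p \<tau>)"
    proof (cases "Suc k \<in> ?A")
      case True
      then have "nmem (R ?p \<tau>) x [] = Suc k" using t k by (simp add: active_def)
      then show ?thesis using True by auto
    next
      case False
      then have e: "R ?p \<tau> = \<tau>" using t k by (auto simp: active_def)
      have i: "?A \<inter> {1..Suc k} = ?A \<inter> {1..k}" using False unfolding ins by blast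
      show ?thesis using I unfolding e i by auto
    qed
  qed (use readyD[OF rd1] x in \<open>simp_all add: \<sigma>1_def\<close>)
  moreover have "R (For ''i'' ''n'' ?p) \<sigma>1 = R (find_active x) \<sigma>" by (simp add: find_active_def \<sigma>1_def)
  moreover have "?A \<inter> {1..n} = ?A" by (auto simp: active_def)
  ultimately have "(nmem (R (find_active x) \<sigma>) x [] = 0 \<and> ?A = {}) \<or>
      (nmem (R (find_active x) \<sigma>) x [] \<in> ?A \<and> (\<forall>i\<in>?A. i \<le> nmem (R (find_active x) \<sigma>) x []))"
    by metis
  then show ?thesis using finite_active by (auto intro!: Max_eqI[symmetric])
qed

lemma Max_active:
  assumes "active \<sigma> \<noteq> {}"
  shows "Max (active \<sigma>) \<in> {1..n}" "Max (active \<sigma>) \<noteq> 0"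
  using Max_in[OF finite_active assms] by (simp_all add: active_def)

lemma run_init_knife:
  assumes rd: "ready \<sigma>"
  defines "\<tau> \<equiv> R init_knife \<sigma>"
  shows "i \<in> {1..n} \<Longrightarrow> rmem \<tau> ''full'' [i] = v i (goods \<sigma>)" "piece \<tau> = {}" "left \<tau> = goods \<sigma>"
    "nmem \<tau> ''last'' [] = (if active \<sigma> = {} then 1 else Max (active \<sigma>))"
proof -
  let ?a1 = "Ask ''full'' [NV ''i''] (NV ''i'') ''goods'' []"
  let ?a = "For ''i'' ''n'' ?a1"
  let ?b = "For ''g'' ''m'' (SetN ''piece'' [NV ''g''] (NConst 0))"
  let ?c1 = "SetN ''left'' [NV ''g''] (NVar ''goods'' [NV ''g''])"
  let ?c = "For ''g'' ''m'' ?c1"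
  let ?e = "When (NEq (NV ''last'') (NConst 0)) (SetV ''last'' (NConst 1))"
  define \<sigma>1 where "\<sigma>1 = R ?a \<sigma>"
  define \<sigma>2 where "\<sigma>2 = R ?b \<sigma>1"
  define \<sigma>3 where "\<sigma>3 = R ?c \<sigma>2"
  define \<sigma>4 where "\<sigma>4 = R (find_active ''last'') \<sigma>3"
  have \<tau>: "\<tau> = R ?e \<sigma>4" by (simp add: \<tau>_def init_knife_def \<sigma>1_def \<sigma>2_def \<sigma>3_def \<sigma>4_def)
  have rd1: "ready \<sigma>1" unfolding \<sigma>1_def using rd by (rule ready_run) simp_all
  have rd2: "ready \<sigma>2" unfolding \<sigma>2_def using rd1 by (rule ready_run) simp_all
  have rd3: "ready \<sigma>3" unfolding \<sigma>3_def using rd2 by (rule ready_run) simp_all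
  have a: "rmem \<sigma>1 ''full'' = (\<lambda>ks. if \<exists>i\<in>{1..n}. ks = [] @ [i] then v (last ks) (goods \<sigma>) else rmem \<sigma> ''full'' ks)"
    unfolding \<sigma>1_def
  proof (rule For_rset)
    fix k \<tau> assume "nmem \<tau> ''i'' [] = k" and fr: "frame ?a \<sigma> \<tau>"
    then show "rmem (R ?a1 \<tau>) ''full'' = (rmem \<tau> ''full'')([] @ [k] := v k (goods \<sigma>))"
      using row_set_cong[OF frameD(1)[OF fr], of "''goods''" m "[]"] by simp
  qed (use readyD[OF rd] in simp_all)
  have b: "nmem \<sigma>2 ''piece'' = (\<lambda>ks. if \<exists>g\<in>{1..m}. ks = [] @ [g] then 0 else nmem \<sigma>1 ''piece'' ks)"
    unfolding \<sigma>2_def by (rule For_nset) (use readyD[OF rd1] in simp_all)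
  have c: "nmem \<sigma>3 ''left'' = (\<lambda>ks. if \<exists>g\<in>{1..m}. ks = [] @ [g] then nmem \<sigma>2 ''goods'' [last ks] else nmem \<sigma>2 ''left'' ks)"
    unfolding \<sigma>3_def
  proof (rule For_nset)
    fix k \<tau> assume "nmem \<tau> ''g'' [] = k" "frame ?c \<sigma>2 \<tau>"
    then show "nmem (R ?c1 \<tau>) ''left'' = (nmem \<tau> ''left'')([] @ [k] := nmem \<sigma>2 ''goods'' [k])"
      using frameD[of ?c \<sigma>2 \<tau>] by simp
  qed (use readyD[OF rd2] in simp_all)
  have fr: "rmem \<sigma>4 ''full'' = rmem \<sigma>1 ''full''" "nmem \<sigma>4 ''piece'' = nmem \<sigma>2 ''piece''"
    "nmem \<sigma>4 ''left'' = nmem \<sigma>3 ''left''" "nmem \<sigma>3 ''act'' = nmem \<sigma> ''act''" "nmem \<sigma>2 ''goods'' = nmem \<sigma> ''goods''"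
    by (simp_all add: \<sigma>4_def \<sigma>3_def \<sigma>2_def \<sigma>1_def find_active_def run_frame del: run.simps)
  show "i \<in> {1..n} \<Longrightarrow> rmem \<tau> ''full'' [i] = v i (goods \<sigma>)" unfolding \<tau> using a fr by simp
  show "piece \<tau> = {}" unfolding \<tau> row_set_def using b fr by simp
  show "left \<tau> = goods \<sigma>" unfolding \<tau> row_set_def using c fr by auto
  have "nmem \<sigma>4 ''last'' [] = (if active \<sigma> = {} then 0 else Max (active \<sigma>))"
    unfolding \<sigma>4_def using run_find_active[OF rd3, of "''last''"] active_cong[OF fr(4)] by simp
  then show "nmem \<tau> ''last'' [] = (if active \<sigma> = {} then 1 else Max (active \<sigma>))"
    unfolding \<tau> using Max_active(2) by (cases "active \<sigma> = {}") simp_all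
qed

lemma run_find_claim:
  assumes rd: "ready \<sigma>" and full: "\<forall>i\<in>{1..n}. rmem \<sigma> ''full'' [i] = v i G"
  defines "a \<equiv> nmem (R find_claim \<sigma>) ''claim'' []"
  shows "(a = 0 \<and> (\<forall>i\<in>active \<sigma>. v i (piece \<sigma>) < share i G)) \<or> (a \<in> active \<sigma> \<and> share a G \<le> v a (piece \<sigma>))"
proof -
  let ?ask = "Ask ''val'' [] (NV ''i'') ''piece'' []"
  let ?w = "When (BAnd (NZ (NVar ''act'' [NV ''i'']))
        (BNot (RLess (RV ''val'') (RMul share_exp (RVar ''full'' [NV ''i'']))))) (SetV ''claim'' (NV ''i''))"
  let ?p = "?ask ;; ?w"
  define \<sigma>1 where "\<sigma>1 = R (SetV ''claim'' (NConst 0)) \<sigma>"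
  have rd1: "ready \<sigma>1" unfolding \<sigma>1_def using rd by (rule ready_run) simp_all
  have s1: "nmem \<sigma>1 ''act'' = nmem \<sigma> ''act''" "nmem \<sigma>1 ''piece'' = nmem \<sigma> ''piece''"
    "rmem \<sigma>1 ''full'' = rmem \<sigma> ''full''" by (simp_all add: \<sigma>1_def)
  let ?ok = "\<lambda>i. i \<in> active \<sigma> \<and> share i G \<le> v i (piece \<sigma>)"
  let ?I = "\<lambda>k (\<tau>::mem). (nmem \<tau> ''claim'' [] = 0 \<and> (\<forall>i\<in>{1..k}. \<not> ?ok i)) \<or> ?ok (nmem \<tau> ''claim'' [])"
  have "?I n (R (For ''i'' ''n'' ?p) \<sigma>1)"
  proof (rule For_induct[where I = ?I])
    fix k \<tau> assume I: "?I k \<tau>" and k: "k < n" "nmem \<tau> ''i'' [] = Suc k"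
      and fr: "frame (For ''i'' ''n'' ?p) \<sigma>1 \<tau>"
    have rdt: "ready \<tau>" using rd1 fr by (rule ready_frame) simp_all
    have t: "nmem \<tau> ''act'' = nmem \<sigma> ''act''" "rmem \<tau> ''full'' = rmem \<sigma> ''full''" "nmem \<tau> ''piece'' = nmem \<sigma> ''piece''"
      using frameD[OF fr] s1 by simp_all
    have piece: "piece \<tau> = piece \<sigma>" using t(3) by (rule row_set_cong)
    have kn: "Suc k \<in> {1..n}" using k by simp
    define \<tau>1 where "\<tau>1 = R ?ask \<tau>"
    have \<tau>1: "nmem \<tau>1 = nmem \<tau>" "rmem \<tau>1 ''val'' [] = v (Suc k) (piece \<sigma>)" "rmem \<tau>1 ''full'' [Suc k] = v (Suc k) G"
      using k piece bspec[OF full kn] t by (simp_all add: \<tau>1_def)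
    have ins: "{1..Suc k} = insert (Suc k) {1..k}" by auto
    have claim: "nmem (R ?p \<tau>) ''claim'' [] = (if ?ok (Suc k) then Suc k else nmem \<tau> ''claim'' [])"
    proof -
      have "bval \<tau>1 (BAnd (NZ (NVar ''act'' [NV ''i'']))
        (BNot (RLess (RV ''val'') (RMul share_exp (RVar ''full'' [NV ''i'']))))) \<longleftrightarrow> ?ok (Suc k)"
        using \<tau>1 t k kn readyD(1)[OF rdt] by (simp add: active_def share_def not_less)
      then have "nmem (R ?w \<tau>1) ''claim'' [] = (if ?ok (Suc k) then Suc k else nmem \<tau>1 ''claim'' [])"
        using k \<tau>1 by (simp del: bval.simps)
      then show ?thesis using \<tau>1(1) unfolding \<tau>1_def by simp
    qed
    show "?I (Suc k) (R ?p \<tau>)" using I unfolding claim ins by auto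
  qed (use readyD[OF rd1] in \<open>simp_all add: \<sigma>1_def\<close>)
  moreover have "R (For ''i'' ''n'' ?p) \<sigma>1 = R find_claim \<sigma>" by (simp add: find_claim_def \<sigma>1_def)
  moreover have "i \<in> {1..n}" if "i \<in> active \<sigma>" for i using that by (simp add: active_def)
  ultimately show ?thesis unfolding a_def by (metis not_less)
qed

lemma run_give_piece:
  assumes rd: "ready \<sigma>" and a: "nmem \<sigma> ''claim'' [] = a" "a \<in> {1..n}"
    and free: "\<forall>g\<in>piece \<sigma>. nmem \<sigma> ''owner'' [g] = 0"
  defines "\<tau> \<equiv> R give_piece \<sigma>"
  shows "active \<tau> = active \<sigma> - {a}" "piece \<tau> = {}"
    "bundle_of \<tau> = (bundle_of \<sigma>)(a := bundle_of \<sigma> a \<union> piece \<sigma>)"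
    "g \<notin> piece \<sigma> \<Longrightarrow> g \<in> {1..m} \<Longrightarrow> nmem \<tau> ''owner'' [g] = nmem \<sigma> ''owner'' [g]"
proof -
  let ?b1 = "When (NZ (NVar ''piece'' [NV ''h''])) (SetN ''owner'' [NV ''h''] (NV ''claim''))"
  let ?b = "For ''h'' ''m'' ?b1"
  let ?c = "For ''h'' ''m'' (SetN ''piece'' [NV ''h''] (NConst 0))"
  define \<sigma>1 where "\<sigma>1 = R (SetN ''act'' [NV ''claim''] (NConst 0)) \<sigma>"
  define \<sigma>2 where "\<sigma>2 = R ?b \<sigma>1"
  have \<tau>: "\<tau> = R ?c \<sigma>2" by (simp add: \<tau>_def give_piece_def \<sigma>1_def \<sigma>2_def)
  have rd1: "ready \<sigma>1" unfolding \<sigma>1_def using rd by (rule ready_run) simp_all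
  have rd2: "ready \<sigma>2" unfolding \<sigma>2_def using rd1 by (rule ready_run) simp_all
  have s1: "nmem \<sigma>1 ''act'' = (nmem \<sigma> ''act'')([a] := 0)" "nmem \<sigma>1 ''owner'' = nmem \<sigma> ''owner''"
    "nmem \<sigma>1 ''piece'' = nmem \<sigma> ''piece''" "nmem \<sigma>1 ''claim'' [] = a" using a by (simp_all add: \<sigma>1_def)
  have b: "nmem \<sigma>2 ''owner'' = (\<lambda>ks. if \<exists>g\<in>{1..m}. ks = [] @ [g]
      then (if nmem \<sigma> ''piece'' [last ks] \<noteq> 0 then a else nmem \<sigma> ''owner'' [last ks]) else nmem \<sigma>1 ''owner'' ks)"
    unfolding \<sigma>2_def
  proof (rule For_nset)
    fix k \<tau> assume k: "nmem \<tau> ''h'' [] = k" and fr: "frame ?b \<sigma>1 \<tau>"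
      and old: "nmem \<tau> ''owner'' ([] @ [k]) = nmem \<sigma>1 ''owner'' ([] @ [k])"
    have "nmem \<tau> ''piece'' = nmem \<sigma> ''piece''" "nmem \<tau> ''claim'' [] = a"
      using frameD[OF fr] s1 by simp_all
    then show "nmem (R ?b1 \<tau>) ''owner'' = (nmem \<tau> ''owner'')([] @ [k] :=
        (if nmem \<sigma> ''piece'' [k] \<noteq> 0 then a else nmem \<sigma> ''owner'' [k]))"
      using k old s1 by auto
  qed (use readyD[OF rd1] in simp_all)
  have c: "nmem \<tau> ''piece'' = (\<lambda>ks. if \<exists>g\<in>{1..m}. ks = [] @ [g] then 0 else nmem \<sigma>2 ''piece'' ks)"
    unfolding \<tau> by (rule For_nset) (use readyD[OF rd2] in simp_all)
  have fr: "nmem \<tau> ''owner'' = nmem \<sigma>2 ''owner''" "nmem \<tau> ''act'' = nmem \<sigma>1 ''act''"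
    by (simp_all add: \<tau> \<sigma>2_def run_frame del: run.simps)
  show "active \<tau> = active \<sigma> - {a}" unfolding active_def fr s1 by auto
  show "piece \<tau> = {}" unfolding row_set_def c by simp
  have ow: "nmem \<tau> ''owner'' [g] = (if g \<in> piece \<sigma> then a else nmem \<sigma> ''owner'' [g])" if "g \<in> {1..m}" for g
    using that unfolding fr b by (simp add: row_set_def)
  then show "g \<notin> piece \<sigma> \<Longrightarrow> g \<in> {1..m} \<Longrightarrow> nmem \<tau> ''owner'' [g] = nmem \<sigma> ''owner'' [g]" by simp
  have pm: "piece \<sigma> \<subseteq> {1..m}" by (auto simp: row_set_def)
  show "bundle_of \<tau> = (bundle_of \<sigma>)(a := bundle_of \<sigma> a \<union> piece \<sigma>)"
  proof
    fix i
    show "bundle_of \<tau> i = ((bundle_of \<sigma>)(a := bundle_of \<sigma> a \<union> piece \<sigma>)) i"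
      using ow pm a(2) free by (cases "i = a") (auto simp: bundle_of_def)
  qed
qed

text \<open>The array \<open>owner\<close> also holds the goods handed out singly, whereas the
  subroutine starts with empty bundles; hence the restriction to the agents \<open>A\<close> of the
  call.\<close>

definition knife_state :: "nat set \<Rightarrow> mem \<Rightarrow> nat set \<times> nat set \<times> nat set \<times> (nat \<Rightarrow> nat set)" where
  "knife_state A \<sigma> = (piece \<sigma>, left \<sigma>, active \<sigma>, \<lambda>i. if i \<in> A then bundle_of \<sigma> i else {})"

text \<open>A pass performs one knife step on the good \<open>g\<close>, or none if \<open>g\<close>
  is gone or nobody is active. The claim that \<open>g\<close> has left or that nobody is active
  afterwards is what makes the state after all passes final.\<close>

lemma run_cut_good:
  assumes rd: "ready \<sigma>" and full: "\<forall>i\<in>{1..n}. rmem \<sigma> ''full'' [i] = v i G"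
    and g: "nmem \<sigma> ''g'' [] = g" "g \<in> {1..m}"
    and un: "unassigned \<sigma> (piece \<sigma> \<union> left \<sigma>)" and dj: "piece \<sigma> \<inter> left \<sigma> = {}" and A: "active \<sigma> \<subseteq> A"
  defines "\<tau> \<equiv> R cut_good \<sigma>"
  shows "unassigned \<tau> (piece \<tau> \<union> left \<tau>) \<and> piece \<tau> \<inter> left \<tau> = {} \<and> active \<tau> \<subseteq> A \<and> (\<forall>i. i \<notin> A \<longrightarrow> bundle_of \<tau> i = bundle_of \<sigma> i) \<and>
    left \<tau> \<subseteq> left \<sigma> \<and> active \<tau> \<subseteq> active \<sigma> \<and> (g \<notin> left \<tau> \<or> active \<tau> = {}) \<and>
    (knife_step n v G)\<^sup>*\<^sup>* (knife_state A \<sigma>) (knife_state A \<tau>)"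
proof -
  define \<sigma>1 where "\<sigma>1 = R (find_active ''own'') \<sigma>"
  have fr1: "nmem \<sigma>1 ''act'' = nmem \<sigma> ''act''" "nmem \<sigma>1 ''owner'' = nmem \<sigma> ''owner''"
    "nmem \<sigma>1 ''piece'' = nmem \<sigma> ''piece''" "nmem \<sigma>1 ''left'' = nmem \<sigma> ''left''" "nmem \<sigma>1 ''g'' = nmem \<sigma> ''g''"
    "rmem \<sigma>1 ''full'' = rmem \<sigma> ''full''"
    by (simp_all add: \<sigma>1_def find_active_def run_frame del: run.simps)
  have rd1: "ready \<sigma>1" unfolding \<sigma>1_def using rd by (rule ready_run) (simp_all add: find_active_def)
  have own: "nmem \<sigma>1 ''own'' [] \<noteq> 0 \<longleftrightarrow> active \<sigma> \<noteq> {}"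
    unfolding \<sigma>1_def using run_find_active[OF rd, of "''own''"] Max_active(2)
    by (cases "active \<sigma> = {}") simp_all
  have abs1: "active \<sigma>1 = active \<sigma>" "bundle_of \<sigma>1 = bundle_of \<sigma>" "piece \<sigma>1 = piece \<sigma>" "left \<sigma>1 = left \<sigma>"
    using active_cong[OF fr1(1)] bundle_of_cong[OF fr1(2)] row_set_cong[OF fr1(3)] row_set_cong[OF fr1(4)] by simp_all
  have st1: "knife_state A \<sigma>1 = knife_state A \<sigma>" unfolding knife_state_def abs1 by (rule refl)
  have un1: "unassigned \<sigma>1 X = unassigned \<sigma> X" for X unfolding unassigned_def abs1 fr1 by (rule refl)
  let ?set = "SetN ''piece'' [NV ''g''] (NConst 1) ;; SetN ''left'' [NV ''g''] (NConst 0)"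
  let ?fin = "When (NZ (NV ''claim'')) give_piece"
  have gl: "nmem \<sigma>1 ''left'' [g] \<noteq> 0 \<longleftrightarrow> g \<in> left \<sigma>" using g(2) fr1 by (simp add: row_set_def)
  show ?thesis
  proof (cases "g \<in> left \<sigma> \<and> active \<sigma> \<noteq> {}")
    case False
    then have "\<tau> = \<sigma>1" unfolding \<tau>_def cut_good_def using gl own g fr1 by (auto simp: \<sigma>1_def[symmetric])
    then show ?thesis using False st1 un dj A by (auto simp: abs1 un1)
  next
    case True
    define \<sigma>2 where "\<sigma>2 = R ?set \<sigma>1"
    define \<sigma>3 where "\<sigma>3 = R find_claim \<sigma>2"
    have \<tau>: "\<tau> = R ?fin \<sigma>3"
      unfolding \<tau>_def cut_good_def using True gl own g fr1 by (simp add: \<sigma>1_def[symmetric] \<sigma>2_def \<sigma>3_def)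
    have rd2: "ready \<sigma>2" unfolding \<sigma>2_def using rd1 by (rule ready_run) simp_all
    have rd3: "ready \<sigma>3" unfolding \<sigma>3_def using rd2 by (rule ready_run) (simp_all add: find_claim_def)
    have s2: "nmem \<sigma>2 ''act'' = nmem \<sigma> ''act''" "nmem \<sigma>2 ''owner'' = nmem \<sigma> ''owner''"
      "nmem \<sigma>2 ''piece'' = (nmem \<sigma> ''piece'')([g] := 1)" "nmem \<sigma>2 ''left'' = (nmem \<sigma> ''left'')([g] := 0)"
      "rmem \<sigma>2 ''full'' = rmem \<sigma> ''full''"
      using g fr1 by (simp_all add: \<sigma>2_def)
    have abs2: "active \<sigma>2 = active \<sigma>" "bundle_of \<sigma>2 = bundle_of \<sigma>" "piece \<sigma>2 = insert g (piece \<sigma>)" "left \<sigma>2 = left \<sigma> - {g}"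
      using active_cong[OF s2(1)] bundle_of_cong[OF s2(2)] g(2) unfolding row_set_def s2 by auto
    have full2: "\<forall>i\<in>{1..n}. rmem \<sigma>2 ''full'' [i] = v i G" using full s2 by simp
    note fc = run_find_claim[OF rd2 full2, folded \<sigma>3_def, unfolded abs2]
    have fr3: "nmem \<sigma>3 ''act'' = nmem \<sigma>2 ''act''" "nmem \<sigma>3 ''owner'' = nmem \<sigma>2 ''owner''"
      "nmem \<sigma>3 ''piece'' = nmem \<sigma>2 ''piece''" "nmem \<sigma>3 ''left'' = nmem \<sigma>2 ''left''"
      by (simp_all add: \<sigma>3_def find_claim_def run_frame del: run.simps)
    have abs3: "active \<sigma>3 = active \<sigma>" "bundle_of \<sigma>3 = bundle_of \<sigma>" "piece \<sigma>3 = insert g (piece \<sigma>)" "left \<sigma>3 = left \<sigma> - {g}"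
      using abs2 active_cong[OF fr3(1)] bundle_of_cong[OF fr3(2)] row_set_cong[OF fr3(3)] row_set_cong[OF fr3(4)] by metis+
    have ow3: "nmem \<sigma>3 ''owner'' = nmem \<sigma> ''owner''" using fr3 s2 by simp
    have free: "\<forall>h\<in>piece \<sigma> \<union> left \<sigma>. nmem \<sigma> ''owner'' [h] = 0" and nb: "\<forall>i\<in>active \<sigma>. bundle_of \<sigma> i = {}"
      using un unfolding unassigned_def by blast+
    show ?thesis
    proof (cases "nmem \<sigma>3 ''claim'' [] = 0")
      case c: True
      then have \<tau>3: "\<tau> = \<sigma>3" unfolding \<tau> by simp
      have "0 \<notin> active \<sigma>" by (simp add: active_def)
      then have all: "\<forall>i\<in>active \<sigma>. v i (insert g (piece \<sigma>)) < share i G" using fc c by metis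
      have "knife_step n v G (knife_state A \<sigma>) (knife_state A \<tau>)"
        unfolding \<tau>3 knife_state_def abs3
        by (rule knife_step.extend) (use True all in \<open>auto simp: share_def\<close>)
      moreover have "insert g (piece \<sigma>) \<union> (left \<sigma> - {g}) = piece \<sigma> \<union> left \<sigma>" using True by blast
      then have "unassigned \<tau> (piece \<tau> \<union> left \<tau>)"
        unfolding \<tau>3 unassigned_def abs3 ow3 using free nb by simp
      ultimately show ?thesis using A dj unfolding \<tau>3 abs3 by auto
    next
      case c: False
      define a where "a = nmem \<sigma>3 ''claim'' []"
      have a: "a \<in> active \<sigma>" "share a G \<le> v a (insert g (piece \<sigma>))" using fc c unfolding a_def by auto
      have an: "a \<in> {1..n}" using a(1) by (simp add: active_def)
      have \<tau>g: "\<tau> = R give_piece \<sigma>3" unfolding \<tau> using c by simp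
      have fr3': "\<forall>h\<in>piece \<sigma>3. nmem \<sigma>3 ''owner'' [h] = 0" unfolding abs3 ow3 using free True by simp
      note gp = run_give_piece[OF rd3 a_def[symmetric] an fr3', folded \<tau>g]
      have "nmem \<tau> ''left'' = nmem \<sigma>3 ''left''" unfolding \<tau>g by (simp add: give_piece_def run_frame del: run.simps)
      then have lt: "left \<tau> = left \<sigma> - {g}" using abs3(4) row_set_cong by metis
      have bd: "bundle_of \<tau> = (bundle_of \<sigma>)(a := insert g (piece \<sigma>))"
        using gp(3) nb a(1) unfolding abs3 by simp
      have "knife_state A \<tau> = ({}, left \<sigma> - {g}, active \<sigma> - {a},
          (\<lambda>i. if i \<in> A then bundle_of \<sigma> i else {})(a := insert g (piece \<sigma>)))"
        unfolding knife_state_def gp(1,2) lt bd abs3 using a(1) A by (auto simp: fun_eq_iff)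
      moreover have "knife_step n v G (knife_state A \<sigma>) ({}, left \<sigma> - {g}, active \<sigma> - {a},
          (\<lambda>i. if i \<in> A then bundle_of \<sigma> i else {})(a := insert g (piece \<sigma>)))"
        unfolding knife_state_def
        by (rule knife_step.assign) (use True a in \<open>auto simp: share_def\<close>)
      ultimately have st: "knife_step n v G (knife_state A \<sigma>) (knife_state A \<tau>)" by simp
      have "unassigned \<tau> (piece \<tau> \<union> left \<tau>)"
        unfolding unassigned_def gp(1,2) lt bd
      proof (intro conjI ballI)
        fix i assume "i \<in> active \<sigma>3 - {a}"
        then show "((bundle_of \<sigma>)(a := insert g (piece \<sigma>))) i = {}" using nb abs3 by simp
      next
        fix h assume h: "h \<in> {} \<union> (left \<sigma> - {g})"
        have "h \<in> {1..m}" using h by (simp add: row_set_def)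
        moreover have "h \<notin> piece \<sigma>3" unfolding abs3 using h dj by blast
        ultimately have "nmem \<tau> ''owner'' [h] = nmem \<sigma> ''owner'' [h]" using gp(4) ow3 by simp
        then show "nmem \<tau> ''owner'' [h] = 0" using free h by simp
      qed
      then show ?thesis using st A a(1) unfolding gp(1,2) abs3 lt bd by auto
    qed
  qed
qed

lemma nupd_knife_state [simp]:
  "x \<notin> {''act'', ''owner'', ''piece'', ''left''} \<Longrightarrow> knife_state A (nupd x ks a \<sigma>) = knife_state A \<sigma>"
  by (auto simp: knife_state_def fun_eq_iff)

text \<open>Goods are cut in the order of their numbers, one of the orders that the relation allows.
  After the last one there is no good left or no active agent, which are the final states by
  \<open>knife_final\<close>.\<close>

lemma run_knife:
  assumes rd: "ready \<sigma>" and un: "unassigned \<sigma> (goods \<sigma>)"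
    and loop: "loop_result (single_good_step n v) ({1..m} - \<pi> ` {1..n}, {1..n}, \<lambda>_. {}) (single_state \<sigma>)"
  shows "round_bundles n m v \<pi> (bundle_of (R knife \<sigma>))"
proof -
  define G where "G = goods \<sigma>"
  define A where "A = active \<sigma>"
  define B where "B = bundle_of \<sigma>"
  define \<sigma>1 where "\<sigma>1 = R init_knife \<sigma>"
  define \<sigma>2 where "\<sigma>2 = R (For ''g'' ''m'' cut_good) \<sigma>1"
  let ?last = "When (NZ (NVar ''left'' [NV ''g''])) (SetN ''owner'' [NV ''g''] (NV ''last''))"
  let ?fin = "For ''g'' ''m'' ?last"
  have R: "R knife \<sigma> = R ?fin \<sigma>2" by (simp add: knife_def \<sigma>1_def \<sigma>2_def)
  have rd1: "ready \<sigma>1" unfolding \<sigma>1_def using rd by (rule ready_run) (simp_all add: init_knife_def find_active_def)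
  have rd2: "ready \<sigma>2" unfolding \<sigma>2_def using rd1 by (rule ready_run) (simp_all add: bundle_defs)
  have fr1: "nmem \<sigma>1 ''act'' = nmem \<sigma> ''act''" "nmem \<sigma>1 ''owner'' = nmem \<sigma> ''owner''"
    by (simp_all add: \<sigma>1_def init_knife_def find_active_def run_frame del: run.simps)
  note ik = run_init_knife[OF rd, folded \<sigma>1_def]
  have abs1: "active \<sigma>1 = A" "bundle_of \<sigma>1 = B" "left \<sigma>1 = G"
    using active_cong[OF fr1(1)] bundle_of_cong[OF fr1(2)] ik by (simp_all add: A_def B_def G_def)
  have nb: "\<forall>i\<in>A. B i = {}" and free: "\<forall>g\<in>G. nmem \<sigma> ''owner'' [g] = 0"
    using un unfolding unassigned_def A_def B_def G_def by blast+
  have st1: "knife_state A \<sigma>1 = ({}, G, A, \<lambda>_. {})"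
    unfolding knife_state_def abs1 ik(2) using nb by (auto simp: fun_eq_iff)
  have un1: "unassigned \<sigma>1 (piece \<sigma>1 \<union> left \<sigma>1)"
    unfolding unassigned_def abs1 ik(2) fr1 using nb free by simp
  let ?I = "\<lambda>k (\<tau>::mem). unassigned \<tau> (piece \<tau> \<union> left \<tau>) \<and> piece \<tau> \<inter> left \<tau> = {} \<and> active \<tau> \<subseteq> A \<and>
     (\<forall>i. i \<notin> A \<longrightarrow> bundle_of \<tau> i = B i) \<and> (left \<tau> \<inter> {1..k} = {} \<or> active \<tau> = {}) \<and>
     (knife_step n v G)\<^sup>*\<^sup>* ({}, G, A, \<lambda>_. {}) (knife_state A \<tau>)"
  have "?I m \<sigma>2"
    unfolding \<sigma>2_def
  proof (rule For_induct[where I = ?I])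
    fix k \<tau> assume I: "?I k \<tau>" and k: "k < m" "nmem \<tau> ''g'' [] = Suc k"
      and fr: "frame (For ''g'' ''m'' cut_good) \<sigma>1 \<tau>"
    have rdt: "ready \<tau>" using rd1 fr by (rule ready_frame) (simp_all add: bundle_defs)
    have "rmem \<tau> ''full'' = rmem \<sigma>1 ''full''" using frameD[OF fr] by (simp add: bundle_defs)
    then have full: "\<forall>i\<in>{1..n}. rmem \<tau> ''full'' [i] = v i G" using ik(1) by (simp add: G_def)
    have I': "unassigned \<tau> (piece \<tau> \<union> left \<tau>)" "piece \<tau> \<inter> left \<tau> = {}" "active \<tau> \<subseteq> A"
      "\<forall>i. i \<notin> A \<longrightarrow> bundle_of \<tau> i = B i" "left \<tau> \<inter> {1..k} = {} \<or> active \<tau> = {}"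
      "(knife_step n v G)\<^sup>*\<^sup>* ({}, G, A, \<lambda>_. {}) (knife_state A \<tau>)" using I by blast+
    have km: "Suc k \<in> {1..m}" using k by simp
    let ?\<tau> = "R cut_good \<tau>"
    have c: "unassigned ?\<tau> (piece ?\<tau> \<union> left ?\<tau>)" "piece ?\<tau> \<inter> left ?\<tau> = {}" "active ?\<tau> \<subseteq> A"
      "\<forall>i. i \<notin> A \<longrightarrow> bundle_of ?\<tau> i = bundle_of \<tau> i" "left ?\<tau> \<subseteq> left \<tau>" "active ?\<tau> \<subseteq> active \<tau>"
      "Suc k \<notin> left ?\<tau> \<or> active ?\<tau> = {}" "(knife_step n v G)\<^sup>*\<^sup>* (knife_state A \<tau>) (knife_state A ?\<tau>)"
      using run_cut_good[OF rdt full k(2) km I'(1,2,3)] by - (elim conjE, assumption)+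
    have ins: "{1..Suc k} = insert (Suc k) {1..k}" by auto
    have "left ?\<tau> \<inter> {1..Suc k} = {} \<or> active ?\<tau> = {}"
    proof (cases "active ?\<tau> = {}")
      case False
      then have "left \<tau> \<inter> {1..k} = {}" "Suc k \<notin> left ?\<tau>" using I'(5) c(6,7) by auto
      then show ?thesis unfolding ins using c(5) by blast
    qed simp
    moreover have "\<forall>i. i \<notin> A \<longrightarrow> bundle_of ?\<tau> i = B i" using c(4) I'(4) by simp
    moreover have "(knife_step n v G)\<^sup>*\<^sup>* ({}, G, A, \<lambda>_. {}) (knife_state A ?\<tau>)" using I'(6) c(8) by (rule rtranclp_trans)
    ultimately show "?I (Suc k) ?\<tau>" using c(1-3) by (intro conjI)
  qed (use readyD[OF rd1] un1 in \<open>simp_all add: bundle_defs st1 abs1 ik(2)\<close>)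
  then have I: "unassigned \<sigma>2 (piece \<sigma>2 \<union> left \<sigma>2)" "active \<sigma>2 \<subseteq> A"
      "\<forall>i. i \<notin> A \<longrightarrow> bundle_of \<sigma>2 i = B i" "left \<sigma>2 \<inter> {1..m} = {} \<or> active \<sigma>2 = {}"
      "(knife_step n v G)\<^sup>*\<^sup>* ({}, G, A, \<lambda>_. {}) (knife_state A \<sigma>2)" by blast+
  have "left \<sigma>2 \<inter> {1..m} = left \<sigma>2" by (auto simp: row_set_def)
  then have stop: "left \<sigma>2 = {} \<or> active \<sigma>2 = {}" using I(4) by simp
  define l where "l = (if A = {} then 1 else Max A)"
  have l: "nmem \<sigma>2 ''last'' [] = l"
    using ik(4) by (simp add: l_def A_def \<sigma>2_def run_frame bundle_defs del: run.simps)
  have ln: "l \<in> {1..n}" using n_pos Max_active(1)[of \<sigma>] by (simp add: l_def A_def)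
  have ow: "nmem (R ?fin \<sigma>2) ''owner'' = (\<lambda>ks. if \<exists>g\<in>{1..m}. ks = [] @ [g]
      then (if nmem \<sigma>2 ''left'' [last ks] \<noteq> 0 then l else nmem \<sigma>2 ''owner'' [last ks]) else nmem \<sigma>2 ''owner'' ks)"
  proof (rule For_nset)
    fix k \<tau> assume k: "nmem \<tau> ''g'' [] = k" and fr: "frame ?fin \<sigma>2 \<tau>"
      and old: "nmem \<tau> ''owner'' ([] @ [k]) = nmem \<sigma>2 ''owner'' ([] @ [k])"
    have "nmem \<tau> ''left'' = nmem \<sigma>2 ''left''" "nmem \<tau> ''last'' [] = l" using frameD[OF fr] l by simp_all
    then show "nmem (R ?last \<tau>) ''owner'' = (nmem \<tau> ''owner'')([] @ [k] :=
        (if nmem \<sigma>2 ''left'' [k] \<noteq> 0 then l else nmem \<sigma>2 ''owner'' [k]))" using k old by auto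
  qed (use readyD[OF rd2] in simp_all)
  have own: "nmem (R ?fin \<sigma>2) ''owner'' [g] = (if g \<in> left \<sigma>2 then l else nmem \<sigma>2 ''owner'' [g])" if "g \<in> {1..m}" for g
    unfolding ow using that by (simp add: row_set_def)
  have free2: "\<forall>g\<in>left \<sigma>2. nmem \<sigma>2 ''owner'' [g] = 0" using I(1) unfolding unassigned_def by blast
  have lm: "left \<sigma>2 \<subseteq> {1..m}" by (auto simp: row_set_def)
  have bd: "bundle_of (R knife \<sigma>) = (bundle_of \<sigma>2)(l := bundle_of \<sigma>2 l \<union> left \<sigma>2)"
  proof
    fix i
    show "bundle_of (R knife \<sigma>) i = ((bundle_of \<sigma>2)(l := bundle_of \<sigma>2 l \<union> left \<sigma>2)) i"
      unfolding R using own lm ln free2 by (cases "i = l") (auto simp: bundle_of_def)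
  qed
  have "if A = {} then \<exists>h\<in>{1..n}. bundle_of (R knife \<sigma>) = B(h := B h \<union> G)
      else \<exists>P. moving_knife n v G A P \<and> bundle_of (R knife \<sigma>) = (\<lambda>i. if i \<in> A then P i else B i)"
  proof (cases "A = {}")
    case True
    \<comment> \<open>Without agents the initial state of the knife is final, so the cutting loop
      has changed nothing and all of \<open>G\<close> goes to agent \<open>l = 1\<close>.\<close>
    have "\<not> knife_step n v G ({}, G, A, \<lambda>_. {}) s'" for s' using knife_final[of G "{}" G A "\<lambda>_. {}"] True by blast
    then have "knife_state A \<sigma>2 = ({}, G, A, \<lambda>_. {})" using I(5) by (metis converse_rtranclpE)
    then have "left \<sigma>2 = G" by (simp add: knife_state_def)
    moreover have "bundle_of \<sigma>2 = B" using I(3) True by auto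
    ultimately show ?thesis using True bd ln by auto
  next
    case False
    define P0 where "P0 = (\<lambda>i. if i \<in> A then bundle_of \<sigma>2 i else {})"
    have "loop_result (knife_step n v G) ({}, G, A, \<lambda>_. {}) (piece \<sigma>2, left \<sigma>2, active \<sigma>2, P0)"
      unfolding loop_result_def knife_final using I(5) stop by (simp add: knife_state_def P0_def)
    then have mk: "moving_knife n v G A (P0(Max A := P0 (Max A) \<union> left \<sigma>2))"
      unfolding moving_knife_def by blast
    have "Max A \<in> A" using False finite_active by (simp add: A_def)
    then have "bundle_of (R knife \<sigma>) = (\<lambda>i. if i \<in> A then (P0(Max A := P0 (Max A) \<union> left \<sigma>2)) i else B i)"
      unfolding bd using False I(3) by (auto simp: l_def P0_def fun_eq_iff)
    then show ?thesis using mk False by auto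
  qed
  then show ?thesis using loop unfolding round_bundles_def single_state_def A_def B_def G_def by blast
qed

section \<open>Correctness of the threshold update\<close>

lemma run_update_agent:
  assumes rd: "ready \<sigma>" and i: "nmem \<sigma> ''i'' [] = i" "i \<in> {1..n}"
  shows "gamma (R update_agent \<sigma>) = (gamma \<sigma>)(i := if v i (bundle_of \<sigma> i) < gamma \<sigma> i
      then (1 - 1 / real m) * gamma \<sigma> i else gamma \<sigma> i)"
    "nmem (R update_agent \<sigma>) ''flag'' [] = (if v i (bundle_of \<sigma> i) < gamma \<sigma> i then 1 else nmem \<sigma> ''flag'' [])"
proof -
  let ?a1 = "Test (NEq (NVar ''owner'' [NV ''g'']) (NV ''i''))
    (SetN ''piece'' [NV ''g''] (NConst 1)) (SetN ''piece'' [NV ''g''] (NConst 0))"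
  let ?a = "For ''g'' ''m'' ?a1"
  let ?ask = "Ask ''val'' [] (NV ''i'') ''piece'' []"
  define \<sigma>1 where "\<sigma>1 = R ?a \<sigma>"
  define \<sigma>2 where "\<sigma>2 = R ?ask \<sigma>1"
  have a: "nmem \<sigma>1 ''piece'' = (\<lambda>ks. if \<exists>g\<in>{1..m}. ks = [] @ [g]
      then (if nmem \<sigma> ''owner'' [last ks] = i then 1 else 0) else nmem \<sigma> ''piece'' ks)"
    unfolding \<sigma>1_def
  proof (rule For_nset)
    fix k \<tau> assume "nmem \<tau> ''g'' [] = k" "frame ?a \<sigma> \<tau>"
    then show "nmem (R ?a1 \<tau>) ''piece'' = (nmem \<tau> ''piece'')([] @ [k] := (if nmem \<sigma> ''owner'' [k] = i then 1 else 0))"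
      using frameD[of ?a \<sigma> \<tau>] i by auto
  qed (use readyD[OF rd] in simp_all)
  have p: "piece \<sigma>1 = bundle_of \<sigma> i" unfolding row_set_def a using i(2) by (auto simp: bundle_of_def)
  have s1: "nmem \<sigma>1 ''i'' [] = i" "nmem \<sigma>1 ''m'' [] = m" "nmem \<sigma>1 ''flag'' = nmem \<sigma> ''flag''"
    "rmem \<sigma>1 ''thr'' = rmem \<sigma> ''thr''"
    using i readyD[OF rd] by (simp_all add: \<sigma>1_def run_frame del: run.simps)
  have s2: "nmem \<sigma>2 = nmem \<sigma>1" "rmem \<sigma>2 ''thr'' = rmem \<sigma> ''thr''" "rmem \<sigma>2 ''val'' [] = v i (bundle_of \<sigma> i)"
    using s1 p by (simp_all add: \<sigma>2_def)
  have R: "R update_agent \<sigma> = R (When (RLess (RV ''val'') (RVar ''thr'' [NV ''i'']))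
    (SetR ''thr'' [NV ''i''] (RMul (RSub (RNat (NConst 1)) (RDiv (RNat (NConst 1)) (RNat (NV ''m''))))
        (RVar ''thr'' [NV ''i''])) ;; SetV ''flag'' (NConst 1))) \<sigma>2"
    by (simp add: update_agent_def \<sigma>1_def \<sigma>2_def)
  show "gamma (R update_agent \<sigma>) = (gamma \<sigma>)(i := if v i (bundle_of \<sigma> i) < gamma \<sigma> i
      then (1 - 1 / real m) * gamma \<sigma> i else gamma \<sigma> i)"
    unfolding R using s1 s2 by (auto simp: gamma_def fun_eq_iff)
  show "nmem (R update_agent \<sigma>) ''flag'' [] = (if v i (bundle_of \<sigma> i) < gamma \<sigma> i then 1 else nmem \<sigma> ''flag'' [])"
    unfolding R using s1 s2 by (simp add: gamma_def)
qed

lemma run_update_thresholds: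
  assumes rd: "ready \<sigma>" and inj: "inj_on (mate \<sigma>) {1..n}"
  defines "\<tau> \<equiv> R update_thresholds \<sigma>"
  defines "U \<equiv> {i\<in>{1..n}. v i (bundle_of \<sigma> i) < gamma \<sigma> i}"
  shows "gamma \<tau> = (\<lambda>i. if i \<in> U then (1 - 1 / real m) * gamma \<sigma> i else gamma \<sigma> i)"
    "nmem \<tau> ''flag'' [] = 0 \<longleftrightarrow> U = {}"
    "i \<in> {1..n} \<Longrightarrow> nmem \<tau> ''owner'' [mate \<sigma> i] = i"
    "g \<notin> mate \<sigma> ` {1..n} \<Longrightarrow> nmem \<tau> ''owner'' [g] = nmem \<sigma> ''owner'' [g]"
proof -
  define \<sigma>1 where "\<sigma>1 = R (SetV ''flag'' (NConst 0)) \<sigma>"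
  define \<sigma>2 where "\<sigma>2 = R (For ''i'' ''n'' update_agent) \<sigma>1"
  let ?c1 = "SetN ''owner'' [NVar ''mate'' [NV ''i'']] (NV ''i'')"
  let ?c = "For ''i'' ''n'' ?c1"
  have \<tau>: "\<tau> = R ?c \<sigma>2" by (simp add: \<tau>_def update_thresholds_def \<sigma>1_def \<sigma>2_def)
  have rd1: "ready \<sigma>1" unfolding \<sigma>1_def using rd by (rule ready_run) simp_all
  have rd2: "ready \<sigma>2" unfolding \<sigma>2_def using rd1 by (rule ready_run) (simp_all add: update_agent_def)
  have s1: "gamma \<sigma>1 = gamma \<sigma>" "nmem \<sigma>1 ''flag'' [] = 0" "nmem \<sigma>1 ''owner'' = nmem \<sigma> ''owner''"
    by (simp_all add: \<sigma>1_def gamma_def fun_eq_iff)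
  let ?I = "\<lambda>k (\<tau>::mem). gamma \<tau> = (\<lambda>i. if i \<in> U \<inter> {1..k} then (1 - 1 / real m) * gamma \<sigma> i else gamma \<sigma> i) \<and>
     (nmem \<tau> ''flag'' [] = 0 \<longleftrightarrow> U \<inter> {1..k} = {})"
  have I: "?I n \<sigma>2"
    unfolding \<sigma>2_def
  proof (rule For_induct[where I = ?I])
    fix k \<tau> assume I: "?I k \<tau>" and k: "k < n" "nmem \<tau> ''i'' [] = Suc k"
      and fr: "frame (For ''i'' ''n'' update_agent) \<sigma>1 \<tau>"
    have rdt: "ready \<tau>" using rd1 fr by (rule ready_frame) (simp_all add: update_agent_def)
    have "nmem \<tau> ''owner'' = nmem \<sigma> ''owner''" using frameD[OF fr] s1 by (simp add: update_agent_def)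
    then have b: "bundle_of \<tau> = bundle_of \<sigma>" by (rule bundle_of_cong)
    have kn: "Suc k \<in> {1..n}" using k by simp
    note ua = run_update_agent[OF rdt k(2) kn, unfolded b]
    have g: "gamma \<tau> (Suc k) = gamma \<sigma> (Suc k)" using I by simp
    have U: "v (Suc k) (bundle_of \<sigma> (Suc k)) < gamma \<sigma> (Suc k) \<longleftrightarrow> Suc k \<in> U" using kn by (simp add: U_def)
    have ins: "{1..Suc k} = insert (Suc k) {1..k}" by auto
    show "?I (Suc k) (R update_agent \<tau>)"
    proof
      show "gamma (R update_agent \<tau>) = (\<lambda>i. if i \<in> U \<inter> {1..Suc k} then (1 - 1 / real m) * gamma \<sigma> i else gamma \<sigma> i)"
        unfolding ua(1) g U ins using I by (auto simp: fun_eq_iff)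
      show "nmem (R update_agent \<tau>) ''flag'' [] = 0 \<longleftrightarrow> U \<inter> {1..Suc k} = {}"
        unfolding ua(2) g U ins using I by auto
    qed
  qed (use readyD[OF rd1] s1 in \<open>simp_all add: update_agent_def gamma_def fun_eq_iff\<close>)
  have Un: "U \<inter> {1..n} = U" by (auto simp: U_def)
  have fr: "rmem \<tau> ''thr'' = rmem \<sigma>2 ''thr''" "nmem \<tau> ''flag'' = nmem \<sigma>2 ''flag''"
    by (simp_all add: \<tau> run_frame del: run.simps)
  have "gamma \<tau> = gamma \<sigma>2" using fr(1) by (simp add: gamma_def fun_eq_iff)
  then show "gamma \<tau> = (\<lambda>i. if i \<in> U then (1 - 1 / real m) * gamma \<sigma> i else gamma \<sigma> i)"
    using I Un by simp
  show "nmem \<tau> ''flag'' [] = 0 \<longleftrightarrow> U = {}" using I Un fr(2) by simp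
  have s2: "nmem \<sigma>2 ''owner'' = nmem \<sigma> ''owner''" "nmem \<sigma>2 ''mate'' = nmem \<sigma> ''mate''"
    by (simp_all add: \<sigma>2_def \<sigma>1_def update_agent_def run_frame del: run.simps)
  let ?J = "\<lambda>k (\<tau>::mem). (\<forall>i\<in>{1..k}. nmem \<tau> ''owner'' [mate \<sigma> i] = i) \<and>
     (\<forall>g. g \<notin> mate \<sigma> ` {1..k} \<longrightarrow> nmem \<tau> ''owner'' [g] = nmem \<sigma> ''owner'' [g])"
  have J: "?J n \<tau>"
    unfolding \<tau>
  proof (rule For_induct[where I = ?J])
    fix k \<tau> assume J: "?J k \<tau>" and k: "k < n" "nmem \<tau> ''i'' [] = Suc k" and fr: "frame ?c \<sigma>2 \<tau>"
    have "nmem \<tau> ''mate'' = nmem \<sigma> ''mate''" using frameD[OF fr] s2 by simp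
    then have o: "nmem (R ?c1 \<tau>) ''owner'' = (nmem \<tau> ''owner'')([mate \<sigma> (Suc k)] := Suc k)" using k by simp
    \<comment> \<open>By injectivity no later write destroys an owner entered before.\<close>
    have ne: "mate \<sigma> i \<noteq> mate \<sigma> (Suc k)" if "i \<in> {1..k}" for i
      using inj_onD[OF inj, of i "Suc k"] that k(1) by auto
    have ins: "{1..Suc k} = insert (Suc k) {1..k}" by auto
    show "?J (Suc k) (R ?c1 \<tau>)" unfolding o ins using J ne by auto
  qed (use readyD[OF rd2] s2 in simp_all)
  show "i \<in> {1..n} \<Longrightarrow> nmem \<tau> ''owner'' [mate \<sigma> i] = i" using J by blast
  show "g \<notin> mate \<sigma> ` {1..n} \<Longrightarrow> nmem \<tau> ''owner'' [g] = nmem \<sigma> ''owner'' [g]" using J by blast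
qed

section \<open>The program follows a run of the algorithm\<close>

definition simulates :: "nat \<Rightarrow> mem \<Rightarrow> bool" where
  "simulates t \<sigma> \<longleftrightarrow> ready \<sigma> \<and> (\<exists>s. alg_run n m v t s \<and> thr s = gamma \<sigma> \<and>
     (nmem \<sigma> ''flag'' [] = 0 \<longleftrightarrow> unsat s = {}) \<and> (unsat s = {} \<longrightarrow> bundles s = output_bundles m \<sigma>))"

text \<open>Before the first round every good has owner 0, so \<open>output_bundles\<close> is
  nonempty at index 0 while the initial state has empty bundles everywhere. For this reason
  \<open>simulates\<close> compares bundles only when all agents are satisfied.\<close>

lemma simulates_initialize:
  assumes "nmem \<sigma> ''n'' [] = n" "nmem \<sigma> ''m'' [] = m" "\<And>ks. nmem \<sigma> ''unit'' ks = 0"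
  shows "simulates 0 (R initialize \<sigma>)"
proof -
  note i = run_initialize[OF assms]
  let ?s = "\<lparr>thr = gamma (R initialize \<sigma>), unsat = {1..n}, bundles = \<lambda>_. {}\<rparr>"
  have "alg_init n m v ?s"
    using i(3) unfolding alg_init_def gamma_def initial_threshold_def by simp
  then have "alg_run n m v 0 ?s" by (rule alg_run.init)
  then show ?thesis using i(1,2) n_pos unfolding simulates_def by (intro conjI exI[of _ ?s]) simp_all
qed

lemma simulates_round:
  assumes sim: "simulates t \<sigma>" and flag: "nmem \<sigma> ''flag'' [] \<noteq> 0"
  shows "simulates (Suc t) (R alg_round \<sigma>)"
proof -
  obtain s where rd: "ready \<sigma>" and run: "alg_run n m v t s" and thr: "thr s = gamma \<sigma>" and us: "unsat s \<noteq> {}"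
    using sim flag unfolding simulates_def by blast
  define \<sigma>1 where "\<sigma>1 = R find_matching \<sigma>"
  define \<sigma>2 where "\<sigma>2 = R singles \<sigma>1"
  define \<sigma>3 where "\<sigma>3 = R knife \<sigma>2"
  define \<tau> where "\<tau> = R update_thresholds \<sigma>3"
  have R: "R alg_round \<sigma> = \<tau>" by (simp add: alg_round_def \<sigma>1_def \<sigma>2_def \<sigma>3_def \<tau>_def)
  have rd1: "ready \<sigma>1" unfolding \<sigma>1_def using rd by (rule ready_run) (simp_all add: matching_defs)
  have rd2: "ready \<sigma>2" unfolding \<sigma>2_def using rd1 by (rule ready_run) (simp_all add: bundle_defs)
  have rd3: "ready \<sigma>3" unfolding \<sigma>3_def using rd2 by (rule ready_run) (simp_all add: bundle_defs)
  have rdt: "ready \<tau>" unfolding \<tau>_def using rd3 by (rule ready_run) (simp_all add: bundle_defs)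
  define \<pi> where "\<pi> = mate \<sigma>1"
  have \<pi>: "max_weight_matching n m v (thr s) \<pi>" unfolding \<pi>_def \<sigma>1_def thr using run_find_matching[OF rd] .
  then have mt: "matching n m \<pi>" by (simp add: max_weight_matching_def)
  then have inj: "inj_on \<pi> {1..n}" and \<pi>m: "\<pi> ` {1..n} \<subseteq> {1..m}" by (auto simp: matching_def)
  define B where "B = bundle_of \<sigma>3"
  have B: "round_bundles n m v \<pi> B"
    unfolding B_def \<sigma>3_def using run_knife[OF rd2] run_singles[OF rd1] unfolding \<sigma>2_def \<pi>_def by blast
  have fr: "rmem \<sigma>3 ''thr'' = rmem \<sigma> ''thr''" "nmem \<sigma>3 ''mate'' = nmem \<sigma>1 ''mate''"
    by (simp_all add: \<sigma>3_def \<sigma>2_def \<sigma>1_def matching_defs bundle_defs run_frame del: run.simps)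
  have g3: "gamma \<sigma>3 = gamma \<sigma>" and m3: "mate \<sigma>3 = \<pi>" and m3': "mate \<sigma>3 j = \<pi> j" for j
    using fr by (simp_all add: gamma_def fun_eq_iff \<pi>_def)
  note up = run_update_thresholds[OF rd3 inj[folded m3], folded \<tau>_def B_def, unfolded g3 m3 m3']
  define U where "U = {i\<in>{1..n}. v i (B i) < gamma \<sigma> i}"
  let ?C = "\<lambda>i. if i \<in> {1..n} then B i \<union> {\<pi> i} else {}"
  note rb = round_bundles_result[OF mt B]
  \<comment> \<open>The equation is needed for all naturals \<open>i\<close>: outside
    \<open>{1..n}\<close> it says that no good is left without an agent as owner.\<close>
  have out: "output_bundles m \<tau> i = ?C i" for i
  proof -
    have matched: "nmem \<tau> ''owner'' [\<pi> j] = j" if "j \<in> {1..n}" for j using up(3)[of j] that by simp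
    have other: "nmem \<tau> ''owner'' [g] = nmem \<sigma>3 ''owner'' [g]" "nmem \<sigma>3 ''owner'' [g] \<in> {1..n}"
      if "g \<in> {1..m} - \<pi> ` {1..n}" for g
    proof -
      show "nmem \<tau> ''owner'' [g] = nmem \<sigma>3 ''owner'' [g]" using up(4)[of g] that by blast
      have "g \<in> (\<Union>i\<in>{1..n}. B i)" unfolding rb(1) by (rule that)
      then obtain j where j: "j \<in> {1..n}" "g \<in> B j" by (rule UN_E)
      then have "nmem \<sigma>3 ''owner'' [g] = j" by (simp add: B_def bundle_of_def split: if_splits)
      then show "nmem \<sigma>3 ''owner'' [g] \<in> {1..n}" using j(1) by simp
    qed
    have Bi: "g \<in> B i \<longleftrightarrow> nmem \<sigma>3 ''owner'' [g] = i" if "i \<in> {1..n}" "g \<in> {1..m}" for g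
      using that by (simp add: B_def bundle_of_def)
    have "g \<in> output_bundles m \<tau> i \<longleftrightarrow> g \<in> ?C i" for g
    proof (cases "g \<in> {1..m}")
      case False
      have "?C i \<subseteq> {1..m}"
      proof (cases "i \<in> {1..n}")
        case True
        then have "B i \<subseteq> {1..m} - \<pi> ` {1..n}" unfolding rb(1)[symmetric] by (rule UN_upper)
        moreover have "\<pi> i \<in> {1..m}" using \<pi>m True by (rule subsetD[OF _ imageI])
        ultimately show ?thesis using True by (simp add: subset_iff)
      next
        case False
        then show ?thesis by (simp only: if_False empty_subsetI)
      qed
      then have "g \<notin> ?C i" using False by blast
      moreover have "g \<notin> output_bundles m \<tau> i" unfolding output_bundles_def using False by blast
      ultimately show ?thesis by blast
    next
      case gm: True
      then have o: "g \<in> output_bundles m \<tau> i \<longleftrightarrow> nmem \<tau> ''owner'' [g] = i" by (simp add: output_bundles_def)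
      show ?thesis
      proof (cases "g \<in> \<pi> ` {1..n}")
        case True
        then obtain j where j: "j \<in> {1..n}" "g = \<pi> j" by blast
        have "g \<notin> B i" if "i \<in> {1..n}" using rb(1) True that by blast
        moreover have "\<pi> i = \<pi> j \<longleftrightarrow> i = j" if "i \<in> {1..n}" using inj_on_eq_iff[OF inj that j(1)] .
        ultimately show ?thesis using o matched[OF j(1)] j by auto
      next
        case False
        then have "g \<in> {1..m} - \<pi> ` {1..n}" using gm by blast
        note ot = other[OF this]
        have "g \<noteq> \<pi> i" if "i \<in> {1..n}" using False that by blast
        then show ?thesis using o ot Bi gm by auto
      qed
    qed
    then show ?thesis by blast
  qed
  let ?s = "\<lparr>thr = gamma \<tau>, unsat = U, bundles = ?C\<rparr>"
  have "alg_iteration n m v s ?s"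
    unfolding alg_iteration_def alg_state.simps U_def up(1) thr[symmetric]
    using \<pi> B by (intro exI[of _ \<pi>] exI[of _ B] conjI refl)
  then have "alg_run n m v (Suc t) ?s" by (rule alg_run.iter[OF run us])
  then show ?thesis
    unfolding R simulates_def using rdt up(2) out by (intro conjI exI[of _ ?s]) (simp_all add: U_def fun_eq_iff)
qed

lemma simulates_finished:
  assumes "simulates t \<sigma>" "nmem \<sigma> ''flag'' [] = 0"
  shows "alg_output n m v (output_bundles m \<sigma>)"
proof -
  obtain s where "alg_run n m v t s" "unsat s = {}" "bundles s = output_bundles m \<sigma>"
    using assms unfolding simulates_def by auto
  then show ?thesis unfolding alg_output_def by (intro exI[of _ t] exI[of _ s]) simp
qed

text \<open>\<open>T\<close> bounds the length of all runs of the relation, so \<open>T - t\<close>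
  bounds the rounds still possible. When it is 0, the flag must be cleared, since another round
  would extend the simulated run beyond \<open>T\<close>.\<close>

lemma exec_main_loop:
  assumes sim: "simulates t \<sigma>" and T: "\<forall>t s. alg_run n m v t s \<longrightarrow> t \<le> T"
    and C: "C = cost (n + m) alg_round"
  shows "\<exists>u \<sigma>'. exec m v (While (NZ (NV ''flag'')) (compile alg_round)) \<sigma> u \<sigma>' \<and>
    u \<le> 1 + (T - t) * (C + 1) \<and> alg_output n m v (output_bundles m \<sigma>')"
  using sim
proof (induction "T - t" arbitrary: t \<sigma>)
  case 0
  have "nmem \<sigma> ''flag'' [] = 0"
  proof (rule ccontr)
    assume "nmem \<sigma> ''flag'' [] \<noteq> 0"
    with 0 have "simulates (Suc t) (R alg_round \<sigma>)" by (intro simulates_round)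
    then obtain s where "alg_run n m v (Suc t) s" unfolding simulates_def by blast
    then have "Suc t \<le> T" using T by blast
    then show False using 0 by simp
  qed
  then have "alg_output n m v (output_bundles m \<sigma>)" using simulates_finished 0 by blast
  moreover have "exec m v (While (NZ (NV ''flag'')) (compile alg_round)) \<sigma> 1 \<sigma>"
    using \<open>nmem \<sigma> ''flag'' [] = 0\<close> by (intro exec.WhileFalse) simp
  ultimately show ?case by (intro exI[of _ 1] exI[of _ \<sigma>]) simp
next
  case (Suc k)
  show ?case
  proof (cases "nmem \<sigma> ''flag'' [] = 0")
    case True
    then have "alg_output n m v (output_bundles m \<sigma>)" using simulates_finished Suc.prems by blast
    moreover have "exec m v (While (NZ (NV ''flag'')) (compile alg_round)) \<sigma> 1 \<sigma>"
      using True by (intro exec.WhileFalse) simp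
    ultimately show ?thesis by (intro exI[of _ 1] exI[of _ \<sigma>]) simp
  next
    case False
    have rd: "ready \<sigma>" using Suc.prems unfolding simulates_def by blast
    have sim': "simulates (Suc t) (R alg_round \<sigma>)" using simulates_round Suc.prems False by blast
    obtain a where a: "a \<le> C" "exec m v (compile alg_round) \<sigma> a (R alg_round \<sigma>)"
      using exec_compile[OF well_formed_programs(3) bounds_unmodified(5,6), of \<sigma> "n + m" m v] readyD[OF rd] C by auto
    have "k = T - Suc t" using Suc.hyps(2) by simp
    then obtain u \<sigma>' where u: "exec m v (While (NZ (NV ''flag'')) (compile alg_round)) (R alg_round \<sigma>) u \<sigma>'"
      "u \<le> 1 + (T - Suc t) * (C + 1)" "alg_output n m v (output_bundles m \<sigma>')"
      using Suc.hyps(1)[OF _ sim'] by blast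
    have "exec m v (While (NZ (NV ''flag'')) (compile alg_round)) \<sigma> (Suc (a + u)) \<sigma>'"
      using False by (intro exec.WhileTrue[OF _ a(2) u(1)]) simp
    moreover have "Suc (a + u) \<le> 1 + (T - t) * (C + 1)"
    proof -
      have "T - t = Suc (T - Suc t)" using Suc.hyps(2) by simp
      then show ?thesis using a(1) u(2) by simp
    qed
    ultimately show ?thesis using u(3) by blast
  qed
qed

lemma input_mem_simps:
  "nmem (input_mem n m) ''n'' [] = n" "nmem (input_mem n m) ''m'' [] = m" "nmem (input_mem n m) ''unit'' ks = 0"
  by (simp_all add: input_mem_def)

lemma exec_alg_com:
  assumes T: "\<forall>t s. alg_run n m v t s \<longrightarrow> t \<le> T"
  shows "\<exists>u \<sigma>. exec m v alg_com (input_mem n m) u \<sigma> \<and>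
    u \<le> 2 + cost (n + m) initialize + T * (cost (n + m) alg_round + 1) \<and> alg_output n m v (output_bundles m \<sigma>)"
proof -
  let ?\<sigma> = "input_mem n m"
  obtain a where a: "a \<le> cost (n + m) initialize" "exec m v (compile initialize) ?\<sigma> a (R initialize ?\<sigma>)"
    using exec_compile[OF well_formed_programs(2) bounds_unmodified(3,4), of ?\<sigma> "n + m" m v] input_mem_simps by auto
  have "simulates 0 (R initialize ?\<sigma>)" by (rule simulates_initialize) (fact input_mem_simps)+
  from exec_main_loop[OF this T refl] obtain u \<sigma>'
    where u: "exec m v (While (NZ (NV ''flag'')) (compile alg_round)) (R initialize ?\<sigma>) u \<sigma>'"
      "u \<le> 1 + (T - 0) * (cost (n + m) alg_round + 1)" "alg_output n m v (output_bundles m \<sigma>')" by blast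
  have "exec m v alg_com ?\<sigma> (Suc (a + u)) \<sigma>'"
    unfolding alg_com_def
    by (rule exec.CondFalse[OF _ exec.Seq[OF a(2) u(1)]]) (use n_le_m input_mem_simps in simp)
  moreover have "Suc (a + u) \<le> 2 + cost (n + m) initialize + T * (cost (n + m) alg_round + 1)" using a(1) u(2) by simp
  ultimately show ?thesis using u(3) by blast
qed

end

section \<open>Running time\<close>

lemma exec_alg_com_few_goods:
  assumes inst: "subadditive_instance n m v" and "m < n"
  shows "\<exists>u \<sigma>. exec m v alg_com (input_mem n m) u \<sigma> \<and> u \<le> 1 + cost (n + m) give_all \<and>
    nash_approx (8 * real n) n m v (output_bundles m \<sigma>)"
proof -
  let ?\<sigma> = "input_mem n m"
  have s: "nmem ?\<sigma> ''n'' [] = n" "nmem ?\<sigma> ''m'' [] = m" by (simp_all add: input_mem_def)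
  obtain a where a: "a \<le> cost (n + m) give_all" "exec m v (compile give_all) ?\<sigma> a (run m v give_all ?\<sigma>)"
    using exec_compile[OF well_formed_programs(1) bounds_unmodified(1,2), of ?\<sigma> "n + m" m v] s by auto
  have "exec m v alg_com ?\<sigma> (Suc a) (run m v give_all ?\<sigma>)"
    unfolding alg_com_def using \<open>m < n\<close> s by (intro exec.CondTrue[OF _ a(2)]) simp
  moreover have "nmem (run m v give_all ?\<sigma>) ''owner'' =
      (\<lambda>ks. if \<exists>g\<in>{1..m}. ks = [] @ [g] then 1 else nmem ?\<sigma> ''owner'' ks)"
    unfolding give_all_def by (rule For_nset) (use s in simp_all)
  then have "output_bundles m (run m v give_all ?\<sigma>) = (\<lambda>i. if i = 1 then {1..m} else {})"
    by (auto simp: output_bundles_def fun_eq_iff)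
  moreover have "allocation n m (\<lambda>i. if i = 1 then {1..m} else {})"
    unfolding allocation_def using \<open>m < n\<close> by (auto split: if_splits)
  ultimately show ?thesis
    using nash_approx_few_goods[OF inst \<open>m < n\<close>, of _ "8 * real n"] \<open>m < n\<close> a(1)
    by (intro exI[of _ "Suc a"] exI[of _ "run m v give_all ?\<sigma>"]) simp
qed

theorem theorem2:
  shows "\<exists>(c :: com) (p :: real poly). \<forall>n m v. subadditive_instance n m v \<longrightarrow>
    (n \<le> m \<longrightarrow>
       alg_halts_within n m v (poly p (input_size n m v)) \<and>
       (\<forall>B. alg_output n m v B \<longrightarrow> nash_approx (8 * real n) n m v B)) \<and>
    (\<exists>t \<sigma>. exec m v c (input_mem n m) t \<sigma> \<and>
       real t \<le> poly p (input_size n m v) \<and>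
       (n \<le> m \<longrightarrow> alg_output n m v (output_bundles m \<sigma>)) \<and>
       nash_approx (8 * real n) n m v (output_bundles m \<sigma>))"
proof -
  obtain K d K1 d1 K2 d2 where K: "\<And>N. cost N give_all \<le> K * (N + 1) ^ d"
    "\<And>N. cost N initialize \<le> K1 * (N + 1) ^ d1" "\<And>N. cost N alg_round \<le> K2 * (N + 1) ^ d2"
    using cost_polynomial by metis
  \<comment> \<open>The 3 is the degree of the bound \<open>?b \<le> X ^ 3\<close> on the number of
    rounds, and adding the other exponents lets one power dominate every term. The 3 in
    \<open>c\<close> below collects the 2 of \<open>exec_alg_com\<close> and the 1 for the test in
    each round.\<close>
  define D where "D = d + d1 + d2 + 3"
  define c where "c = real (3 + K + K1 + K2)"
  define p where "p = smult c ([:1, 1:] ^ D)"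
  have pp: "poly p s = c * (1 + s) ^ D" for s by (simp add: p_def)
  show ?thesis
  proof (intro exI[of _ alg_com] exI[of _ p] allI impI)
    fix n m v assume inst: "subadditive_instance n m v"
    define s where "s = input_size n m v"
    define X where "X = 1 + s"
    have finr: "0 \<le> value_bits n m v" by (rule value_bits_nonneg)
    then have NX: "real (n + m + 1) \<le> X" by (simp add: X_def s_def input_size_def)
    then have X1: "1 \<le> X" by simp
    have pw: "X ^ e \<le> X ^ D" if "e \<le> D" for e using X1 that by (rule power_increasing[rotated])
    have cst: "real (cost (n + m) q) \<le> real L * X ^ e" if "cost (n + m) q \<le> L * (n + m + 1) ^ e" for q L e
    proof -
      have "real (cost (n + m) q) \<le> real (L * (n + m + 1) ^ e)" using that by (rule of_nat_mono)
      also have "\<dots> = real L * real (n + m + 1) ^ e" by simp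
      also have "\<dots> \<le> real L * X ^ e" using NX by (intro mult_left_mono power_mono) auto
      finally show ?thesis .
    qed
    have XD: "1 \<le> X ^ D" using X1 by simp
    show "(n \<le> m \<longrightarrow>
       alg_halts_within n m v (poly p (input_size n m v)) \<and>
       (\<forall>B. alg_output n m v B \<longrightarrow> nash_approx (8 * real n) n m v B)) \<and>
      (\<exists>t \<sigma>. exec m v alg_com (input_mem n m) t \<sigma> \<and>
       real t \<le> poly p (input_size n m v) \<and>
       (n \<le> m \<longrightarrow> alg_output n m v (output_bundles m \<sigma>)) \<and>
       nash_approx (8 * real n) n m v (output_bundles m \<sigma>))"
      unfolding pp s_def[symmetric] X_def[symmetric]
    proof (cases "n \<le> m")
      case False
      then have "m < n" by simp
      from exec_alg_com_few_goods[OF inst this] obtain u \<sigma> where u: "exec m v alg_com (input_mem n m) u \<sigma>"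
        "u \<le> 1 + cost (n + m) give_all" "nash_approx (8 * real n) n m v (output_bundles m \<sigma>)" by blast
      have "real u \<le> 1 + real (cost (n + m) give_all)" using u(2) by linarith
      also have "real (cost (n + m) give_all) \<le> real K * X ^ d" by (rule cst) (rule K)
      also have "real K * X ^ d \<le> real K * X ^ D" using pw[of d] by (intro mult_left_mono) (auto simp: D_def)
      also have "1 + real K * X ^ D \<le> X ^ D + real K * X ^ D" using XD by simp
      also have "\<dots> \<le> c * X ^ D" using XD by (simp add: c_def algebra_simps)
      finally show "(n \<le> m \<longrightarrow> alg_halts_within n m v (c * X ^ D) \<and>
         (\<forall>B. alg_output n m v B \<longrightarrow> nash_approx (8 * real n) n m v B)) \<and>
        (\<exists>t \<sigma>. exec m v alg_com (input_mem n m) t \<sigma> \<and> real t \<le> c * X ^ D \<and>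
         (n \<le> m \<longrightarrow> alg_output n m v (output_bundles m \<sigma>)) \<and>
         nash_approx (8 * real n) n m v (output_bundles m \<sigma>))" using u False by auto
    next
      case True
      interpret fair_instance n m v using inst True by unfold_locales
      let ?b = "real n * (1 + real m * value_bits n m v) + 1"
      have b3: "?b \<le> X ^ 3"
      proof -
        have le: "real n \<le> s" "real m \<le> s" "value_bits n m v \<le> s" "0 \<le> s"
          using finr by (simp_all add: s_def input_size_def)
        have "?b \<le> s * (1 + s * s) + 1" using le finr by (intro add_mono mult_mono) auto
        also have "\<dots> \<le> X ^ 3" using le by (simp add: X_def power3_eq_cube algebra_simps)
        finally show ?thesis .
      qed
      define T where "T = nat \<lfloor>?b\<rfloor>"
      have T: "\<forall>t s'. alg_run n m v t s' \<longrightarrow> t \<le> T"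
      proof (intro allI impI)
        fix t s' assume "alg_run n m v t s'"
        then show "t \<le> T" using rounds_bound[of t s'] unfolding T_def by linarith
      qed
      have b0: "0 \<le> ?b" using finr by simp
      then have TX: "real T \<le> X ^ 3" using b3 unfolding T_def by linarith
      obtain u \<sigma> where u: "exec m v alg_com (input_mem n m) u \<sigma>"
        "u \<le> 2 + cost (n + m) initialize + T * (cost (n + m) alg_round + 1)" "alg_output n m v (output_bundles m \<sigma>)"
        using exec_alg_com[OF T] by blast
      have "real u \<le> real (2 + cost (n + m) initialize + T * (cost (n + m) alg_round + 1))" using u(2) by (rule of_nat_mono)
      also have "\<dots> = 2 + real (cost (n + m) initialize) + real T * (real (cost (n + m) alg_round) + 1)" by simp
      also have "\<dots> \<le> 2 * X ^ D + real K1 * X ^ D + (real K2 + 1) * X ^ D"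
      proof (intro add_mono)
        show "2 \<le> 2 * X ^ D" using XD by simp
        have "real (cost (n + m) initialize) \<le> real K1 * X ^ d1" by (rule cst) (rule K)
        also have "\<dots> \<le> real K1 * X ^ D" using pw[of d1] by (intro mult_left_mono) (auto simp: D_def)
        finally show "real (cost (n + m) initialize) \<le> real K1 * X ^ D" .
        have "real (cost (n + m) alg_round) \<le> real K2 * X ^ d2" by (rule cst) (rule K)
        moreover have "1 \<le> X ^ d2" using X1 by simp
        ultimately have "real (cost (n + m) alg_round) + 1 \<le> (real K2 + 1) * X ^ d2" by (simp add: algebra_simps)
        then have "real T * (real (cost (n + m) alg_round) + 1) \<le> X ^ 3 * ((real K2 + 1) * X ^ d2)"
          using TX X1 by (intro mult_mono) auto
        also have "\<dots> = (real K2 + 1) * X ^ (3 + d2)" by (simp add: power_add)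
        also have "\<dots> \<le> (real K2 + 1) * X ^ D" using pw[of "3 + d2"] by (intro mult_left_mono) (auto simp: D_def)
        finally show "real T * (real (cost (n + m) alg_round) + 1) \<le> (real K2 + 1) * X ^ D" .
      qed
      also have "\<dots> \<le> c * X ^ D" using XD by (simp add: c_def algebra_simps)
      finally have time: "real u \<le> c * X ^ D" .
      have "X ^ 3 \<le> X ^ D" by (rule pw) (simp add: D_def)
      also have "\<dots> \<le> c * X ^ D" using XD by (simp add: c_def algebra_simps)
      finally have "alg_halts_within n m v (c * X ^ D)" using halts_within b3 by (meson order_trans)
      then show "(n \<le> m \<longrightarrow> alg_halts_within n m v (c * X ^ D) \<and>
         (\<forall>B. alg_output n m v B \<longrightarrow> nash_approx (8 * real n) n m v B)) \<and>
        (\<exists>t \<sigma>. exec m v alg_com (input_mem n m) t \<sigma> \<and> real t \<le> c * X ^ D \<and>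
         (n \<le> m \<longrightarrow> alg_output n m v (output_bundles m \<sigma>)) \<and>
         nash_approx (8 * real n) n m v (output_bundles m \<sigma>))"
        using u time output_approx by blast
    qed
  qed
qed

end
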